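(* Suppose that $P_0$ is a Borel probability measure on $\mathbb R^d$ supported in $B_R(0)$ and satisfying the doubling condition (UD) with constant $D_{\mathrm{UD}}$. Let $\mathcal B\in\mathfrak W_{\sigma,\eta,\rho}$ with $\sigma,\eta,\rho\ge0$. Then for every $q,k,\ell\in\mathbb N_0$ there is a constant $C_{\mathcal B,q,k,\ell}$ (depending only on $q,k,\ell$, on the chosen finite normal-form representation of $\mathcal B$ and its coefficient bounds, and on $D_{\mathrm{UD}}$) such that for every $t>0$, $x\in\mathbb R^d$ and every fixed $w_1,\ldots,w_\ell\in\mathbb R^d$ with $|w_j|\leq1$, $$\left|\partial_t^qD_x^{k+\ell}\mathcal B(t,x)\big[\underbrace{x,\ldots,x}_{k\text{ times}},w_1,\ldots,w_\ell\big]\right|\leq C_{\mathcal B,q,k,\ell}\,e^{-(\sigma+\ell)t/2}\,b(t)^{\eta+2q+k+\ell}(1+R)^{\rho+2q+2k+\ell}.$$ In particular, taking $k=0$, $$\left\lVert\partial_t^qD_x^\ell\mathcal B(t,x)\right\rVert_{\mathrm{op}}\leq C_{\mathcal B,q,\ell}\,e^{-(\sigma+\ell)t/2}\,b(t)^{\eta+2q+\ell}(1+R)^{\rho+2q+\ell}.$$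
   Context: Posterior. For $t>0$, $x\in\mathbb R^d$ let $\mu_{x,t}(dy)\propto\exp\left(-\frac{|x-e^{-t/2}y|^2}{2(1-e^{-t})}\right)P_0(dy)$ (a probability measure), $Y\sim\mu_{x,t}$, $\bar y_{x,t}=\mathbb E_{\mu_{x,t}}[Y]$, $Z=Y-\bar y_{x,t}$. Set $b(t)=(1-e^{-t})^{-1}$. The tensor $\partial_t^qD_x^{n}\mathcal B(t,x)$ is regarded as an $n$-linear map, evaluated on the indicated vectors. Atoms. Admissible vector insertions are built recursively: $\bar y_{x,t}$ is admissible; given admissible insertions $U_1,\dots,U_\ell$ (vector fields of $(t,x)$), $k,\ell\in\mathbb N_0$, $m\in2\mathbb N_0$, define the vector and scalar atoms $$\mathcal M_{k,m}[U_1,\ldots,U_\ell]:=\mathbb E_{\mu_{x,t}}\Big[Z\langle Z,x\rangle^k|Z|^m\prod_{i=1}^{\ell}\langle Z,U_i\rangle\Big],\quad \mathcal S_{k,m}[U_1,\ldots,U_\ell]:=\mathbb E_{\mu_{x,t}}\Big[\langle Z,x\rangle^k|Z|^m\prod_{i=1}^{\ell}\langle Z,U_i\rangle\Big],$$ with each $U_i=U_i(t,x)$ held fixed in the outer expectation (empty product $=1$). Every vector atom is an admissible insertion; only finitely many recursive steps are allowed. Insertion count $K$ and radius degree $\rho(\cdot)$ (assigned to chosen expressions). $K(\bar y_{x,t})=0$, $\rho(\bar y_{x,t})=1$; both $\mathcal S_{k,m}[U_1,\dots,U_\ell]$ and $\mathcal M_{k,m}[U_1,\dots,U_\ell]$ have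 $K=k+\sum_iK(U_i)$; $\rho(\mathcal S_{k,m}[U_1,\dots,U_\ell])=2k+m+\ell+\sum_i\rho(U_i)$ and $\rho(\mathcal M_{k,m}[U_1,\dots,U_\ell])=2k+m+\ell+1+\sum_i\rho(U_i)$. Both are additive over products, with time-dependent coefficients contributing zero. Weighted class. For $\sigma,\eta,\rho\geq0$, a vector field belongs to $\mathfrak W_{\sigma,\eta,\rho}$ if it is a finite sum of elementary monomials $\mathcal B(t,x)=c(t)\big(\prod_{\nu=1}^N\mathcal S_\nu(t,x)\big)\mathcal V(t,x)$, where $c\in C^\infty((0,\infty))$, each $\mathcal S_\nu$ is a scalar atom, $\mathcal V$ is either $\bar y_{x,t}$ or a vector atom, and the chosen representation satisfies $\rho(\mathcal B)\leq\rho$ and, for every $q\in\mathbb N_0$, $|\partial_t^qc(t)|\leq C_qe^{-(K(\mathcal B)+\sigma)t/2}b(t)^{\eta+q}$ for all $t>0$ with $C_q$ independent of $t$. Doubling condition (UD). Let $M=\operatorname{supp}P_0$ (compact). For $\theta\in\mathbb S^{d-1}$ set $U_\theta(y)=\sup_{y'\in M}\langle\theta,y'\rangle-\langle\theta,y\rangle$ and $F_\theta(u)=P_0(\{y:U_\theta(y)\leq u\})$, $u>0$. (UD) with constant $D_{\mathrm{UD}}\geq1$ means $F_\theta(2u)\leq D_{\mathrm{UD}}F_\theta(u)$ for all $\theta\in\mathbb S^{d-1}$ and all $u>0$. *)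

theory Defs
  imports "HOL-Probability.Probability"
begin

text \<open>
  The constant in the estimate does not depend on the dimension, so \<open>d\<close> has to be quantified inside
  the statement and cannot be a type parameter. A vector of \<open>\<real>^d\<close> is a function
  \<open>nat \<Rightarrow> real\<close> of which only the coordinates \<open>i < d\<close> are ever read. The Borel sigma-algebra of
  \<open>\<real>^d\<close> is the finite product sigma-algebra \<open>Pi\<^sub>M {..<d} (\<lambda>_. borel)\<close>.
\<close>

type_synonym vec = "nat \<Rightarrow> real"

definition dot :: "nat \<Rightarrow> vec \<Rightarrow> vec \<Rightarrow> real" where
  "dot d x y = (\<Sum>i<d. x i * y i)"

definition vnorm :: "nat \<Rightarrow> vec \<Rightarrow> real" where
  "vnorm d x = L2_set x {..<d}"

definition borel_prob :: "nat \<Rightarrow> vec measure \<Rightarrow> bool" where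
  "borel_prob d P \<longleftrightarrow> prob_space P \<and> sets P = sets (Pi\<^sub>M {..<d} (\<lambda>_. borel))"

definition supp :: "nat \<Rightarrow> vec measure \<Rightarrow> vec set" where
  "supp d P = {y \<in> space P. \<forall>r>0. measure P {z \<in> space P. vnorm d (\<lambda>i. z i - y i) < r} > 0}"


subsection \<open>The doubling condition\<close>

definition U_dir :: "nat \<Rightarrow> vec measure \<Rightarrow> vec \<Rightarrow> vec \<Rightarrow> real" where
  "U_dir d P \<theta> y = (SUP y'\<in>supp d P. dot d \<theta> y') - dot d \<theta> y"

definition F_dir :: "nat \<Rightarrow> vec measure \<Rightarrow> vec \<Rightarrow> real \<Rightarrow> real" where
  "F_dir d P \<theta> u = measure P {y \<in> space P. U_dir d P \<theta> y \<le> u}"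

definition UD :: "nat \<Rightarrow> vec measure \<Rightarrow> real \<Rightarrow> bool" where
  "UD d P D \<longleftrightarrow> D \<ge> 1 \<and>
     (\<forall>\<theta>. vnorm d \<theta> = 1 \<longrightarrow> (\<forall>u>0. F_dir d P \<theta> (2 * u) \<le> D * F_dir d P \<theta> u))"


subsection \<open>The posterior\<close>

definition bcoef :: "real \<Rightarrow> real" where
  "bcoef t = inverse (1 - exp (- t))"

definition likelihood :: "nat \<Rightarrow> real \<Rightarrow> vec \<Rightarrow> vec \<Rightarrow> real" where
  "likelihood d t x y =
     exp (- ((vnorm d (\<lambda>i. x i - exp (- t / 2) * y i))\<^sup>2 / (2 * (1 - exp (- t)))))"

definition posterior :: "nat \<Rightarrow> vec measure \<Rightarrow> real \<Rightarrow> vec \<Rightarrow> vec measure" where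
  "posterior d P t x =
     density P (\<lambda>y. ennreal (likelihood d t x y / (LINT y'|P. likelihood d t x y')))"

definition ybar :: "nat \<Rightarrow> vec measure \<Rightarrow> real \<Rightarrow> vec \<Rightarrow> vec" where
  "ybar d P t x = (\<lambda>j. LINT y|posterior d P t x. y j)"

definition Zvar :: "nat \<Rightarrow> vec measure \<Rightarrow> real \<Rightarrow> vec \<Rightarrow> vec \<Rightarrow> vec" where
  "Zvar d P t x y = (\<lambda>j. y j - ybar d P t x j)"


subsection \<open>Atoms\<close>

text \<open>
  Insertions and scalar atoms are formal expressions, because \<open>K\<close> and \<open>\<rho>\<close> are assigned to the
  expression and not to the function it denotes, and because the constant in the estimate depends
  on the expression but not on the measure in which it is evaluated.
\<close>

datatype insertion = Ybar | VAtom nat nat "insertion list"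

datatype scalar_atom = SAtom nat nat "insertion list"

fun admissible :: "insertion \<Rightarrow> bool" where
  "admissible Ybar \<longleftrightarrow> True"
| "admissible (VAtom k m Us) \<longleftrightarrow> even m \<and> (\<forall>U\<in>set Us. admissible U)"

fun admissible_scalar :: "scalar_atom \<Rightarrow> bool" where
  "admissible_scalar (SAtom k m Us) \<longleftrightarrow> even m \<and> (\<forall>U\<in>set Us. admissible U)"

primrec insertion_val :: "nat \<Rightarrow> vec measure \<Rightarrow> real \<Rightarrow> vec \<Rightarrow> insertion \<Rightarrow> vec" where
  "insertion_val d P t x Ybar = ybar d P t x"
| "insertion_val d P t x (VAtom k m Us) =
     (\<lambda>j. LINT y|posterior d P t x.
        Zvar d P t x y j * dot d (Zvar d P t x y) x ^ k * vnorm d (Zvar d P t x y) ^ m *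
        prod_list (map (dot d (Zvar d P t x y)) (map (insertion_val d P t x) Us)))"

primrec scalar_val :: "nat \<Rightarrow> vec measure \<Rightarrow> real \<Rightarrow> vec \<Rightarrow> scalar_atom \<Rightarrow> real" where
  "scalar_val d P t x (SAtom k m Us) =
     (LINT y|posterior d P t x.
        dot d (Zvar d P t x y) x ^ k * vnorm d (Zvar d P t x y) ^ m *
        prod_list (map (dot d (Zvar d P t x y)) (map (insertion_val d P t x) Us)))"

primrec K_ins :: "insertion \<Rightarrow> nat" where
  "K_ins Ybar = 0"
| "K_ins (VAtom k m Us) = k + sum_list (map K_ins Us)"

primrec K_scalar :: "scalar_atom \<Rightarrow> nat" where
  "K_scalar (SAtom k m Us) = k + sum_list (map K_ins Us)"

primrec rho_ins :: "insertion \<Rightarrow> nat" where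
  "rho_ins Ybar = 1"
| "rho_ins (VAtom k m Us) = 2 * k + m + length Us + 1 + sum_list (map rho_ins Us)"

primrec rho_scalar :: "scalar_atom \<Rightarrow> nat" where
  "rho_scalar (SAtom k m Us) = 2 * k + m + length Us + sum_list (map rho_ins Us)"


subsection \<open>The weighted class\<close>

text \<open>
  A monomial without its coefficient is a pair \<open>(Ss, V)\<close>; the second component \<open>V\<close> is \<open>Ybar\<close> or a
  vector atom, i.e. an insertion. A normal form is a list \<open>N\<close> of such pairs together with
  coefficients \<open>c j\<close>, \<open>j < length N\<close>. The bounds \<open>A j q\<close> are the constants \<open>C_q\<close> of the \<open>j\<close>-th
  coefficient.
\<close>

type_synonym monomial = "scalar_atom list \<times> insertion"

definition admissible_monomial :: "monomial \<Rightarrow> bool" where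
  "admissible_monomial = (\<lambda>(Ss, V). (\<forall>S\<in>set Ss. admissible_scalar S) \<and> admissible V)"

definition K_monomial :: "monomial \<Rightarrow> nat" where
  "K_monomial = (\<lambda>(Ss, V). sum_list (map K_scalar Ss) + K_ins V)"

definition rho_monomial :: "monomial \<Rightarrow> nat" where
  "rho_monomial = (\<lambda>(Ss, V). sum_list (map rho_scalar Ss) + rho_ins V)"

definition monomial_val :: "nat \<Rightarrow> vec measure \<Rightarrow> real \<Rightarrow> vec \<Rightarrow> monomial \<Rightarrow> vec" where
  "monomial_val d P t x =
     (\<lambda>(Ss, V) j. prod_list (map (scalar_val d P t x) Ss) * insertion_val d P t x V j)"

definition smooth_pos :: "(real \<Rightarrow> real) \<Rightarrow> bool" where
  "smooth_pos f \<longleftrightarrow> (\<forall>q. \<forall>t>0. (deriv ^^ q) f differentiable at t)"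

definition weighted_repr ::
  "nat \<Rightarrow> vec measure \<Rightarrow> real \<Rightarrow> real \<Rightarrow> real \<Rightarrow> monomial list \<Rightarrow> (nat \<Rightarrow> real \<Rightarrow> real) \<Rightarrow>
   (nat \<Rightarrow> nat \<Rightarrow> real) \<Rightarrow> (real \<Rightarrow> vec \<Rightarrow> vec) \<Rightarrow> bool" where
  "weighted_repr d P \<sigma> \<eta> \<rho> N c A B \<longleftrightarrow>
     (\<forall>t>0. \<forall>x. \<forall>i<d. B t x i = (\<Sum>j<length N. c j t * monomial_val d P t x (N ! j) i)) \<and>
     (\<forall>j<length N.
        admissible_monomial (N ! j) \<and>
        real (rho_monomial (N ! j)) \<le> \<rho> \<and>
        smooth_pos (c j) \<and>
        (\<forall>q. \<forall>t>0. \<bar>(deriv ^^ q) (c j) t\<bar> \<le>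
           A j q * exp (- (real (K_monomial (N ! j)) + \<sigma>) * t / 2) * bcoef t powr (\<eta> + real q)))"

text \<open>Membership in the class forgets the representation, on which the constant may depend.\<close>

definition weighted_class ::
  "nat \<Rightarrow> vec measure \<Rightarrow> real \<Rightarrow> real \<Rightarrow> real \<Rightarrow> (real \<Rightarrow> vec \<Rightarrow> vec) set" where
  "weighted_class d P \<sigma> \<eta> \<rho> = {B. \<exists>N c A. weighted_repr d P \<sigma> \<eta> \<rho> N c A B}"


subsection \<open>Derivative tensors\<close>

definition partial :: "nat \<Rightarrow> (vec \<Rightarrow> real) \<Rightarrow> vec \<Rightarrow> real" where
  "partial i f x = deriv (\<lambda>s. f (x(i := s))) (x i)"

text \<open>
  \<open>Dx d f [v\<^sub>1, \<dots>, v\<^sub>n] x\<close> is the \<open>n\<close>-linear form with coefficients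
  \<open>\<partial>\<^sub>i\<^sub>1 \<dots> \<partial>\<^sub>i\<^sub>n f(x)\<close>, evaluated on fixed vectors \<open>v\<^sub>1, \<dots>, v\<^sub>n\<close>. If all iterated partial
  derivatives exist and are locally bounded, then \<open>f\<close> is smooth and this is its \<open>n\<close>-th Frechet
  derivative.
\<close>

primrec Dx :: "nat \<Rightarrow> (vec \<Rightarrow> real) \<Rightarrow> vec list \<Rightarrow> vec \<Rightarrow> real" where
  "Dx d f [] x = f x"
| "Dx d f (v # vs) x = (\<Sum>i<d. v i * partial i (Dx d f vs) x)"

definition DtDx ::
  "nat \<Rightarrow> (real \<Rightarrow> vec \<Rightarrow> vec) \<Rightarrow> nat \<Rightarrow> real \<Rightarrow> vec \<Rightarrow> vec list \<Rightarrow> vec" where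
  "DtDx d B q t x vs = (\<lambda>j. (deriv ^^ q) (\<lambda>s. Dx d (\<lambda>z. B s z j) vs x) t)"

text \<open>
  \<^const>\<open>deriv\<close> is total; this says that every derivative taken in \<^const>\<open>DtDx\<close> exists.
\<close>

definition derivs_exist :: "nat \<Rightarrow> (real \<Rightarrow> vec \<Rightarrow> vec) \<Rightarrow> bool" where
  "derivs_exist d B \<longleftrightarrow>
     (\<forall>t>0. \<forall>x vs. \<forall>j<d.
        (\<forall>i<d. (\<lambda>s. Dx d (\<lambda>z. B t z j) vs (x(i := s))) differentiable at (x i)) \<and>
        (\<forall>q. (\<lambda>s. DtDx d B q s x vs j) differentiable at t))"

definition op_norm :: "nat \<Rightarrow> nat \<Rightarrow> (vec list \<Rightarrow> vec) \<Rightarrow> real" where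
  "op_norm d l T = (SUP ws\<in>{ws. length ws = l \<and> (\<forall>w\<in>set ws. vnorm d w \<le> 1)}. vnorm d (T ws))"

end

theory Submission
  imports Defs
begin

text \<open>
  Since \<open>Z = Y - ybar\<close> and \<open>ybar\<close> is the expectation of an independent replica of \<open>Y\<close>, every nested
  atom is one expectation over finitely many independent replicas \<open>Y\<^sub>a\<close> of the posterior, of a product
  of factors \<open>\<langle>Y\<^sub>a - Y\<^sub>b, x\<rangle>\<close> and inner products of points and differences. The posterior is
  the exponential tilt of \<open>P\<^sub>0\<close> by \<open>exp (- t / 2) b \<langle>x, y\<rangle> - (b - 1) |y|\<^sup>2 / 2\<close>, so that a derivative
  either hits a factor or \<open>b\<close>, or inserts the derivative of that exponent at some \<open>Y\<^sub>a\<close> minus the one at a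
  fresh replica. Counting powers shows that each factor \<open>\<langle>Y\<^sub>a - Y\<^sub>b, x\<rangle>\<close> is accompanied by \<open>exp (- t / 2)\<close>, and
  \<open>exp (- t / 2) |\<langle>Y\<^sub>a - Y\<^sub>b, x\<rangle>|\<close> is bounded by the scaled distances \<open>W\<^sub>a, W\<^sub>b\<close> of the two points to the
  supporting hyperplane of the support in direction \<open>x\<close>. The tilt is by \<open>- b W\<close> up to a constant and the
  Gaussian factor, whose exponent is at most \<open>(b - 1) R\<^sup>2 / 2\<close>. By doubling,
  \<open>\<integral> exp (- b W / 2) \<le> D \<integral> exp (- b W)\<close>, hence all posterior moments of \<open>W / (1 + R)\<^sup>2\<close> are bounded
  independently of \<open>x\<close>, \<open>t\<close> and the dimension.
\<close>

section \<open>Independent replicas of a tilted probability measure\<close>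

text \<open>The Gaussian factor costs up to \<open>exp ((b - 1) * R\<^sup>2 / 2)\<close>, and a
  plain exponential moment bound would carry this cost into the constant, while only powers of
  \<open>b\<close> and \<open>1 + R\<close> are allowed. The cost and \<open>D\<close> are therefore
  merged into one logarithm \<Lambda> that is subtracted inside the exponential. The moments then
  depend on \<Lambda> polynomially, and rescaling by \<open>b * (1 + R)\<^sup>2\<close> removes even
  the \<open>b\<close>.

  The constant must serve all dimensions and measures at once. Derivatives are therefore taken on
  syntax: the list of resulting terms is computed from the monomial and the orders alone, and the
  constant is read off that list. The final estimates never sum bounds over coordinates; they use
  Cauchy-Schwarz and test against one vector of norm at most \<open>1\<close>.

  Slots of the tensor filled with \<open>x\<close> must not be differentiated again. Directions are
  therefore formal symbols \<open>V i\<close>, and \<open>x\<close> is substituted after the last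
  derivative. Such a slot then grows like a factor \<open>FX\<close>: it consumes one
  \<open>exp (- t / 2)\<close> and one more power of \<open>1 + R\<close> than a slot with a bounded
  vector, whence \<open>2 * k\<close> in the radius and no \<open>k\<close> in the decay.\<close>

definition bmeas :: "'a measure \<Rightarrow> ('a \<Rightarrow> real) set" where
  "bmeas M = {f \<in> borel_measurable M. \<exists>C. \<forall>x\<in>space M. \<bar>f x\<bar> \<le> C}"

lemma bmeasI: "f \<in> borel_measurable M \<Longrightarrow> (\<And>x. x \<in> space M \<Longrightarrow> \<bar>f x\<bar> \<le> C) \<Longrightarrow> f \<in> bmeas M"
  by (auto simp: bmeas_def)

lemma bmeas_measurable: "f \<in> bmeas M \<Longrightarrow> f \<in> borel_measurable M"
  by (auto simp: bmeas_def)

lemma bmeas_bound: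
  assumes "f \<in> bmeas M"
  obtains C where "C \<ge> 0" "\<And>x. x \<in> space M \<Longrightarrow> \<bar>f x\<bar> \<le> C"
proof -
  obtain C where "\<forall>x\<in>space M. \<bar>f x\<bar> \<le> C"
    using assms by (auto simp: bmeas_def)
  then show ?thesis
    by (intro that[of "max C 0"]) (auto intro: le_max_iff_disj[THEN iffD2])
qed

lemma bmeas_const [simp, intro]: "(\<lambda>x. c) \<in> bmeas M"
  by (auto simp: bmeas_def)

lemma bmeas_add [intro]:
  assumes "f \<in> bmeas M" "g \<in> bmeas M"
  shows "(\<lambda>x. f x + g x) \<in> bmeas M"
proof -
  obtain A B where "\<And>x. x \<in> space M \<Longrightarrow> \<bar>f x\<bar> \<le> A" "\<And>x. x \<in> space M \<Longrightarrow> \<bar>g x\<bar> \<le> B"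
    using assms by (metis bmeas_bound)
  then show ?thesis
    using assms[THEN bmeas_measurable]
    by (intro bmeasI[where C = "A + B"]) (auto intro: order_trans[OF abs_triangle_ineq] add_mono)
qed

lemma bmeas_mult [intro]:
  assumes "f \<in> bmeas M" "g \<in> bmeas M"
  shows "(\<lambda>x. f x * g x) \<in> bmeas M"
proof -
  obtain A B where "A \<ge> 0" "\<And>x. x \<in> space M \<Longrightarrow> \<bar>f x\<bar> \<le> A" "\<And>x. x \<in> space M \<Longrightarrow> \<bar>g x\<bar> \<le> B"
    using assms by (metis bmeas_bound)
  then show ?thesis
    using assms[THEN bmeas_measurable]
    by (intro bmeasI[where C = "A * B"]) (auto simp: abs_mult intro!: mult_mono)
qed

lemma bmeas_minus [intro]: "f \<in> bmeas M \<Longrightarrow> (\<lambda>x. - f x) \<in> bmeas M"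
  using bmeas_mult[of "\<lambda>_. -1" M f] by simp

lemma bmeas_diff [intro]: "f \<in> bmeas M \<Longrightarrow> g \<in> bmeas M \<Longrightarrow> (\<lambda>x. f x - g x) \<in> bmeas M"
  using bmeas_add[of f M "\<lambda>x. - g x"] by auto

lemma bmeas_divide [intro]: "f \<in> bmeas M \<Longrightarrow> (\<lambda>x. f x / c) \<in> bmeas M"
  using bmeas_mult[of f M "\<lambda>_. inverse c"] by (simp add: divide_inverse)

lemma bmeas_sum [intro]: "(\<And>i. i \<in> A \<Longrightarrow> f i \<in> bmeas M) \<Longrightarrow> (\<lambda>x. \<Sum>i\<in>A. f i x) \<in> bmeas M"
  by (induction A rule: infinite_finite_induct) auto

lemma bmeas_prod [intro]: "(\<And>i. i \<in> A \<Longrightarrow> f i \<in> bmeas M) \<Longrightarrow> (\<lambda>x. \<Prod>i\<in>A. f i x) \<in> bmeas M"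
  by (induction A rule: infinite_finite_induct) auto

lemma bmeas_power [intro]: "f \<in> bmeas M \<Longrightarrow> (\<lambda>x. f x ^ n) \<in> bmeas M"
  by (induction n) auto

lemma bmeas_sum_list [intro]:
  "(\<And>f. f \<in> set fs \<Longrightarrow> g f \<in> bmeas M) \<Longrightarrow> (\<lambda>x. \<Sum>f\<leftarrow>fs. g f x) \<in> bmeas M"
  by (induction fs) auto

lemma bmeas_exp [intro]:
  assumes "f \<in> bmeas M"
  shows "(\<lambda>x. exp (f x)) \<in> bmeas M"
proof -
  obtain A where A: "\<And>x. x \<in> space M \<Longrightarrow> \<bar>f x\<bar> \<le> A"
    using assms by (metis bmeas_bound)
  show ?thesis
    using assms[THEN bmeas_measurable]
    by (intro bmeasI[where C = "exp A"]) (auto dest!: A)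
qed

lemma bmeas_compose:
  assumes "f \<in> bmeas N" "h \<in> measurable M N"
  shows "(\<lambda>x. f (h x)) \<in> bmeas M"
proof -
  obtain C where "\<And>x. x \<in> space N \<Longrightarrow> \<bar>f x\<bar> \<le> C"
    using assms by (metis bmeas_bound)
  then show ?thesis
    using assms measurable_space[OF assms(2)]
    by (intro bmeasI[where C = C]) (auto intro: measurable_compose bmeas_measurable)
qed

lemma bmeas_cong: "(\<And>x. x \<in> space M \<Longrightarrow> f x = g x) \<Longrightarrow> f \<in> bmeas M \<longleftrightarrow> g \<in> bmeas M"
  by (auto simp: bmeas_def cong: measurable_cong)

lemma (in finite_measure) bmeas_integrable: "f \<in> bmeas M \<Longrightarrow> integrable M f"
  using bmeas_bound[of f M] integrable_const_bound[of f] bmeas_measurable[of f M]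
  by (metis AE_I2 real_norm_def)

section \<open>Infinitely many replicas and integrals over tilted coordinates\<close>

context sequence_space
begin

lemma measurable_coord [measurable]: "(\<lambda>Y. Y a) \<in> measurable S M"
  by (rule measurable_component_singleton) simp

lemma measurable_reindex [measurable]: "(\<lambda>Y a. Y (r a)) \<in> measurable S S"
  by (rule measurable_PiM_single') (auto simp: space_PiM PiE_iff)

lemma measurable_case_nat_right: "y \<in> space M \<Longrightarrow> (\<lambda>Y. case_nat y Y) \<in> measurable S S"
  by (rule measurable_PiM_single') (auto simp: space_PiM PiE_iff split: nat.split)

lemma space_S_iff: "Y \<in> space S \<longleftrightarrow> (\<forall>a. Y a \<in> space M)"
  by (auto simp: space_PiM PiE_iff)

lemma bmeas_coord: "f \<in> bmeas M \<Longrightarrow> (\<lambda>Y. f (Y a)) \<in> bmeas S"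
  by (rule bmeas_compose[OF _ measurable_coord])

lemma bmeas_reindex: "F \<in> bmeas S \<Longrightarrow> (\<lambda>Y. F (\<lambda>a. Y (r a))) \<in> bmeas S"
  by (rule bmeas_compose[OF _ measurable_reindex])

text \<open>One infinite product serves every number of replicas, so a derivative can bring in a
  fresh replica without changing the space; \<open>n\<close> only says how many coordinates carry
  the tilt.\<close>

definition tint :: "nat \<Rightarrow> ('a \<Rightarrow> real) \<Rightarrow> ((nat \<Rightarrow> 'a) \<Rightarrow> real) \<Rightarrow> real" where
  "tint n L F = (\<integral>Y. F Y * exp (\<Sum>a<n. L (Y a)) \<partial>S)"

text \<open>Expectation of \<open>F\<close> when the first \<open>n\<close> coordinates are independent with law proportional to
  \<open>exp L\<close>. The remaining coordinates are untilted, so they matter only if \<open>F\<close> reads them.\<close>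

definition texp :: "nat \<Rightarrow> ('a \<Rightarrow> real) \<Rightarrow> ((nat \<Rightarrow> 'a) \<Rightarrow> real) \<Rightarrow> real" where
  "texp n L F = tint n L F / (\<integral>y. exp (L y) \<partial>M) ^ n"

lemma bmeas_tilt: "L \<in> bmeas M \<Longrightarrow> (\<lambda>Y. exp (\<Sum>a\<in>A. L (Y a))) \<in> bmeas S"
  by (intro bmeas_exp bmeas_sum bmeas_coord)

lemma tint_integrable: "F \<in> bmeas S \<Longrightarrow> L \<in> bmeas M \<Longrightarrow> integrable S (\<lambda>Y. F Y * exp (\<Sum>a<n. L (Y a)))"
  by (intro P.bmeas_integrable bmeas_mult bmeas_tilt)

lemma Z_pos: "L \<in> bmeas M \<Longrightarrow> (\<integral>y. exp (L y) \<partial>M) > 0"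
  using M.bmeas_integrable[OF bmeas_exp[of L M]]
  by (subst M.integral_less_AE_space[of "\<lambda>_. 0", simplified]) (auto simp: M.emeasure_space_1)

lemma integral_S_head:
  assumes "H \<in> bmeas S"
  shows "(\<integral>Y. H Y \<partial>S) = (\<integral>y. (\<integral>Y. H (case_nat y Y) \<partial>S) \<partial>M)"
proof -
  interpret PP: pair_prob_space M S ..
  have m: "(\<lambda>p. H (case p of (y, Y) \<Rightarrow> case_nat y Y)) \<in> bmeas (M \<Otimes>\<^sub>M S)"
    by (rule bmeas_compose[OF assms]) measurable
  have "(\<integral>Y. H Y \<partial>S) = (\<integral>Y. H Y \<partial>distr (M \<Otimes>\<^sub>M S) S (\<lambda>(s, \<omega>). case_nat s \<omega>))"
    by (simp add: PiM_iter)
  also have "\<dots> = (\<integral>p. H (case p of (y, Y) \<Rightarrow> case_nat y Y) \<partial>(M \<Otimes>\<^sub>M S))"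
    by (rule integral_distr) (use assms bmeas_measurable in measurable)
  also have "\<dots> = (\<integral>y. (\<integral>Y. H (case_nat y Y) \<partial>S) \<partial>M)"
    using PP.integral_fst'[OF PP.P.bmeas_integrable[OF m]] by simp
  finally show ?thesis .
qed

text \<open>Cutting a sequence at position \<open>n\<close> identifies the product space with two
  independent copies of itself; \<open>dep\<close> confines \<open>F\<close> to the first copy, and
  \<open>G\<close> reads only the second.\<close>

lemma integral_S_split:
  assumes "F \<in> bmeas S" "G \<in> bmeas S"
    and dep: "\<And>Y Y'. (\<And>a. a < n \<Longrightarrow> Y a = Y' a) \<Longrightarrow> F Y = F Y'"
  shows "(\<integral>Y. F Y * G (\<lambda>a. Y (a + n)) \<partial>S) = (\<integral>Y. F Y \<partial>S) * (\<integral>Y. G Y \<partial>S)"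
proof -
  interpret PP: pair_prob_space S S ..
  let ?H = "\<lambda>Y. F Y * G (\<lambda>a. Y (a + n))"
  have H: "?H \<in> bmeas S"
    using bmeas_mult[OF assms(1) bmeas_reindex[OF assms(2), of "\<lambda>a. a + n"]] .
  have m: "(\<lambda>p. ?H (case p of (y, Y) \<Rightarrow> comb_seq n y Y)) \<in> bmeas (S \<Otimes>\<^sub>M S)"
    by (rule bmeas_compose[OF H]) measurable
  have "(\<integral>Y. ?H Y \<partial>S) = (\<integral>Y. ?H Y \<partial>distr (S \<Otimes>\<^sub>M S) S (\<lambda>(s, \<omega>). comb_seq n s \<omega>))"
    by (simp add: PiM_comb_seq)
  also have "\<dots> = (\<integral>p. ?H (case p of (y, Y) \<Rightarrow> comb_seq n y Y) \<partial>(S \<Otimes>\<^sub>M S))"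
    by (rule integral_distr) (use H bmeas_measurable in measurable)
  also have "\<dots> = (\<integral>y. (\<integral>Y. ?H (comb_seq n y Y) \<partial>S) \<partial>S)"
    using PP.integral_fst'[OF PP.P.bmeas_integrable[OF m]] by simp
  also have "\<dots> = (\<integral>y. (\<integral>Y. F y * G Y \<partial>S) \<partial>S)"
  proof -
    have "F (comb_seq n y Y) = F y" for y Y
      by (rule dep) (simp add: comb_seq_less)
    then show ?thesis
      by (simp add: comb_seq_add)
  qed
  also have "\<dots> = (\<integral>Y. F Y \<partial>S) * (\<integral>Y. G Y \<partial>S)"
    by simp
  finally show ?thesis .
qed

lemma tint_cmult: "tint n L (\<lambda>Y. c * F Y) = c * tint n L F"
  by (simp add: tint_def mult.assoc)

lemma tint_head:
  assumes "H \<in> bmeas S" "L \<in> bmeas M"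
  shows "tint (Suc n) L H = (\<integral>y. tint n L (\<lambda>Y. H (case_nat y Y)) * exp (L y) \<partial>M)"
proof -
  have "tint (Suc n) L H =
      (\<integral>y. (\<integral>Y. H (case_nat y Y) * exp (\<Sum>a<Suc n. L (case_nat y Y a)) \<partial>S) \<partial>M)"
    unfolding tint_def by (intro integral_S_head bmeas_mult assms bmeas_tilt)
  also have "\<dots> = (\<integral>y. (\<integral>Y. H (case_nat y Y) * exp (\<Sum>a<n. L (Y a)) * exp (L y) \<partial>S) \<partial>M)"
    unfolding sum.lessThan_Suc_shift exp_add nat.case
    by (intro Bochner_Integration.integral_cong) simp_all
  finally show ?thesis
    by (simp add: tint_def)
qed

text \<open>With \<open>g = 1\<close> the head contributes one more power of the normalisation, with
  \<open>g\<close> the derivative of the exponent it contributes the mean. These are the two ways in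
  which a fresh replica arises when a quotient is differentiated.\<close>

lemma tint_head_product:
  assumes "F \<in> bmeas S" "g \<in> bmeas M" "L \<in> bmeas M"
  shows "tint (Suc n) L (\<lambda>Y. F (\<lambda>a. Y (Suc a)) * g (Y 0)) = tint n L F * (\<integral>y. g y * exp (L y) \<partial>M)"
proof -
  have "tint (Suc n) L (\<lambda>Y. F (\<lambda>a. Y (Suc a)) * g (Y 0)) =
      (\<integral>y. tint n L (\<lambda>Y. F Y * g y) * exp (L y) \<partial>M)"
    using bmeas_mult[OF bmeas_reindex[OF assms(1), of Suc] bmeas_coord[OF assms(2), of 0]] assms(3)
    by (subst tint_head) auto
  also have "\<dots> = (\<integral>y. tint n L F * (g y * exp (L y)) \<partial>M)"
    using tint_cmult[of n L _ F] by (simp only: mult.commute[of "F _"] mult.assoc mult.left_commute)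
  finally show ?thesis
    by simp
qed

lemma tint_split:
  assumes "F \<in> bmeas S" "G \<in> bmeas S" "L \<in> bmeas M"
    and dep: "\<And>Y Y'. (\<And>a. a < n \<Longrightarrow> Y a = Y' a) \<Longrightarrow> F Y = F Y'"
  shows "tint (n + m) L (\<lambda>Y. F Y * G (\<lambda>a. Y (a + n))) = tint n L F * tint m L G"
proof -
  have e: "(\<Sum>a<n + m. L (Y a)) = (\<Sum>a<n. L (Y a)) + (\<Sum>a<m. L (Y (a + n)))" for Y
    by (induction m) (auto simp: add_ac)
  have "(F Y * exp (\<Sum>a<n. L (Y a))) = (F Y' * exp (\<Sum>a<n. L (Y' a)))"
    if "\<And>a. a < n \<Longrightarrow> Y a = Y' a" for Y Y'
    using dep[OF that] that by simp
  note split = integral_S_split[OF bmeas_mult[OF assms(1) bmeas_tilt[OF assms(3)]]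
      bmeas_mult[OF assms(2) bmeas_tilt[OF assms(3)]] this]
  have "tint (n + m) L (\<lambda>Y. F Y * G (\<lambda>a. Y (a + n))) =
      (\<integral>Y. (F Y * exp (\<Sum>a<n. L (Y a))) *
        (G (\<lambda>a. Y (a + n)) * exp (\<Sum>a<m. L (Y (a + n)))) \<partial>S)"
    unfolding tint_def e exp_add by (intro Bochner_Integration.integral_cong) simp_all
  also have "\<dots> = tint n L F * tint m L G"
    unfolding tint_def by (rule split)
  finally show ?thesis .
qed

lemma tint_prod:
  assumes "g \<in> bmeas M" "L \<in> bmeas M"
  shows "tint n L (\<lambda>Y. \<Prod>a<n. g (Y a)) = (\<integral>y. g y * exp (L y) \<partial>M) ^ n"
proof (induction n)
  case 0
  show ?case by (simp add: tint_def P.prob_space)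
next
  case (Suc n)
  have "tint (Suc n) L (\<lambda>Y. \<Prod>a<Suc n. g (Y a)) =
      tint (Suc n) L (\<lambda>Y. (\<lambda>Y. \<Prod>a<n. g (Y a)) (\<lambda>a. Y (Suc a)) * g (Y 0))"
    by (simp add: prod.lessThan_Suc_shift mult_ac del: prod.lessThan_Suc)
  also have "\<dots> = tint n L (\<lambda>Y. \<Prod>a<n. g (Y a)) * (\<integral>y. g y * exp (L y) \<partial>M)"
    by (intro tint_head_product bmeas_prod bmeas_coord assms)
  finally show ?case by (simp add: Suc.IH)
qed

lemma tint_add: "F \<in> bmeas S \<Longrightarrow> G \<in> bmeas S \<Longrightarrow> L \<in> bmeas M \<Longrightarrow>
    tint n L (\<lambda>Y. F Y + G Y) = tint n L F + tint n L G"
  by (simp add: tint_def distrib_right tint_integrable)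

lemma tint_sum: "(\<And>i. i \<in> A \<Longrightarrow> F i \<in> bmeas S) \<Longrightarrow> L \<in> bmeas M \<Longrightarrow>
    tint n L (\<lambda>Y. \<Sum>i\<in>A. F i Y) = (\<Sum>i\<in>A. tint n L (F i))"
  by (simp add: tint_def sum_distrib_right tint_integrable)

lemma texp_add: "F \<in> bmeas S \<Longrightarrow> G \<in> bmeas S \<Longrightarrow> L \<in> bmeas M \<Longrightarrow>
    texp n L (\<lambda>Y. F Y + G Y) = texp n L F + texp n L G"
  by (simp add: texp_def tint_add add_divide_distrib)

lemma texp_cmult: "texp n L (\<lambda>Y. c * F Y) = c * texp n L F"
  by (simp add: texp_def tint_cmult)

lemma texp_diff: "F \<in> bmeas S \<Longrightarrow> G \<in> bmeas S \<Longrightarrow> L \<in> bmeas M \<Longrightarrow>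
    texp n L (\<lambda>Y. F Y - G Y) = texp n L F - texp n L G"
  using texp_add[of F "\<lambda>Y. - G Y" L n] texp_cmult[of n L "-1" G] by auto

lemma texp_sum: "(\<And>i. i \<in> A \<Longrightarrow> F i \<in> bmeas S) \<Longrightarrow> L \<in> bmeas M \<Longrightarrow>
    texp n L (\<lambda>Y. \<Sum>i\<in>A. F i Y) = (\<Sum>i\<in>A. texp n L (F i))"
  by (simp add: texp_def tint_sum sum_divide_distrib)

lemma texp_sum_list: "(\<And>f. f \<in> set fs \<Longrightarrow> F f \<in> bmeas S) \<Longrightarrow> L \<in> bmeas M \<Longrightarrow>
    texp n L (\<lambda>Y. \<Sum>f\<leftarrow>fs. F f Y) = (\<Sum>f\<leftarrow>fs. texp n L (F f))"
proof (induction fs)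
  case Nil
  then show ?case by (simp add: texp_def tint_def)
next
  case (Cons f fs)
  have "(\<lambda>Y. \<Sum>f\<leftarrow>fs. F f Y) \<in> bmeas S"
    using Cons.prems(1) by auto
  then show ?case
    using Cons texp_add[of "F f" "\<lambda>Y. \<Sum>f\<leftarrow>fs. F f Y" L n] by simp
qed

lemma texp_mono:
  assumes "F \<in> bmeas S" "G \<in> bmeas S" "L \<in> bmeas M" "\<And>Y. Y \<in> space S \<Longrightarrow> F Y \<le> G Y"
  shows "texp n L F \<le> texp n L G"
  unfolding texp_def tint_def
  by (intro divide_right_mono integral_mono tint_integrable mult_right_mono assms)
     (use Z_pos[OF assms(3)] in auto)

lemma texp_abs_le:
  assumes "F \<in> bmeas S" "G \<in> bmeas S" "L \<in> bmeas M" "\<And>Y. Y \<in> space S \<Longrightarrow> \<bar>F Y\<bar> \<le> G Y"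
  shows "\<bar>texp n L F\<bar> \<le> texp n L G"
proof -
  have "texp n L (\<lambda>Y. - F Y) = - texp n L F"
    using texp_cmult[of n L "-1" F] by simp
  moreover have "texp n L F \<le> texp n L G" "texp n L (\<lambda>Y. - F Y) \<le> texp n L G"
    using assms by (auto intro!: texp_mono dest!: assms(4))
  ultimately show ?thesis by simp
qed

lemma texp_const: "L \<in> bmeas M \<Longrightarrow> texp n L (\<lambda>_. c) = c"
  using tint_prod[of "\<lambda>_. 1" L n] Z_pos[of L] texp_cmult[of n L c "\<lambda>_. 1"] by (auto simp: texp_def)

lemma texp_head:
  assumes "H \<in> bmeas S" "L \<in> bmeas M"
  shows "texp (Suc n) L H =
    (\<integral>y. texp n L (\<lambda>Y. H (case_nat y Y)) * exp (L y) \<partial>M) / (\<integral>y. exp (L y) \<partial>M)"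
  by (simp add: texp_def tint_head[OF assms])

lemma texp_split:
  assumes "F \<in> bmeas S" "G \<in> bmeas S" "L \<in> bmeas M"
    and dep: "\<And>Y Y'. (\<And>a. a < n \<Longrightarrow> Y a = Y' a) \<Longrightarrow> F Y = F Y'"
  shows "texp (n + m) L (\<lambda>Y. F Y * G (\<lambda>a. Y (a + n))) = texp n L F * texp m L G"
  by (simp add: texp_def tint_split[OF assms] power_add)

lemma texp_prod:
  assumes "g \<in> bmeas M" "L \<in> bmeas M"
  shows "texp n L (\<lambda>Y. \<Prod>a<n. g (Y a)) = ((\<integral>y. g y * exp (L y) \<partial>M) / (\<integral>y. exp (L y) \<partial>M)) ^ n"
  by (simp add: texp_def tint_prod[OF assms] power_divide)

lemma texp_cong: "(\<And>Y. Y \<in> space S \<Longrightarrow> F Y = G Y) \<Longrightarrow> texp n L F = texp n L G"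
  by (simp add: texp_def tint_def cong: Bochner_Integration.integral_cong)

end

section \<open>Differentiation of tilted expectations\<close>

text \<open>Dominated convergence along sequences: by the mean value inequality, the uniform bound
  on \<open>G'\<close> near \<open>s0\<close> bounds all difference quotients.\<close>

lemma (in finite_measure) has_real_derivative_integral:
  fixes G G' :: "real \<Rightarrow> 'a \<Rightarrow> real"
  assumes "\<delta> > 0"
    and G: "\<And>s. \<bar>s - s0\<bar> < \<delta> \<Longrightarrow> G s \<in> bmeas M" and G': "G' s0 \<in> bmeas M"
    and bd: "\<And>s x. \<bar>s - s0\<bar> < \<delta> \<Longrightarrow> x \<in> space M \<Longrightarrow> \<bar>G' s x\<bar> \<le> C"
    and der: "\<And>s x. \<bar>s - s0\<bar> < \<delta> \<Longrightarrow> x \<in> space M \<Longrightarrow>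
      ((\<lambda>s. G s x) has_real_derivative G' s x) (at s)"
  shows "((\<lambda>s. \<integral>x. G s x \<partial>M) has_real_derivative (\<integral>x. G' s0 x \<partial>M)) (at s0)"
proof -
  define I where "I = ball s0 \<delta>"
  have I: "s \<in> I \<longleftrightarrow> \<bar>s - s0\<bar> < \<delta>" for s
    by (auto simp: I_def dist_real_def abs_minus_commute)
  have "open I" "s0 \<in> I" "convex I"
    using \<open>\<delta> > 0\<close> by (auto simp: I_def)
  have "((\<lambda>s. ((\<integral>x. G s x \<partial>M) - (\<integral>x. G s0 x \<partial>M)) / (s - s0)) \<longlongrightarrow> (\<integral>x. G' s0 x \<partial>M)) (at s0 within I)"
    unfolding tendsto_at_iff_sequentially o_def
  proof (intro allI impI)
    fix X assume X: "\<forall>i. X i \<in> I - {s0}" "X \<longlonglongrightarrow> s0"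
    have "(\<lambda>i. \<integral>x. (G (X i) x - G s0 x) / (X i - s0) \<partial>M) \<longlonglongrightarrow> (\<integral>x. G' s0 x \<partial>M)"
    proof (rule integral_dominated_convergence)
      show "G' s0 \<in> borel_measurable M"
        by (rule bmeas_measurable[OF G'])
      show "(\<lambda>x. (G (X i) x - G s0 x) / (X i - s0)) \<in> borel_measurable M" for i
        using X \<open>s0 \<in> I\<close> by (intro bmeas_measurable bmeas_divide bmeas_diff G) (auto simp: I)
      show "integrable M (\<lambda>x. C)"
        by simp
      show "AE x in M. (\<lambda>i. (G (X i) x - G s0 x) / (X i - s0)) \<longlonglongrightarrow> G' s0 x"
      proof (rule AE_I2)
        fix x assume "x \<in> space M"
        then have "((\<lambda>s. (G s x - G s0 x) / (s - s0)) \<longlongrightarrow> G' s0 x) (at s0 within I)"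
          using has_field_derivative_at_within[OF der[of s0 x], of I] \<open>\<delta> > 0\<close>
          by (simp add: has_field_derivative_iff)
        then show "(\<lambda>i. (G (X i) x - G s0 x) / (X i - s0)) \<longlonglongrightarrow> G' s0 x"
          using X unfolding tendsto_at_iff_sequentially o_def by blast
      qed
      show "AE x in M. norm ((G (X i) x - G s0 x) / (X i - s0)) \<le> C" for i
      proof (rule AE_I2)
        fix x assume x: "x \<in> space M"
        have "norm (G (X i) x - G s0 x) \<le> C * norm (X i - s0)"
          using X \<open>s0 \<in> I\<close> bd[OF _ x] der[OF _ x] has_field_derivative_at_within
          by (intro field_differentiable_bound[OF \<open>convex I\<close>, where f' = "\<lambda>s. G' s x"])
            (auto simp: I intro: has_field_derivative_at_within)
        then show "norm ((G (X i) x - G s0 x) / (X i - s0)) \<le> C"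
          using X by (auto simp: divide_simps)
      qed
    qed
    also have "(\<lambda>i. \<integral>x. (G (X i) x - G s0 x) / (X i - s0) \<partial>M) =
        (\<lambda>i. ((\<integral>x. G (X i) x \<partial>M) - (\<integral>x. G s0 x \<partial>M)) / (X i - s0))"
      using X \<open>s0 \<in> I\<close> by (intro ext) (simp add: I bmeas_integrable[OF G])
    finally show "(\<lambda>i. ((\<integral>x. G (X i) x \<partial>M) - (\<integral>x. G s0 x \<partial>M)) / (X i - s0)) \<longlonglongrightarrow> (\<integral>x. G' s0 x \<partial>M)" .
  qed
  then show ?thesis
    using at_within_open[OF \<open>s0 \<in> I\<close> \<open>open I\<close>] by (simp add: has_field_derivative_iff)
qed

context sequence_space
begin

lemma tint_has_real_derivative:
  fixes F F' :: "real \<Rightarrow> (nat \<Rightarrow> 'a) \<Rightarrow> real" and L L' :: "real \<Rightarrow> 'a \<Rightarrow> real"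
  assumes "\<delta> > 0"
    and F: "\<And>s. \<bar>s - s0\<bar> < \<delta> \<Longrightarrow> F s \<in> bmeas S" and F': "F' s0 \<in> bmeas S"
    and bdF: "\<And>s Y. \<bar>s - s0\<bar> < \<delta> \<Longrightarrow> Y \<in> space S \<Longrightarrow> \<bar>F s Y\<bar> \<le> C"
    and bdF': "\<And>s Y. \<bar>s - s0\<bar> < \<delta> \<Longrightarrow> Y \<in> space S \<Longrightarrow> \<bar>F' s Y\<bar> \<le> C"
    and derF: "\<And>s Y. \<bar>s - s0\<bar> < \<delta> \<Longrightarrow> Y \<in> space S \<Longrightarrow>
      ((\<lambda>s. F s Y) has_real_derivative F' s Y) (at s)"
    and L: "\<And>s. \<bar>s - s0\<bar> < \<delta> \<Longrightarrow> L s \<in> bmeas M" and L': "L' s0 \<in> bmeas M"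
    and bdL: "\<And>s y. \<bar>s - s0\<bar> < \<delta> \<Longrightarrow> y \<in> space M \<Longrightarrow> \<bar>L s y\<bar> \<le> C"
    and bdL': "\<And>s y. \<bar>s - s0\<bar> < \<delta> \<Longrightarrow> y \<in> space M \<Longrightarrow> \<bar>L' s y\<bar> \<le> C"
    and derL: "\<And>s y. \<bar>s - s0\<bar> < \<delta> \<Longrightarrow> y \<in> space M \<Longrightarrow>
      ((\<lambda>s. L s y) has_real_derivative L' s y) (at s)"
  shows "((\<lambda>s. tint n (L s) (F s)) has_real_derivative
    tint n (L s0) (F' s0) + (\<Sum>a<n. tint n (L s0) (\<lambda>Y. F s0 Y * L' s0 (Y a)))) (at s0)"
proof -
  define T where "T s Y = (\<Sum>a<n. L s (Y a))" for s Y
  define T' where "T' s Y = (\<Sum>a<n. L' s (Y a))" for s Y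
  define G' where "G' s Y = F' s Y * exp (T s Y) + F s Y * T' s Y * exp (T s Y)" for s Y
  obtain y0 where "y0 \<in> space M"
    using M.not_empty by auto
  then have "C \<ge> 0"
    using bdL[of s0 y0] \<open>\<delta> > 0\<close> by auto
  have s0: "\<bar>s0 - s0\<bar> < \<delta>"
    using \<open>\<delta> > 0\<close> by simp
  have bT: "\<bar>T s Y\<bar> \<le> real n * C" if "\<bar>s - s0\<bar> < \<delta>" "Y \<in> space S" for s Y
    unfolding T_def using that bdL
    by (intro order_trans[OF sum_abs] order_trans[OF sum_bounded_above[where K = C]])
      (auto simp: space_S_iff)
  have bT': "\<bar>T' s Y\<bar> \<le> real n * C" if "\<bar>s - s0\<bar> < \<delta>" "Y \<in> space S" for s Y
    unfolding T'_def using that bdL'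
    by (intro order_trans[OF sum_abs] order_trans[OF sum_bounded_above[where K = C]])
      (auto simp: space_S_iff)
  have mT: "T s \<in> bmeas S" if "\<bar>s - s0\<bar> < \<delta>" for s
    unfolding T_def using that by (intro bmeas_sum bmeas_coord L)
  have mT': "T' s0 \<in> bmeas S"
    unfolding T'_def by (intro bmeas_sum bmeas_coord L')
  have "((\<lambda>s. \<integral>Y. F s Y * exp (T s Y) \<partial>S) has_real_derivative (\<integral>Y. G' s0 Y \<partial>S)) (at s0)"
  proof (rule P.has_real_derivative_integral[OF \<open>\<delta> > 0\<close>])
    show "(\<lambda>Y. F s Y * exp (T s Y)) \<in> bmeas S" if "\<bar>s - s0\<bar> < \<delta>" for s
      using that by (intro bmeas_mult bmeas_exp F mT)
    show "G' s0 \<in> bmeas S"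
      unfolding G'_def by (intro bmeas_add bmeas_mult bmeas_exp F' mT' F[OF s0] mT[OF s0])
    show "\<bar>G' s Y\<bar> \<le> C * exp (real n * C) + C * (real n * C) * exp (real n * C)"
      if s: "\<bar>s - s0\<bar> < \<delta>" "Y \<in> space S" for s Y
    proof -
      have e: "exp (T s Y) \<le> exp (real n * C)"
        using bT[OF s] by simp
      have "\<bar>G' s Y\<bar> \<le> \<bar>F' s Y\<bar> * exp (T s Y) + \<bar>F s Y\<bar> * \<bar>T' s Y\<bar> * exp (T s Y)"
        unfolding G'_def by (rule order_trans[OF abs_triangle_ineq]) (simp add: abs_mult)
      also have "\<dots> \<le> C * exp (real n * C) + C * (real n * C) * exp (real n * C)"
        using bdF[OF s] bdF'[OF s] bT'[OF s] e \<open>C \<ge> 0\<close>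
        by (intro add_mono mult_mono mult_nonneg_nonneg) auto
      finally show ?thesis .
    qed
    show "((\<lambda>s. F s Y * exp (T s Y)) has_real_derivative G' s Y) (at s)"
      if s: "\<bar>s - s0\<bar> < \<delta>" "Y \<in> space S" for s Y
    proof -
      have "((\<lambda>s. T s Y) has_real_derivative T' s Y) (at s)"
        unfolding T_def T'_def using s by (intro DERIV_sum derL) (auto simp: space_S_iff)
      then show ?thesis
        unfolding G'_def using derF[OF s]
        by (auto intro!: derivative_eq_intros)
    qed
  qed
  moreover have "(\<integral>Y. G' s0 Y \<partial>S) =
      tint n (L s0) (F' s0) + (\<Sum>a<n. tint n (L s0) (\<lambda>Y. F s0 Y * L' s0 (Y a)))"
  proof -
    have i: "integrable S (\<lambda>Y. F' s0 Y * exp (T s0 Y))"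
        "integrable S (\<lambda>Y. F s0 Y * T' s0 Y * exp (T s0 Y))"
      by (intro P.bmeas_integrable bmeas_mult bmeas_exp F' mT' F[OF s0] mT[OF s0])+
    have "(\<Sum>a<n. tint n (L s0) (\<lambda>Y. F s0 Y * L' s0 (Y a))) =
        tint n (L s0) (\<lambda>Y. \<Sum>a<n. F s0 Y * L' s0 (Y a))"
      by (rule tint_sum[symmetric]) (intro L[OF s0] bmeas_mult F[OF s0] bmeas_coord L')+
    then show ?thesis
      using i by (simp add: G'_def tint_def T_def T'_def sum_distrib_left)
  qed
  ultimately show ?thesis
    by (simp add: tint_def T_def)
qed

text \<open>Differentiating the normalisation subtracts, for every replica \<open>a\<close>, the same term with
  \<open>Y a\<close> replaced by a fresh replica; the fresh one is put in position \<open>0\<close>.\<close>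

lemma texp_has_real_derivative:
  fixes F F' :: "real \<Rightarrow> (nat \<Rightarrow> 'a) \<Rightarrow> real" and L L' :: "real \<Rightarrow> 'a \<Rightarrow> real"
  assumes "\<delta> > 0"
    and F: "\<And>s. \<bar>s - s0\<bar> < \<delta> \<Longrightarrow> F s \<in> bmeas S" and F': "F' s0 \<in> bmeas S"
    and bdF: "\<And>s Y. \<bar>s - s0\<bar> < \<delta> \<Longrightarrow> Y \<in> space S \<Longrightarrow> \<bar>F s Y\<bar> \<le> C"
    and bdF': "\<And>s Y. \<bar>s - s0\<bar> < \<delta> \<Longrightarrow> Y \<in> space S \<Longrightarrow> \<bar>F' s Y\<bar> \<le> C"
    and derF: "\<And>s Y. \<bar>s - s0\<bar> < \<delta> \<Longrightarrow> Y \<in> space S \<Longrightarrow>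
      ((\<lambda>s. F s Y) has_real_derivative F' s Y) (at s)"
    and L: "\<And>s. \<bar>s - s0\<bar> < \<delta> \<Longrightarrow> L s \<in> bmeas M" and L': "L' s0 \<in> bmeas M"
    and bdL: "\<And>s y. \<bar>s - s0\<bar> < \<delta> \<Longrightarrow> y \<in> space M \<Longrightarrow> \<bar>L s y\<bar> \<le> C"
    and bdL': "\<And>s y. \<bar>s - s0\<bar> < \<delta> \<Longrightarrow> y \<in> space M \<Longrightarrow> \<bar>L' s y\<bar> \<le> C"
    and derL: "\<And>s y. \<bar>s - s0\<bar> < \<delta> \<Longrightarrow> y \<in> space M \<Longrightarrow>
      ((\<lambda>s. L s y) has_real_derivative L' s y) (at s)"
  shows "((\<lambda>s. texp n (L s) (F s)) has_real_derivative
    texp n (L s0) (F' s0) +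
    (\<Sum>a<n. texp (Suc n) (L s0)
      (\<lambda>Y. F s0 (\<lambda>a. Y (Suc a)) * (L' s0 (Y (Suc a)) - L' s0 (Y 0))))) (at s0)"
proof -
  define z where "z s = (\<integral>y. exp (L s y) \<partial>M)" for s
  define m where "m = (\<integral>y. L' s0 y * exp (L s0 y) \<partial>M)"
  have s0: "\<bar>s0 - s0\<bar> < \<delta>"
    using \<open>\<delta> > 0\<close> by simp
  note L0 = L[OF s0] and F0 = F[OF s0]
  have zpos: "z s0 > 0"
    unfolding z_def by (rule Z_pos[OF L0])
  define N' where "N' = tint n (L s0) (F' s0) + (\<Sum>a<n. tint n (L s0) (\<lambda>Y. F s0 Y * L' s0 (Y a)))"
  have dN: "((\<lambda>s. tint n (L s) (F s)) has_real_derivative N') (at s0)"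
    unfolding N'_def by (rule tint_has_real_derivative; fact)
  have dz: "(z has_real_derivative m) (at s0)"
  proof -
    obtain y0 where "y0 \<in> space M"
      using M.not_empty by auto
    then have "C \<ge> 0"
      using bdL[of s0 y0] \<open>\<delta> > 0\<close> by auto
    show ?thesis
      unfolding z_def m_def
    proof (rule M.has_real_derivative_integral[OF \<open>\<delta> > 0\<close>, where G' = "\<lambda>s y. L' s y * exp (L s y)"])
      show "(\<lambda>y. exp (L s y)) \<in> bmeas M" if "\<bar>s - s0\<bar> < \<delta>" for s
        using that by (intro bmeas_exp L)
      show "(\<lambda>y. L' s0 y * exp (L s0 y)) \<in> bmeas M"
        by (intro bmeas_mult bmeas_exp L' L0)
      show "\<bar>L' s y * exp (L s y)\<bar> \<le> C * exp C" if "\<bar>s - s0\<bar> < \<delta>" "y \<in> space M" for s y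
        using bdL[OF that] bdL'[OF that] \<open>C \<ge> 0\<close> by (auto simp: abs_mult intro!: mult_mono)
      show "((\<lambda>s. exp (L s y)) has_real_derivative L' s y * exp (L s y)) (at s)"
        if "\<bar>s - s0\<bar> < \<delta>" "y \<in> space M" for s y
        using derL[OF that] by (auto intro!: derivative_eq_intros)
    qed
  qed
  have "((\<lambda>s. tint n (L s) (F s) / z s ^ n) has_real_derivative
      N' / z s0 ^ n - real n * (tint n (L s0) (F s0) * m / z s0 ^ Suc n)) (at s0)"
  proof -
    have "((\<lambda>s. z s ^ n) has_real_derivative real n * (m * z s0 ^ (n - 1))) (at s0)"
      using DERIV_power[OF dz, of n] by simp
    note d = DERIV_divide[OF dN this]
    have "(N' * z s0 ^ n - tint n (L s0) (F s0) * (real n * (m * z s0 ^ (n - 1)))) / (z s0 ^ n * z s0 ^ n) =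
        N' / z s0 ^ n - real n * (tint n (L s0) (F s0) * m / z s0 ^ Suc n)"
      \<comment> \<open>For \<open>n = 0\<close> the exponent \<open>n - 1\<close> is truncated, but
        the factor \<open>real n\<close> vanishes.\<close>
      using zpos by (cases n) (simp_all add: field_simps)
    with d zpos show ?thesis
      by simp
  qed
  \<comment> \<open>Coordinate \<open>0\<close> integrates to the normalisation in the first product
    and to \<open>m\<close> in the second. The second value does not depend on \<open>a\<close>, so
    the \<open>n\<close> summands together reproduce the derivative of
    \<open>z s ^ n\<close>.\<close>
  moreover have E: "texp (Suc n) (L s0) (\<lambda>Y. F s0 (\<lambda>a. Y (Suc a)) * (L' s0 (Y (Suc a)) - L' s0 (Y 0))) =
      tint n (L s0) (\<lambda>Y. F s0 Y * L' s0 (Y a)) / z s0 ^ n - tint n (L s0) (F s0) * m / z s0 ^ Suc n" for a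
  proof -
    have c: "(\<lambda>Y. F s0 Y * L' s0 (Y a)) \<in> bmeas S"
      by (intro bmeas_mult F0 bmeas_coord L')
    have 1: "texp (Suc n) (L s0) (\<lambda>Y. F s0 (\<lambda>a. Y (Suc a)) * L' s0 (Y (Suc a))) =
        tint n (L s0) (\<lambda>Y. F s0 Y * L' s0 (Y a)) / z s0 ^ n"
      using tint_head_product[OF c bmeas_const[of 1] L0, of n] zpos
      by (simp add: texp_def z_def)
    have 2: "texp (Suc n) (L s0) (\<lambda>Y. F s0 (\<lambda>a. Y (Suc a)) * L' s0 (Y 0)) =
        tint n (L s0) (F s0) * m / z s0 ^ Suc n"
      using tint_head_product[OF F0 L' L0, of n] by (simp add: texp_def z_def m_def)
    have "texp (Suc n) (L s0) (\<lambda>Y. F s0 (\<lambda>a. Y (Suc a)) * L' s0 (Y (Suc a)) -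
        F s0 (\<lambda>a. Y (Suc a)) * L' s0 (Y 0)) =
        tint n (L s0) (\<lambda>Y. F s0 Y * L' s0 (Y a)) / z s0 ^ n - tint n (L s0) (F s0) * m / z s0 ^ Suc n"
      unfolding 1[symmetric] 2[symmetric]
      by (rule texp_diff[OF bmeas_reindex[OF c, of Suc]
          bmeas_mult[OF bmeas_reindex[OF F0, of Suc] bmeas_coord[OF L', of 0]] L0])
    then show ?thesis
      by (simp add: right_diff_distrib)
  qed
  then have "texp n (L s0) (F' s0) + (\<Sum>a<n. texp (Suc n) (L s0)
        (\<lambda>Y. F s0 (\<lambda>a. Y (Suc a)) * (L' s0 (Y (Suc a)) - L' s0 (Y 0)))) =
      N' / z s0 ^ n - real n * (tint n (L s0) (F s0) * m / z s0 ^ Suc n)"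
    unfolding E
    by (simp add: N'_def texp_def sum_subtractf add_divide_distrib flip: z_def sum_divide_distrib)
  ultimately show ?thesis
    by (simp add: z_def texp_def)
qed

end

section \<open>Moments of an exponentially tilted doubling measure\<close>

lemma pow_le_exp: "0 \<le> u \<Longrightarrow> u ^ k \<le> real k ^ k * exp (u::real)"
proof (cases "k = 0")
  case False
  assume "0 \<le> u"
  then have "(u / real k) ^ k \<le> exp (u / real k) ^ k"
    using exp_ge_add_one_self[of "u / real k"] by (intro power_mono) (linarith, simp)
  also have "\<dots> = exp u"
    using False by (simp flip: exp_of_nat_mult)
  finally show ?thesis
    using False by (simp add: power_divide field_simps)
qed simp

text \<open>Split at \<open>X = 4 * \<Lambda>\<close>: below, the power is bounded directly; above,
  \<open>X / 2 - \<Lambda>\<close> exceeds \<open>X / 4\<close>. When \<open>exp \<Lambda>\<close>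
  bounds the mean of \<open>exp (X / 2)\<close>, the last summand has a bounded mean, so \<Lambda>
  enters the moments only as a power.\<close>

lemma pow_le_exp_half:
  fixes X \<Lambda> :: real
  assumes "0 \<le> X" "0 \<le> \<Lambda>"
  shows "X ^ k \<le> 4 ^ k * (\<Lambda> ^ k + real k ^ k * exp (X / 2 - \<Lambda>))"
proof (cases "X / 2 \<le> 2 * \<Lambda>")
  case True
  then have "X ^ k \<le> (4 * \<Lambda>) ^ k"
    using assms by (intro power_mono) auto
  also have "\<dots> \<le> 4 ^ k * (\<Lambda> ^ k + real k ^ k * exp (X / 2 - \<Lambda>))"
    by (simp add: power_mult_distrib)
  finally show ?thesis .
next
  case False
  then have "X ^ k \<le> (4 * (X / 2 - \<Lambda>)) ^ k"
    using assms by (intro power_mono) auto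
  also have "\<dots> \<le> 4 ^ k * (real k ^ k * exp (X / 2 - \<Lambda>))"
    using False assms unfolding power_mult_distrib by (intro mult_left_mono pow_le_exp) auto
  also have "\<dots> \<le> 4 ^ k * (\<Lambda> ^ k + real k ^ k * exp (X / 2 - \<Lambda>))"
    using assms by simp
  finally show ?thesis .
qed

lemma nn_integral_exp_Ici: "(\<integral>\<^sup>+v. ennreal (indicator {a..} v * exp (- v)) \<partial>lborel) = ennreal (exp (- a))"
proof -
  have "(\<integral>\<^sup>+v. ennreal (exp (- v)) * indicator {a..} v \<partial>lborel) = ennreal (0 - (- exp (- a)))"
  proof (rule nn_integral_FTC_atLeast)
    show "((\<lambda>v. - exp (- v)) has_real_derivative exp (- v)) (at v)" for v :: real
      by (auto intro!: derivative_eq_intros)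
    show "((\<lambda>v::real. - exp (- v)) \<longlongrightarrow> 0) at_top"
      using tendsto_minus[OF filterlim_compose[OF exp_at_bot filterlim_uminus_at_bot_at_top]] by simp
  qed auto
  then show ?thesis
    by (simp add: mult.commute ennreal_mult'' flip: ennreal_indicator)
qed

text \<open>Layer cake: \<open>\<integral> exp (-X) = \<integral> exp (-v) P(X \<le> v) dv\<close>, and \<open>X / 2\<close> turns the distribution
  function at \<open>v\<close> into the one at \<open>2 v\<close>.\<close>

lemma (in prob_space) integral_exp_half_le_of_doubling:
  assumes X: "X \<in> bmeas M" and "\<And>x. x \<in> space M \<Longrightarrow> 0 \<le> X x" and "D \<ge> 1"
    and doubling: "\<And>v. v > 0 \<Longrightarrow> prob {x \<in> space M. X x \<le> 2 * v} \<le> D * prob {x \<in> space M. X x \<le> v}"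
  shows "(\<integral>x. exp (- (X x / 2)) \<partial>M) \<le> D * (\<integral>x. exp (- X x) \<partial>M)"
proof -
  have [measurable]: "X \<in> borel_measurable M"
    by (rule bmeas_measurable[OF X])
  interpret pair_sigma_finite M lborel ..
  have cake: "(\<integral>\<^sup>+x. ennreal (exp (- Y x)) \<partial>M) =
      (\<integral>\<^sup>+v. ennreal (exp (- v)) * emeasure M {x \<in> space M. Y x \<le> v} \<partial>lborel)"
    if [measurable]: "Y \<in> borel_measurable M" for Y :: "'a \<Rightarrow> real"
  proof -
    have "(\<integral>\<^sup>+x. ennreal (exp (- Y x)) \<partial>M) =
        (\<integral>\<^sup>+x. (\<integral>\<^sup>+v. ennreal (indicator {Y x..} v * exp (- v)) \<partial>lborel) \<partial>M)"
      by (simp add: nn_integral_exp_Ici)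
    also have "\<dots> = (\<integral>\<^sup>+x. (\<integral>\<^sup>+v. ennreal (exp (- v)) * indicator {p. Y (fst p) \<le> snd p} (x, v) \<partial>lborel) \<partial>M)"
      by (intro nn_integral_cong) (auto simp: indicator_def)
    also have "\<dots> = (\<integral>\<^sup>+v. (\<integral>\<^sup>+x. ennreal (exp (- v)) * indicator {p. Y (fst p) \<le> snd p} (x, v) \<partial>M) \<partial>lborel)"
      by (rule Fubini'[symmetric]) measurable
    also have "\<dots> = (\<integral>\<^sup>+v. ennreal (exp (- v)) * emeasure M {x \<in> space M. Y x \<le> v} \<partial>lborel)"
    proof (rule nn_integral_cong)
      fix v :: real
      have "(\<integral>\<^sup>+x. ennreal (exp (- v)) * indicator {p. Y (fst p) \<le> snd p} (x, v) \<partial>M) =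
          (\<integral>\<^sup>+x. ennreal (exp (- v)) * indicator {x \<in> space M. Y x \<le> v} x \<partial>M)"
        by (intro nn_integral_cong) (auto simp: indicator_def)
      then show "(\<integral>\<^sup>+x. ennreal (exp (- v)) * indicator {p. Y (fst p) \<le> snd p} (x, v) \<partial>M) =
          ennreal (exp (- v)) * emeasure M {x \<in> space M. Y x \<le> v}"
        by (simp add: nn_integral_cmult_indicator)
    qed
    finally show ?thesis .
  qed
  have le: "prob {x \<in> space M. X x / 2 \<le> v} \<le> D * prob {x \<in> space M. X x \<le> v}" for v
  proof (cases "v > 0")
    case True
    then show ?thesis
      using doubling[of v] by (simp add: mult.commute)
  next
    case False
    \<comment> \<open>Doubling is given for \<open>v > 0\<close> only; for \<open>v \<le> 0\<close>,
      however, \<open>X / 2 \<le> v\<close> already forces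
      \<open>X \<le> 2 * v \<le> v\<close>.\<close>
    then have "prob {x \<in> space M. X x / 2 \<le> v} \<le> prob {x \<in> space M. X x \<le> v}"
      by (intro finite_measure_mono) (use False in auto)
    also have "\<dots> \<le> D * prob {x \<in> space M. X x \<le> v}"
      using mult_right_mono[OF \<open>D \<ge> 1\<close> measure_nonneg] by simp
    finally show ?thesis .
  qed
  have "(\<integral>\<^sup>+x. ennreal (exp (- (X x / 2))) \<partial>M) \<le>
      (\<integral>\<^sup>+v. ennreal D * (ennreal (exp (- v)) * emeasure M {x \<in> space M. X x \<le> v}) \<partial>lborel)"
    unfolding cake[OF borel_measurable_divide[OF \<open>X \<in> borel_measurable M\<close> borel_measurable_const]]
  proof (intro nn_integral_mono)
    fix v :: real
    show "ennreal (exp (- v)) * emeasure M {x \<in> space M. X x / 2 \<le> v} \<le>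
        ennreal D * (ennreal (exp (- v)) * emeasure M {x \<in> space M. X x \<le> v})"
      using le[of v] \<open>D \<ge> 1\<close> unfolding emeasure_eq_measure
      by (auto simp: mult_left_mono mult.left_commute simp flip: ennreal_mult intro!: ennreal_leI)
  qed
  also have "\<dots> = ennreal D * (\<integral>\<^sup>+x. ennreal (exp (- X x)) \<partial>M)"
    unfolding cake[OF \<open>X \<in> borel_measurable M\<close>] by (rule nn_integral_cmult) measurable
  finally have "ennreal (\<integral>x. exp (- (X x / 2)) \<partial>M) \<le> ennreal D * ennreal (\<integral>x. exp (- X x) \<partial>M)"
    using bmeas_integrable[OF bmeas_exp[OF bmeas_minus[OF bmeas_divide[OF X]]], of 2]
      bmeas_integrable[OF bmeas_exp[OF bmeas_minus[OF X]]]
    by (simp add: nn_integral_eq_integral)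
  then show ?thesis
    using \<open>D \<ge> 1\<close> by (simp add: ennreal_le_iff flip: ennreal_mult)
qed

text \<open>The mean of \<open>exp (X / 2)\<close> under the tilt is at most
  \<open>exp \<Lambda>\<close> with \<open>\<Lambda> = ln D + \<Gamma>\<close>: dropping
  \<open>G\<close> is free, doubling removes the half at the price of \<open>D\<close>, and
  restoring \<open>G\<close> costs \<open>exp \<Gamma>\<close>. Then \<open>pow_le_exp_half\<close>
  applies. The constant \<open>c\<close> cancels between the two sides, so its size is
  irrelevant.\<close>

lemma (in prob_space) tilted_moment_le:
  assumes X: "X \<in> bmeas M" and X0: "\<And>x. x \<in> space M \<Longrightarrow> 0 \<le> X x" and "D \<ge> 1"
    and doubling: "\<And>v. v > 0 \<Longrightarrow> prob {x \<in> space M. X x \<le> 2 * v} \<le> D * prob {x \<in> space M. X x \<le> v}"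
    and G: "G \<in> bmeas M" and G0: "\<And>x. x \<in> space M \<Longrightarrow> 0 \<le> G x" "\<And>x. x \<in> space M \<Longrightarrow> G x \<le> \<Gamma>"
    and L: "\<And>x. x \<in> space M \<Longrightarrow> L x = c - X x - G x"
  shows "(\<integral>x. X x ^ k * exp (L x) \<partial>M) \<le> 4 ^ k * ((ln D + \<Gamma>) ^ k + real k ^ k) * (\<integral>x. exp (L x) \<partial>M)"
proof -
  define \<Lambda> where "\<Lambda> = ln D + \<Gamma>"
  obtain x0 where "x0 \<in> space M"
    using not_empty by auto
  then have "\<Lambda> \<ge> 0"
    using G0[of x0] \<open>D \<ge> 1\<close> by (simp add: \<Lambda>_def)
  have e\<Lambda>: "exp \<Lambda> = D * exp \<Gamma>"
    using \<open>D \<ge> 1\<close> by (simp add: \<Lambda>_def exp_add)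
  have Lb: "L \<in> bmeas M"
    using bmeas_diff[OF bmeas_diff[OF bmeas_const X] G, of c] L by (simp cong: bmeas_cong)
  note [intro] = bmeas_integrable bmeas_mult bmeas_exp bmeas_power bmeas_divide
  note [simp] = X Lb
  have "(\<integral>x. exp (X x / 2) * exp (L x) \<partial>M) \<le> (\<integral>x. exp c * exp (- (X x / 2)) \<partial>M)"
    using G0 by (intro integral_mono bmeas_integrable bmeas_mult bmeas_exp bmeas_divide bmeas_minus)
      (auto simp: L simp flip: exp_add)
  also have "\<dots> = exp c * (\<integral>x. exp (- (X x / 2)) \<partial>M)"
    by simp
  also have "\<dots> \<le> exp c * (D * (\<integral>x. exp (- X x) \<partial>M))"
    by (intro mult_left_mono integral_exp_half_le_of_doubling[OF X X0 \<open>D \<ge> 1\<close> doubling]) auto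
  also have "\<dots> = D * (\<integral>x. exp c * exp (- X x) \<partial>M)"
    by simp
  also have "\<dots> \<le> D * (\<integral>x. exp \<Gamma> * exp (L x) \<partial>M)"
    using G0 \<open>D \<ge> 1\<close>
    by (intro mult_left_mono integral_mono bmeas_integrable bmeas_mult bmeas_exp bmeas_divide bmeas_minus)
      (auto simp: L simp flip: exp_add)
  finally have E: "(\<integral>x. exp (X x / 2) * exp (L x) \<partial>M) \<le> exp \<Lambda> * (\<integral>x. exp (L x) \<partial>M)"
    by (simp add: e\<Lambda>)
  have "(\<integral>x. X x ^ k * exp (L x) \<partial>M) \<le>
      (\<integral>x. 4 ^ k * \<Lambda> ^ k * exp (L x) + 4 ^ k * real k ^ k * exp (- \<Lambda>) * (exp (X x / 2) * exp (L x)) \<partial>M)"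
  proof (intro integral_mono bmeas_integrable bmeas_add bmeas_mult bmeas_exp bmeas_power bmeas_divide bmeas_const)
    fix x assume "x \<in> space M"
    then have "X x ^ k * exp (L x) \<le> 4 ^ k * (\<Lambda> ^ k + real k ^ k * exp (X x / 2 - \<Lambda>)) * exp (L x)"
      using X0 \<open>\<Lambda> \<ge> 0\<close> by (intro mult_right_mono pow_le_exp_half) auto
    moreover have "exp (X x / 2 - \<Lambda>) = exp (- \<Lambda>) * exp (X x / 2)"
      by (simp flip: exp_add)
    ultimately show "X x ^ k * exp (L x) \<le> 4 ^ k * \<Lambda> ^ k * exp (L x) +
        4 ^ k * real k ^ k * exp (- \<Lambda>) * (exp (X x / 2) * exp (L x))"
      by (simp add: algebra_simps)
  qed auto
  also have "\<dots> = 4 ^ k * \<Lambda> ^ k * (\<integral>x. exp (L x) \<partial>M) +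
      4 ^ k * real k ^ k * exp (- \<Lambda>) * (\<integral>x. exp (X x / 2) * exp (L x) \<partial>M)"
    using bmeas_integrable[OF bmeas_exp[OF Lb]]
      bmeas_integrable[OF bmeas_mult[OF bmeas_exp[OF bmeas_divide[OF X]] bmeas_exp[OF Lb]], of 2]
    by (subst Bochner_Integration.integral_add) auto
  also have "\<dots> \<le> 4 ^ k * \<Lambda> ^ k * (\<integral>x. exp (L x) \<partial>M) +
      4 ^ k * real k ^ k * exp (- \<Lambda>) * (exp \<Lambda> * (\<integral>x. exp (L x) \<partial>M))"
    using E by (intro add_left_mono mult_left_mono) auto
  also have "\<dots> = 4 ^ k * (\<Lambda> ^ k + real k ^ k) * (\<integral>x. exp (L x) \<partial>M)"
    by (simp add: exp_minus field_simps)
  finally show ?thesis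
    by (simp add: \<Lambda>_def)
qed

section \<open>Finite-dimensional vectors and the support\<close>

lemma vnorm_nonneg [simp]: "0 \<le> vnorm d x"
  by (simp add: vnorm_def L2_set_nonneg)

lemma dot_self: "dot d y y = (vnorm d y)\<^sup>2"
  by (simp add: dot_def vnorm_def L2_set_def sum_nonneg power2_eq_square)

lemma dot_commute: "dot d x y = dot d y x"
  by (simp add: dot_def mult.commute)

lemma abs_dot_le: "\<bar>dot d x y\<bar> \<le> vnorm d x * vnorm d y"
proof -
  have "\<bar>dot d x y\<bar> \<le> (\<Sum>i<d. \<bar>x i\<bar> * \<bar>y i\<bar>)"
    unfolding dot_def abs_mult[symmetric] by (rule sum_abs)
  also have "\<dots> \<le> vnorm d x * vnorm d y"
    unfolding vnorm_def by (rule L2_set_mult_ineq)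
  finally show ?thesis .
qed

lemma vnorm_add_le: "vnorm d (\<lambda>i. x i + y i) \<le> vnorm d x + vnorm d y"
  unfolding vnorm_def by (rule L2_set_triangle_ineq)

lemma vnorm_cmult: "vnorm d (\<lambda>i. c * x i) = \<bar>c\<bar> * vnorm d x"
  unfolding vnorm_def L2_set_def power_mult_distrib sum_distrib_left[symmetric]
  by (simp add: real_sqrt_mult)

lemma vnorm_minus: "vnorm d (\<lambda>i. - x i) = vnorm d x"
  by (simp add: vnorm_def L2_set_def)

lemma vnorm_minus_commute: "vnorm d (\<lambda>i. x i - y i) = vnorm d (\<lambda>i. y i - x i)"
  by (simp add: vnorm_def L2_set_def power2_commute)

lemma vnorm_diff_le: "vnorm d (\<lambda>i. x i - y i) \<le> vnorm d x + vnorm d y"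
  using vnorm_add_le[of d x "\<lambda>i. - y i"] by (simp add: vnorm_minus)

lemma vnorm_diff_triangle: "vnorm d (\<lambda>i. x i - z i) \<le> vnorm d (\<lambda>i. x i - y i) + vnorm d (\<lambda>i. y i - z i)"
  using vnorm_add_le[of d "\<lambda>i. x i - y i" "\<lambda>i. y i - z i"] by simp

lemma abs_coord_le_vnorm: "i < d \<Longrightarrow> \<bar>x i\<bar> \<le> vnorm d x"
  using member_le_L2_set[of "{..<d}" i "\<lambda>i. \<bar>x i\<bar>"] by (simp add: vnorm_def L2_set_def)

lemma dot_eq_0_of_vnorm_eq_0: "vnorm d x = 0 \<Longrightarrow> dot d x y = 0"
  using abs_dot_le[of d x y] by simp

lemma dot_diff_left: "dot d (\<lambda>i. x i - y i) z = dot d x z - dot d y z"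
  by (simp add: dot_def left_diff_distrib sum_subtractf)

lemma dot_cmult_right: "dot d z (\<lambda>i. c * x i) = c * dot d z x"
  by (simp add: dot_def sum_distrib_left mult_ac)

lemma dot_normalised: "vnorm d x * dot d (\<lambda>i. x i / vnorm d x) y = dot d x y"
proof (cases "vnorm d x = 0")
  case False
  then show ?thesis
    by (simp add: dot_def sum_distrib_left)
qed (simp add: dot_eq_0_of_vnorm_eq_0)

lemma vnorm_sq_diff_scaled:
  "(vnorm d (\<lambda>i. x i - e * y i))\<^sup>2 = dot d x x - 2 * e * dot d x y + e\<^sup>2 * dot d y y"
  by (simp add: flip: dot_self)
    (simp add: dot_def sum_distrib_left power2_eq_square algebra_simps flip: sum.distrib sum_subtractf)

section \<open>Measurability and full mass of the support\<close>

lemma borel_prob_coord_measurable: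
  assumes "borel_prob d P" "i < d"
  shows "(\<lambda>y. y i) \<in> borel_measurable P"
proof -
  have "(\<lambda>y. y i) \<in> borel_measurable (PiM {..<d} (\<lambda>_. borel :: real measure))"
    using assms(2) by (intro measurable_component_singleton) auto
  then show ?thesis
    using assms(1) by (simp add: borel_prob_def cong: measurable_cong_sets)
qed

lemma rational_approx:
  assumes "0 < r"
  obtains q where "q \<in> PiE {..<d} (\<lambda>_. \<rat>)" "vnorm d (\<lambda>i. q i - y i) < r"
proof -
  \<comment> \<open>The summand \<open>1\<close> keeps the denominator positive for
    \<open>d = 0\<close> and makes the sum of the \<open>d\<close> errors strictly smaller than
    \<open>r\<close>.\<close>
  have "\<exists>p\<in>\<rat>. \<bar>p - y i\<bar> < r / (real d + 1)" for i
  proof -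
    obtain p where "p \<in> \<rat>" "y i < p" "p < y i + r / (real d + 1)"
      using Rats_dense_in_real[of "y i" "y i + r / (real d + 1)"] assms by auto
    then show ?thesis
      by (intro bexI[of _ p]) auto
  qed
  then obtain p where p: "\<And>i. p i \<in> \<rat>" "\<And>i. \<bar>p i - y i\<bar> < r / (real d + 1)"
    by metis
  have "vnorm d (\<lambda>i. restrict p {..<d} i - y i) \<le> (\<Sum>i<d. \<bar>p i - y i\<bar>)"
    unfolding vnorm_def by (rule order_trans[OF L2_set_le_sum_abs]) simp
  also have "\<dots> \<le> real d * (r / (real d + 1))"
    using sum_bounded_above[of "{..<d}" "\<lambda>i. \<bar>p i - y i\<bar>" "r / (real d + 1)"] p(2)
    by (simp add: less_imp_le)
  also have "\<dots> < r"
    using assms by (simp add: field_simps)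
  finally show ?thesis
    using p(1) by (intro that[of "restrict p {..<d}"]) auto
qed

lemma vnorm_ball_measurable:
  assumes "borel_prob d P"
  shows "{z \<in> space P. vnorm d (\<lambda>i. z i - y i) < r} \<in> sets P"
proof -
  have [measurable]: "(\<lambda>z. z i) \<in> borel_measurable P" if "i \<in> {..<d}" for i
    using borel_prob_coord_measurable[OF assms] that by auto
  show ?thesis
    unfolding vnorm_def L2_set_def by measurable
qed

text \<open>The complement of the support is a union of null balls with rational centres and radii.
  Since there are countably many of these, it is a measurable null set, which gives both
  claims.\<close>

lemma
  assumes bp: "borel_prob d P"
  shows supp_measurable: "supp d P \<in> sets P"
    and AE_supp: "AE y in P. y \<in> supp d P"
proof -
  interpret prob_space P
    using bp by (simp add: borel_prob_def)
  define B where "B = (\<lambda>(q, s). {z \<in> space P. vnorm d (\<lambda>i. z i - q i) < s})"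
  define I where "I = {qs \<in> PiE {..<d} (\<lambda>_. \<rat>) \<times> \<rat>. prob (B qs) = 0}"
  have "countable I"
    unfolding I_def
    by (rule countable_subset[OF _ countable_SIGMA[of "PiE {..<d} (\<lambda>_. \<rat>)" "\<lambda>_. \<rat>"]])
      (auto intro!: countable_PiE countable_rat)
  have mB [measurable]: "B qs \<in> sets P" for qs
    using vnorm_ball_measurable[OF bp] by (cases qs) (simp add: B_def)
  have eq: "space P - supp d P = (\<Union>qs\<in>I. B qs)"
  proof (intro equalityI subsetI)
    fix y assume y: "y \<in> space P - supp d P"
    then obtain r where r: "r > 0" "prob {z \<in> space P. vnorm d (\<lambda>i. z i - y i) < r} = 0"
      by (auto simp: supp_def not_less measure_le_0_iff)
    \<comment> \<open>With a radius below \<open>r / 2\<close>, a ball around a rational centre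
      within distance \<open>s\<close> of \<open>y\<close> contains \<open>y\<close> and stays
      inside the null ball of radius \<open>r\<close>.\<close>
    obtain s where s: "s \<in> \<rat>" "0 < s" "s < r / 2"
      using Rats_dense_in_real[of 0 "r / 2"] r by auto
    obtain q where q: "q \<in> PiE {..<d} (\<lambda>_. \<rat>)" "vnorm d (\<lambda>i. q i - y i) < s"
      using rational_approx[OF s(2)] by blast
    have "B (q, s) \<subseteq> {z \<in> space P. vnorm d (\<lambda>i. z i - y i) < r}"
    proof safe
      fix z assume "z \<in> B (q, s)"
      then show "z \<in> space P" "vnorm d (\<lambda>i. z i - y i) < r"
        using vnorm_diff_triangle[of d z y q] q(2) s by (auto simp: B_def)
    qed
    then have "prob (B (q, s)) \<le> prob {z \<in> space P. vnorm d (\<lambda>i. z i - y i) < r}"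
      by (intro finite_measure_mono vnorm_ball_measurable[OF bp])
    then have "(q, s) \<in> I"
      using q s r by (simp add: I_def measure_le_0_iff)
    moreover have "y \<in> B (q, s)"
      using y q by (simp add: B_def vnorm_minus_commute[of d y q])
    ultimately show "y \<in> (\<Union>qs\<in>I. B qs)"
      by blast
  next
    fix y assume "y \<in> (\<Union>qs\<in>I. B qs)"
    then obtain q s where qs: "(q, s) \<in> I" "y \<in> B (q, s)"
      by auto
    define r where "r = s - vnorm d (\<lambda>i. y i - q i)"
    have "r > 0" "y \<in> space P"
      using qs by (auto simp: r_def B_def)
    have "{z \<in> space P. vnorm d (\<lambda>i. z i - y i) < r} \<subseteq> B (q, s)"
    proof safe
      fix z assume z: "z \<in> space P" "vnorm d (\<lambda>i. z i - y i) < r"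
      then show "z \<in> B (q, s)"
        using vnorm_diff_triangle[of d z q y] by (simp add: B_def r_def)
    qed
    then have "prob {z \<in> space P. vnorm d (\<lambda>i. z i - y i) < r} \<le> prob (B (q, s))"
      by (intro finite_measure_mono) auto
    also have "\<dots> = 0"
      using qs by (simp add: I_def)
    finally have "y \<notin> supp d P"
      using \<open>r > 0\<close> by (auto simp: supp_def not_less)
    then show "y \<in> space P - supp d P"
      using \<open>y \<in> space P\<close> by simp
  qed
  have "(\<Union>qs\<in>I. B qs) \<in> null_sets P"
  proof (rule null_sets_UN'[OF \<open>countable I\<close>])
    fix qs assume "qs \<in> I"
    then have "prob (B qs) = 0"
      by (simp add: I_def)
    then show "B qs \<in> null_sets P"
      by (intro null_setsI mB) (simp add: emeasure_eq_measure)
  qed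
  then have null: "space P - supp d P \<in> null_sets P"
    by (simp add: eq)
  show "AE y in P. y \<in> supp d P"
    by (rule AE_I'[OF null]) blast
  have "space P - (space P - supp d P) = supp d P"
    by (auto simp: supp_def)
  then show "supp d P \<in> sets P"
    using sets.compl_sets[OF null_setsD2[OF null]] by (simp only:)
qed

section \<open>The posterior as a tilted measure\<close>

lemma bcoef_ge_1: "t > 0 \<Longrightarrow> bcoef t \<ge> 1"
  by (simp add: bcoef_def one_le_inverse_iff)

lemma bcoef_mult_exp: "t > 0 \<Longrightarrow> bcoef t * (exp (- t / 2))\<^sup>2 = bcoef t - 1"
proof -
  assume "t > 0"
  have "(exp (- t / 2))\<^sup>2 = exp (- t)"
    by (simp add: power2_eq_square flip: exp_add)
  then show ?thesis
    using \<open>t > 0\<close> by (simp add: bcoef_def field_simps)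
qed

text \<open>The part of the log-likelihood that depends on \<open>y\<close>, with
  \<open>bcoef t * exp (- t)\<close> rewritten as \<open>bcoef t - 1\<close>. The part that depends
  on \<open>x\<close> alone cancels in the normalised posterior.\<close>

definition lw :: "nat \<Rightarrow> real \<Rightarrow> vec \<Rightarrow> vec \<Rightarrow> real" where
  "lw d t x y = exp (- t / 2) * bcoef t * dot d x y - (bcoef t - 1) / 2 * dot d y y"

lemma likelihood_eq:
  assumes "t > 0"
  shows "likelihood d t x y = exp (- (bcoef t / 2) * dot d x x) * exp (lw d t x y)"
proof -
  define e where "e = exp (- t / 2)"
  define b where "b = bcoef t"
  have "A / (2 * B) = inverse B / 2 * A" for A B :: real
    by (simp add: field_simps)
  then have "(vnorm d (\<lambda>i. x i - e * y i))\<^sup>2 / (2 * (1 - exp (- t))) =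
      b / 2 * (dot d x x - 2 * e * dot d x y + e\<^sup>2 * dot d y y)"
    unfolding vnorm_sq_diff_scaled b_def bcoef_def .
  also have "\<dots> = b / 2 * dot d x x - e * b * dot d x y + (b * e\<^sup>2) / 2 * dot d y y"
    by (simp add: algebra_simps)
  also have "b * e\<^sup>2 = b - 1"
    unfolding b_def e_def by (rule bcoef_mult_exp[OF assms])
  finally have "likelihood d t x y = exp (- (b / 2 * dot d x x - e * b * dot d x y + (b - 1) / 2 * dot d y y))"
    by (simp only: likelihood_def e_def)
  also have "\<dots> = exp (- (b / 2) * dot d x x) * exp (e * b * dot d x y - (b - 1) / 2 * dot d y y)"
    by (simp flip: exp_add)
  finally show ?thesis
    by (simp only: lw_def b_def e_def)
qed

locale cloud =
  fixes d :: nat and P :: "vec measure" and R :: real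
  assumes bp: "borel_prob d P" and supp_bounded: "supp d P \<subseteq> {y. vnorm d y \<le> R}"

text \<open>On the support, which has full mass, \<open>vnorm d y \<le> R\<close> and the
  nonnegativity of the width hold at every point and not just almost everywhere. The integrands are
  then bounded on the whole space and lie in \<open>bmeas\<close>.\<close>

sublocale cloud \<subseteq> sequence_space "restrict_space P (supp d P)"
proof -
  interpret P0: prob_space P
    using bp by (simp add: borel_prob_def)
  have "emeasure P (supp d P) = 1"
    using P0.emeasure_eq_1_AE[OF supp_measurable[OF bp] AE_supp[OF bp]] .
  then interpret prob_space "restrict_space P (supp d P)"
    by (intro prob_space_restrict_space supp_measurable[OF bp])
  show "sequence_space (restrict_space P (supp d P))"
    by unfold_locales
qed

context cloud
begin

abbreviation "Q \<equiv> restrict_space P (supp d P)"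

lemma supp_inter [simp]: "supp d P \<inter> space P = supp d P" "supp d P \<inter> space P \<in> sets P"
  using supp_measurable[OF bp] by (auto simp: supp_def)

lemma space_Q [simp]: "space Q = supp d P"
  by (auto simp: space_restrict_space supp_def)

lemma vnorm_supp: "y \<in> supp d P \<Longrightarrow> vnorm d y \<le> R"
  using supp_bounded by auto

lemma R_nonneg: "R \<ge> 0"
proof -
  obtain y where "y \<in> supp d P"
    using M.not_empty by auto
  then show ?thesis
    using vnorm_supp[of y] order_trans[OF vnorm_nonneg] by blast
qed

lemma measurable_coord_P: "i < d \<Longrightarrow> (\<lambda>y. y i) \<in> borel_measurable P"
  by (rule borel_prob_coord_measurable[OF bp])

lemma measurable_dot_P: "(\<lambda>y. dot d x y) \<in> borel_measurable P" "(\<lambda>y. dot d y y) \<in> borel_measurable P"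
  unfolding dot_def by (auto intro!: borel_measurable_sum borel_measurable_times measurable_coord_P)

lemma bmeas_coord_Q: "i < d \<Longrightarrow> (\<lambda>y. y i) \<in> bmeas Q"
  by (rule bmeasI[where C = R])
    (auto intro!: measurable_restrict_space1 measurable_coord_P intro: order_trans[OF abs_coord_le_vnorm vnorm_supp])

lemma bmeas_dot_Q: "(\<lambda>y. dot d x y) \<in> bmeas Q" "(\<lambda>y. dot d y y) \<in> bmeas Q"
  unfolding dot_def by (auto intro!: bmeas_sum bmeas_mult bmeas_coord_Q)

lemma bmeas_lw: "lw d t x \<in> bmeas Q"
  unfolding lw_def[abs_def] by (intro bmeas_diff bmeas_mult bmeas_const bmeas_dot_Q)

lemma integral_Q: "f \<in> borel_measurable P \<Longrightarrow> (\<integral>y. f y \<partial>P) = (\<integral>y. f y \<partial>Q :: real)"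
  unfolding integral_restrict_space[OF supp_inter(2)]
  using AE_supp[OF bp] supp_measurable[OF bp]
  by (intro integral_cong_AE) (auto elim!: eventually_mono)

lemma measurable_lw_P: "lw d t x \<in> borel_measurable P"
  unfolding lw_def[abs_def]
  by (intro borel_measurable_diff borel_measurable_times borel_measurable_const measurable_dot_P)

lemma posterior_integral:
  assumes "t > 0" and f: "f \<in> borel_measurable P"
  shows "(LINT y|posterior d P t x. f y) =
    (\<integral>y. f y * exp (lw d t x y) \<partial>Q) / (\<integral>y. exp (lw d t x y) \<partial>Q)"
proof -
  let ?a = "exp (- (bcoef t / 2) * dot d x x)"
  let ?z = "\<integral>y. exp (lw d t x y) \<partial>Q"
  note [measurable] = measurable_lw_P[of t x] f
  have z: "?z > 0"
    by (rule Z_pos[OF bmeas_lw])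
  have "(LINT y|P. likelihood d t x y) = ?a * ?z"
    by (simp add: likelihood_eq[OF \<open>t > 0\<close>] integral_Q)
  then have "posterior d P t x = density P (\<lambda>y. ennreal (exp (lw d t x y) / ?z))"
    using z by (simp add: posterior_def likelihood_eq[OF \<open>t > 0\<close>])
  then have "(LINT y|posterior d P t x. f y) = (\<integral>y. (exp (lw d t x y) / ?z) *\<^sub>R f y \<partial>P)"
    using z by (simp only:) (rule integral_density; auto)
  also have "\<dots> = (\<integral>y. f y * exp (lw d t x y) / ?z \<partial>P)"
    by (simp add: mult.commute)
  also have "\<dots> = (\<integral>y. f y * exp (lw d t x y) / ?z \<partial>Q)"
    by (rule integral_Q) measurable
  finally show ?thesis
    by simp
qed

subsection \<open>The scaled distance to the supporting hyperplane\<close>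

text \<open>For \<open>vnorm d x = 0\<close> the normalised direction is the zero vector and the width is \<open>0\<close>.\<close>

definition width :: "real \<Rightarrow> vec \<Rightarrow> vec \<Rightarrow> real" where
  "width t x y = exp (- t / 2) * vnorm d x * U_dir d P (\<lambda>i. x i / vnorm d x) y"

lemma width_eq: "width t x y =
  exp (- t / 2) * vnorm d x * (SUP y'\<in>supp d P. dot d (\<lambda>i. x i / vnorm d x) y') - exp (- t / 2) * dot d x y"
  using dot_normalised[of d x y] by (simp add: width_def U_dir_def right_diff_distrib mult.assoc)

text \<open>The supremum is common to both points and cancels. A quantity that grows with
  \<open>x\<close> is thus traded for two nonnegative ones whose moments doubling controls.\<close>

lemma exp_dot_diff: "exp (- t / 2) * (dot d x y - dot d x y') = width t x y' - width t x y"
  by (simp add: width_eq algebra_simps)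

lemma bmeas_width: "width t x \<in> bmeas Q"
  unfolding width_eq[abs_def] by (intro bmeas_diff bmeas_mult bmeas_const bmeas_dot_Q)

lemma width_nonneg:
  assumes "y \<in> supp d P"
  shows "0 \<le> width t x y"
proof -
  let ?\<theta> = "\<lambda>i. x i / vnorm d x"
  have "bdd_above (dot d ?\<theta> ` supp d P)"
    using vnorm_supp abs_dot_le[of d ?\<theta>]
    by (intro bdd_aboveI2[where M = "vnorm d ?\<theta> * R"])
      (meson abs_le_D1 mult_left_mono order_trans vnorm_nonneg)
  then have "dot d ?\<theta> y \<le> (SUP y'\<in>supp d P. dot d ?\<theta> y')"
    by (intro cSUP_upper assms)
  then show ?thesis
    by (simp add: width_def U_dir_def)
qed

lemma F_dir_Q: "F_dir d P \<theta> u = M.prob {y \<in> supp d P. U_dir d P \<theta> y \<le> u}"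
proof -
  interpret P0: prob_space P
    using bp by (simp add: borel_prob_def)
  have m: "{y \<in> space P. U_dir d P \<theta> y \<le> u} \<in> sets P"
    unfolding U_dir_def using measurable_dot_P(1)[of \<theta>] by measurable
  have "{y \<in> supp d P. U_dir d P \<theta> y \<le> u} = supp d P \<inter> {y \<in> space P. U_dir d P \<theta> y \<le> u}"
    by (auto simp: supp_def)
  then have "M.prob {y \<in> supp d P. U_dir d P \<theta> y \<le> u} = P0.prob {y \<in> supp d P. U_dir d P \<theta> y \<le> u}"
    and "{y \<in> supp d P. U_dir d P \<theta> y \<le> u} \<in> sets P"
    using m supp_measurable[OF bp] by (auto simp: measure_restrict_space)
  moreover have "P0.prob {y \<in> supp d P. U_dir d P \<theta> y \<le> u} = P0.prob {y \<in> space P. U_dir d P \<theta> y \<le> u}"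
    using AE_supp[OF bp] m calculation(2) by (intro measure_eq_AE) auto
  ultimately show ?thesis
    by (simp add: F_dir_def)
qed

text \<open>(UD) holds with one constant at all scales, so it survives multiplication by the
  positive number \<open>b * exp (- t / 2) * vnorm d x\<close>; this is why neither \<open>x\<close>
  nor \<open>t\<close> enters the constant. If \<open>x\<close> has norm \<open>0\<close>, the width
  vanishes and \<open>D \<ge> 1\<close> suffices.\<close>

lemma width_doubling:
  assumes "UD d P D" "v > 0" "b > 0"
  shows "M.prob {y \<in> supp d P. b * width t x y \<le> 2 * v} \<le> D * M.prob {y \<in> supp d P. b * width t x y \<le> v}"
proof (cases "vnorm d x = 0")
  case True
  have "1 * M.prob (supp d P) \<le> D * M.prob (supp d P)"
    using assms(1) by (intro mult_right_mono) (auto simp: UD_def)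
  then show ?thesis
    using True \<open>v > 0\<close> by (simp add: width_def)
next
  case False
  define s where "s = b * exp (- t / 2) * vnorm d x"
  have "s > 0"
    using False \<open>b > 0\<close> vnorm_nonneg[of d x] by (simp add: s_def less_le)
  let ?\<theta> = "\<lambda>i. x i / vnorm d x"
  have "vnorm d ?\<theta> = 1"
    using vnorm_cmult[of d "inverse (vnorm d x)" x] False by (simp add: divide_inverse mult.commute)
  then have "F_dir d P ?\<theta> (2 * (v / s)) \<le> D * F_dir d P ?\<theta> (v / s)"
    using assms divide_pos_pos[OF \<open>v > 0\<close> \<open>s > 0\<close>] unfolding UD_def by blast
  moreover have "b * width t x y \<le> u \<longleftrightarrow> U_dir d P ?\<theta> y \<le> u / s" for y u
    using \<open>s > 0\<close> by (simp add: width_def s_def pos_le_divide_eq mult_ac)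
  ultimately show ?thesis
    by (simp add: F_dir_Q)
qed

text \<open>\<open>tilted_moment_le\<close> is applied to \<open>b * W\<close> with
  \<open>\<Gamma> = (b - 1) / 2 * R\<^sup>2\<close>. With \<open>u = b * (1 + R)\<^sup>2\<close> one
  has \<open>ln D + \<Gamma> \<le> u * (ln D + 1)\<close>. Division by \<open>u ^ k\<close> turns
  \<open>b * W\<close> into \<open>W / (1 + R)\<^sup>2\<close>: the \<open>b\<close> of the tilt
  cancels the \<open>b\<close> of the Gaussian cost.\<close>

lemma tilted_width_moment:
  assumes UD: "UD d P D" and "t > 0"
  shows "(\<integral>y. (width t x y / (1 + R)\<^sup>2) ^ k * exp (lw d t x y) \<partial>Q) \<le>
    4 ^ k * ((ln D + 1) ^ k + real k ^ k) * (\<integral>y. exp (lw d t x y) \<partial>Q)"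
proof -
  define b where "b = bcoef t"
  define u where "u = b * (1 + R)\<^sup>2"
  have "D \<ge> 1"
    using UD by (simp add: UD_def)
  have b: "b \<ge> 1"
    using bcoef_ge_1[OF \<open>t > 0\<close>] by (simp add: b_def)
  have R2: "(1 + R)\<^sup>2 \<ge> 1"
    using R_nonneg by (simp add: one_le_power)
  have u1: "u \<ge> 1"
    unfolding u_def using mult_mono[OF b R2] b by simp
  have z: "(\<integral>y. exp (lw d t x y) \<partial>Q) > 0"
    by (rule Z_pos[OF bmeas_lw])
  have "(\<integral>y. (b * width t x y) ^ k * exp (lw d t x y) \<partial>Q) \<le>
      4 ^ k * ((ln D + (b - 1) / 2 * R\<^sup>2) ^ k + real k ^ k) * (\<integral>y. exp (lw d t x y) \<partial>Q)"
  proof (rule M.tilted_moment_le[where G = "\<lambda>y. (b - 1) / 2 * dot d y y"])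
    show "(\<lambda>y. b * width t x y) \<in> bmeas Q" "(\<lambda>y. (b - 1) / 2 * dot d y y) \<in> bmeas Q"
      by (intro bmeas_mult bmeas_const bmeas_width bmeas_dot_Q)+
    show "M.prob {y \<in> space Q. b * width t x y \<le> 2 * v} \<le> D * M.prob {y \<in> space Q. b * width t x y \<le> v}"
      if "v > 0" for v
      using width_doubling[OF UD that, of b] b by simp
    show "lw d t x y = exp (- t / 2) * b * vnorm d x * (SUP y'\<in>supp d P. dot d (\<lambda>i. x i / vnorm d x) y')
        - b * width t x y - (b - 1) / 2 * dot d y y" for y
      by (simp add: lw_def b_def width_eq algebra_simps)
    show "(b - 1) / 2 * dot d y y \<le> (b - 1) / 2 * R\<^sup>2" if "y \<in> space Q" for y
      using that b vnorm_supp by (intro mult_left_mono) (auto simp: dot_self power_mono)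
  qed (use b \<open>D \<ge> 1\<close> width_nonneg in \<open>auto simp: dot_self\<close>)
  also have "\<dots> \<le> 4 ^ k * (u ^ k * (ln D + 1) ^ k + u ^ k * real k ^ k) * (\<integral>y. exp (lw d t x y) \<partial>Q)"
  proof -
    have "R\<^sup>2 \<le> (1 + R)\<^sup>2"
      using R_nonneg by (intro power_mono) auto
    then have "(b - 1) / 2 * R\<^sup>2 \<le> b * (1 + R)\<^sup>2"
      using b by (intro mult_mono) auto
    moreover have "ln D * 1 \<le> ln D * u"
      using \<open>D \<ge> 1\<close> u1 by (intro mult_left_mono) auto
    ultimately have "ln D + (b - 1) / 2 * R\<^sup>2 \<le> u * (ln D + 1)"
      unfolding u_def distrib_left mult_1_right by (simp only: mult.commute[of "ln D"])
    moreover have "0 \<le> ln D + (b - 1) / 2 * R\<^sup>2"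
      using \<open>D \<ge> 1\<close> b by simp
    ultimately have "(ln D + (b - 1) / 2 * R\<^sup>2) ^ k \<le> (u * (ln D + 1)) ^ k"
      by (intro power_mono)
    moreover have "1 * real k ^ k \<le> u ^ k * real k ^ k"
      using u1 by (intro mult_right_mono one_le_power) auto
    ultimately show ?thesis
      using z by (intro mult_right_mono mult_left_mono add_mono) (auto simp: power_mult_distrib)
  qed
  also have "\<dots> = u ^ k * (4 ^ k * ((ln D + 1) ^ k + real k ^ k) * (\<integral>y. exp (lw d t x y) \<partial>Q))"
    by (simp add: algebra_simps)
  finally have "(\<integral>y. (b * width t x y) ^ k * exp (lw d t x y) \<partial>Q) / u ^ k \<le>
      4 ^ k * ((ln D + 1) ^ k + real k ^ k) * (\<integral>y. exp (lw d t x y) \<partial>Q)"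
    using u1 by (simp add: divide_le_eq mult.commute)
  moreover have "(width t x y / (1 + R)\<^sup>2) ^ k * exp (lw d t x y) = (b * width t x y) ^ k * exp (lw d t x y) / u ^ k" for y
    using b by (simp add: u_def power_divide power_mult_distrib)
  ultimately show ?thesis
    by simp
qed

text \<open>The summand \<open>1\<close> makes every factor at least \<open>1\<close>, so that a
  product over all replicas dominates each single factor and can serve as a common bound.\<close>

lemma tilted_one_plus_width_moment:
  assumes UD: "UD d P D" and "t > 0"
  shows "(\<integral>y. (1 + width t x y / (1 + R)\<^sup>2) ^ m * exp (lw d t x y) \<partial>Q) / (\<integral>y. exp (lw d t x y) \<partial>Q)
    \<le> 2 ^ m * (1 + 4 ^ m * ((ln D + 1) ^ m + real m ^ m))"
proof -
  let ?w = "\<lambda>y. width t x y / (1 + R)\<^sup>2" and ?e = "\<lambda>y. exp (lw d t x y)"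
  have z: "(\<integral>y. ?e y \<partial>Q) > 0"
    by (rule Z_pos[OF bmeas_lw])
  have i: "(\<lambda>y. ?e y) \<in> bmeas Q" "(\<lambda>y. ?w y ^ m * ?e y) \<in> bmeas Q" "(\<lambda>y. (1 + ?w y) ^ m * ?e y) \<in> bmeas Q"
    by (intro bmeas_mult bmeas_exp bmeas_power bmeas_add bmeas_const bmeas_divide bmeas_width bmeas_lw)+
  have le: "(1 + w) ^ m \<le> 2 ^ m * (1 + w ^ m)" if "0 \<le> w" for w :: real
  proof (cases "w \<le> 1")
    case True
    then have "(1 + w) ^ m \<le> 2 ^ m"
      using that by (intro power_mono) auto
    then show ?thesis
      using that by (simp add: algebra_simps add_increasing2)
  next
    case False
    then have "(1 + w) ^ m \<le> (2 * w) ^ m"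
      by (intro power_mono) auto
    then show ?thesis
      by (simp add: algebra_simps power_mult_distrib add_increasing)
  qed
  have "(\<integral>y. (1 + ?w y) ^ m * ?e y \<partial>Q) \<le> (\<integral>y. 2 ^ m * (?e y + ?w y ^ m * ?e y) \<partial>Q)"
  proof (intro integral_mono M.bmeas_integrable i bmeas_mult bmeas_add bmeas_const)
    fix y assume "y \<in> space Q"
    then have "(1 + ?w y) ^ m * ?e y \<le> 2 ^ m * (1 + ?w y ^ m) * ?e y"
      using width_nonneg by (intro mult_right_mono le) auto
    then show "(1 + ?w y) ^ m * ?e y \<le> 2 ^ m * (?e y + ?w y ^ m * ?e y)"
      by (simp only: algebra_simps)
  qed
  also have "\<dots> = 2 ^ m * ((\<integral>y. ?e y \<partial>Q) + (\<integral>y. ?w y ^ m * ?e y \<partial>Q))"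
    using M.bmeas_integrable[OF i(1)] M.bmeas_integrable[OF i(2)] by simp
  also have "\<dots> \<le> 2 ^ m * ((\<integral>y. ?e y \<partial>Q) + 4 ^ m * ((ln D + 1) ^ m + real m ^ m) * (\<integral>y. ?e y \<partial>Q))"
    using tilted_width_moment[OF assms, of x m] by simp
  finally show ?thesis
    using z by (simp add: divide_le_eq algebra_simps)
qed

end

section \<open>Replica expressions\<close>

text \<open>A list of factors stands for the product of the scalars below, read off replicas \<open>Y a\<close>.
  \<open>FX a b\<close> is \<open>\<langle>Y a - Y b, x\<rangle>\<close>, \<open>FV a b i\<close> is \<open>\<langle>Y a - Y b, V i\<rangle>\<close> with \<open>V i\<close> the \<open>i\<close>-th direction of
  differentiation, and \<open>FG\<close> pairs two points or differences.\<close>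

datatype 'i rv = Pt 'i | Dif 'i 'i

datatype 'i factor = is_FX: FX 'i 'i | is_FV: FV 'i 'i (dir: nat) | is_FG: FG "'i rv" "'i rv"

primrec rvec :: "('i \<Rightarrow> vec) \<Rightarrow> 'i rv \<Rightarrow> vec" where
  "rvec Y (Pt a) = Y a"
| "rvec Y (Dif a b) = (\<lambda>i. Y a i - Y b i)"

primrec fval :: "nat \<Rightarrow> vec \<Rightarrow> (nat \<Rightarrow> vec) \<Rightarrow> ('i \<Rightarrow> vec) \<Rightarrow> 'i factor \<Rightarrow> real" where
  "fval d x V Y (FX a b) = dot d (rvec Y (Dif a b)) x"
| "fval d x V Y (FV a b i) = dot d (rvec Y (Dif a b)) (V i)"
| "fval d x V Y (FG p q) = dot d (rvec Y p) (rvec Y q)"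

definition fsval :: "nat \<Rightarrow> vec \<Rightarrow> (nat \<Rightarrow> vec) \<Rightarrow> ('i \<Rightarrow> vec) \<Rightarrow> 'i factor list \<Rightarrow> real" where
  "fsval d x V Y fs = prod_list (map (fval d x V Y) fs)"

lemma fsval_simps [simp]:
  "fsval d x V Y [] = 1"
  "fsval d x V Y (f # fs) = fval d x V Y f * fsval d x V Y fs"
  "fsval d x V Y (fs @ gs) = fsval d x V Y fs * fsval d x V Y gs"
  by (simp_all add: fsval_def)

lemma rvec_map: "rvec Y (map_rv r p) = rvec (\<lambda>a. Y (r a)) p"
  by (cases p) simp_all

lemma fval_map: "fval d x V Y (map_factor r f) = fval d x V (\<lambda>a. Y (r a)) f"
  by (cases f) (simp_all add: rvec_map)

lemma fsval_map: "fsval d x V Y (map (map_factor r) fs) = fsval d x V (\<lambda>a. Y (r a)) fs"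
  by (induction fs) (simp_all add: fval_map)

lemma rvec_cong: "(\<And>a. a \<in> set_rv p \<Longrightarrow> Y a = Y' a) \<Longrightarrow> rvec Y p = rvec Y' p"
  by (cases p) simp_all

lemma fval_cong: "(\<And>a. a \<in> set_factor f \<Longrightarrow> Y a = Y' a) \<Longrightarrow> fval d x V Y f = fval d x V Y' f"
  by (cases f) (simp_all cong: rvec_cong)

definition indices :: "'i factor list \<Rightarrow> 'i set" where
  "indices fs = (\<Union>f\<in>set fs. set_factor f)"

lemma indices_simps [simp]:
  "indices [] = {}" "indices (f # fs) = set_factor f \<union> indices fs"
  "indices (fs @ gs) = indices fs \<union> indices gs"
  "indices (map (map_factor r) fs) = r ` indices fs"
  by (auto simp: indices_def factor.set_map)

lemma fsval_cong: "(\<And>a. a \<in> indices fs \<Longrightarrow> Y a = Y' a) \<Longrightarrow> fsval d x V Y fs = fsval d x V Y' fs"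
  unfolding fsval_def by (intro arg_cong[where f = prod_list] map_cong refl fval_cong) (auto simp: indices_def)

definition dirs :: "'i factor list \<Rightarrow> nat list" where
  "dirs fs = map dir (filter is_FV fs)"

definition nX :: "'i factor list \<Rightarrow> nat" where
  "nX fs = length (filter is_FX fs)"

definition nG :: "'i factor list \<Rightarrow> nat" where
  "nG fs = length (filter is_FG fs)"

lemma dirs_simps [simp]:
  "dirs [] = []" "dirs (FX a b # fs) = dirs fs" "dirs (FV a b i # fs) = i # dirs fs"
  "dirs (FG p q # fs) = dirs fs" "dirs (fs @ gs) = dirs fs @ dirs gs"
  by (simp_all add: dirs_def)

lemma nX_simps [simp]:
  "nX [] = 0" "nX (FX a b # fs) = Suc (nX fs)" "nX (FV a b i # fs) = nX fs"
  "nX (FG p q # fs) = nX fs" "nX (fs @ gs) = nX fs + nX gs"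
  by (simp_all add: nX_def)

lemma nG_simps [simp]:
  "nG [] = 0" "nG (FX a b # fs) = nG fs" "nG (FV a b i # fs) = nG fs"
  "nG (FG p q # fs) = Suc (nG fs)" "nG (fs @ gs) = nG fs + nG gs"
  by (simp_all add: nG_def)

lemma counts_map [simp]:
  "dirs (map (map_factor r) fs) = dirs fs"
  "nX (map (map_factor r) fs) = nX fs"
  "nG (map (map_factor r) fs) = nG fs"
proof -
  show "dirs (map (map_factor r) fs) = dirs fs"
  proof (induction fs)
    case (Cons f fs) then show ?case by (cases f) auto
  qed simp
  show "nX (map (map_factor r) fs) = nX fs"
  proof (induction fs)
    case (Cons f fs) then show ?case by (cases f) auto
  qed simp
  show "nG (map (map_factor r) fs) = nG fs"
  proof (induction fs)
    case (Cons f fs) then show ?case by (cases f) auto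
  qed simp
qed

subsection \<open>Translation of atoms\<close>

text \<open>A fragment \<open>(n, fs)\<close> is a scalar function of the outer variable of an atom, which has index \<open>0\<close>;
  the replicas \<open>1, \<dots>, n\<close> are integrated out. Each \<open>Z = Y 0 - ybar\<close> uses up a replica of its own, because
  \<open>ybar\<close> is the expectation of that replica.\<close>

type_synonym fragment = "nat \<times> nat factor list"

text \<open>The outer variable \<open>0\<close> is shared, whereas the inner replicas must be
  disjoint for the expectation of the product to factor. Hence only the nonzero indices are
  shifted.\<close>

fun frag_mult :: "fragment \<Rightarrow> fragment \<Rightarrow> fragment" where
  "frag_mult (n, fs) (n', fs') = (n + n', fs @ map (map_factor (\<lambda>a. if a = 0 then 0 else a + n)) fs')"

definition frag_prod :: "fragment list \<Rightarrow> fragment" where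
  "frag_prod gs = foldr frag_mult gs (0, [])"

type_synonym expr = "nat \<times> nat factor list \<times> nat rv"

text \<open>Index \<open>1\<close> is the replica behind the mean in \<open>Z\<close>; the replicas
  of the insertion, its index \<open>0\<close> included, start at \<open>2\<close>. The outer
  variable does not occur among them: this expresses that an insertion is held fixed in the outer
  expectation.\<close>

fun frag_ins :: "expr \<Rightarrow> fragment" where
  "frag_ins (n, fs, p) =
     (Suc n, FG (Dif 0 1) (map_rv (\<lambda>a. a + 2) p) # map (map_factor (\<lambda>a. a + 2)) fs)"

text \<open>The two copies of \<open>Z\<close> in its squared norm need different replicas, since
  one shared replica would give the mean of the squared distance instead of the square of the mean.
  The exponent \<open>m\<close> is even, so \<open>m div 2\<close> such pairs suffice.\<close>

definition atom_frag :: "nat \<Rightarrow> nat \<Rightarrow> expr list \<Rightarrow> fragment" where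
  "atom_frag k m Es = frag_prod (replicate k (1, [FX 0 1]) @
     replicate (m div 2) (2, [FG (Dif 0 1) (Dif 0 2)]) @ map frag_ins Es)"

text \<open>In a vector atom the outer variable is integrated too and becomes replica
  \<open>0\<close>. The leading \<open>Z\<close> is \<open>Dif 0 1\<close>, which pushes the
  fragment's replicas up by one; the \<open>2\<close> counts the outer variable and this
  mean.\<close>

primrec tr_ins :: "insertion \<Rightarrow> expr" where
  "tr_ins Ybar = (1, [], Pt 0)"
| "tr_ins (VAtom k m Us) = (case atom_frag k m (map tr_ins Us) of (n, fs) \<Rightarrow>
     (n + 2, map (map_factor (\<lambda>a. if a = 0 then 0 else a + 1)) fs, Dif 0 1))"

primrec tr_scalar :: "scalar_atom \<Rightarrow> nat \<times> nat factor list" where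
  "tr_scalar (SAtom k m Us) = (case atom_frag k m (map tr_ins Us) of (n, fs) \<Rightarrow> (Suc n, fs))"

fun juxtapose :: "nat \<times> nat factor list \<Rightarrow> expr \<Rightarrow> expr" where
  "juxtapose (n, fs) (n', fs', p) =
     (n + n', fs @ map (map_factor (\<lambda>a. a + n)) fs', map_rv (\<lambda>a. a + n) p)"

definition tr_monomial :: "monomial \<Rightarrow> expr" where
  "tr_monomial = (\<lambda>(Ss, V). foldr juxtapose (map tr_scalar Ss) (tr_ins V))"

text \<open>An \<open>FX\<close> is counted with radius \<open>2\<close> although it is linear in
  the replicas, because \<open>exp (- t / 2)\<close> times its absolute value is controlled by
  widths of order \<open>(1 + R)\<^sup>2\<close>. This is the \<open>2 * k\<close> in the radius
  degree of an atom.\<close>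

fun frag_ok :: "nat \<Rightarrow> nat \<Rightarrow> fragment \<Rightarrow> bool" where
  "frag_ok K r (n, fs) \<longleftrightarrow> indices fs \<subseteq> {..n} \<and> dirs fs = [] \<and> nX fs = K \<and> 2 * nX fs + 2 * nG fs = r"

fun scalar_ok :: "nat \<Rightarrow> nat \<Rightarrow> nat \<times> nat factor list \<Rightarrow> bool" where
  "scalar_ok K r (n, fs) \<longleftrightarrow> indices fs \<subseteq> {..<n} \<and> dirs fs = [] \<and> nX fs = K \<and> 2 * nX fs + 2 * nG fs = r"

fun expr_ok :: "nat \<Rightarrow> nat \<Rightarrow> expr \<Rightarrow> bool" where
  "expr_ok K r (n, fs, p) \<longleftrightarrow> indices fs \<subseteq> {..<n} \<and> set_rv p \<subseteq> {..<n} \<and> dirs fs = [] \<and>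
     nX fs = K \<and> 2 * nX fs + 2 * nG fs + 1 = r"

lemma frag_ok_mult: "frag_ok K r g \<Longrightarrow> frag_ok K' r' g' \<Longrightarrow> frag_ok (K + K') (r + r') (frag_mult g g')"
  by (cases g; cases g') auto

lemma frag_ok_prod:
  assumes "list_all2 (\<lambda>(K, r) g. frag_ok K r g) Krs gs"
  shows "frag_ok (sum_list (map fst Krs)) (sum_list (map snd Krs)) (frag_prod gs)"
  using assms
proof (induction rule: list_all2_induct)
  case Nil
  then show ?case by (simp add: frag_prod_def)
next
  case (Cons Kr Krs g gs)
  then show ?case
    using frag_ok_mult[of "fst Kr" "snd Kr" g _ _ "frag_prod gs"] by (auto simp: frag_prod_def)
qed

lemma frag_ok_ins: "expr_ok K r e \<Longrightarrow> frag_ok K (1 + r) (frag_ins e)"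
  by (cases e) (auto simp: rv.set_map)

lemma frag_ok_atom:
  assumes "even m" and "\<And>U. U \<in> set Us \<Longrightarrow> expr_ok (K_ins U) (rho_ins U) (tr_ins U)"
  shows "frag_ok (k + sum_list (map K_ins Us)) (2 * k + m + length Us + sum_list (map rho_ins Us))
    (atom_frag k m (map tr_ins Us))"
proof -
  \<comment> \<open>Pairs of insertion count and radius, one per fragment; the \<open>1 +\<close> in
    the last group is the \<open>Z\<close> that an insertion is paired with.\<close>
  let ?Krs = "replicate k (1, 2) @ replicate (m div 2) (0, 2) @ map (\<lambda>U. (K_ins U, 1 + rho_ins U)) Us"
  have "list_all2 (\<lambda>(K, r) g. frag_ok K r g) ?Krs (replicate k (1, [FX 0 1]) @
     replicate (m div 2) (2, [FG (Dif 0 1) (Dif 0 2)]) @ map frag_ins (map tr_ins Us))"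
  proof (intro list_all2_appendI)
    have "frag_ok (K_ins U) (1 + rho_ins U) (frag_ins (tr_ins U))" if "U \<in> set Us" for U
      by (rule frag_ok_ins[OF assms(2)[OF that]])
    then show "list_all2 (\<lambda>(K, r) g. frag_ok K r g) (map (\<lambda>U. (K_ins U, 1 + rho_ins U)) Us)
        (map frag_ins (map tr_ins Us))"
      by (auto simp: list_all2_conv_all_nth)
  qed (auto simp: list_all2_conv_all_nth)
  moreover have "(\<Sum>U\<leftarrow>Us. 1 + rho_ins U) = length Us + sum_list (map rho_ins Us)"
    by (induction Us) auto
  ultimately show ?thesis
    using \<open>even m\<close> frag_ok_prod[of ?Krs]
    by (simp add: atom_frag_def sum_list_replicate o_def algebra_simps)
qed

lemma expr_ok_ins: "admissible U \<Longrightarrow> expr_ok (K_ins U) (rho_ins U) (tr_ins U)"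
proof (induction U)
  case (VAtom k m Us)
  then have "frag_ok (k + sum_list (map K_ins Us)) (2 * k + m + length Us + sum_list (map rho_ins Us))
      (atom_frag k m (map tr_ins Us))"
    by (intro frag_ok_atom) auto
  then show ?case
    by (cases "atom_frag k m (map tr_ins Us)") auto
qed auto

lemma scalar_ok_atom: "admissible_scalar A \<Longrightarrow> scalar_ok (K_scalar A) (rho_scalar A) (tr_scalar A)"
proof (cases A)
  case (SAtom k m Us)
  assume "admissible_scalar A"
  with SAtom have "frag_ok (k + sum_list (map K_ins Us)) (2 * k + m + length Us + sum_list (map rho_ins Us))
      (atom_frag k m (map tr_ins Us))"
    by (intro frag_ok_atom expr_ok_ins) auto
  then show ?thesis
    using SAtom by (cases "atom_frag k m (map tr_ins Us)") auto
qed

lemma expr_ok_juxtapose: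
  "scalar_ok K r s \<Longrightarrow> expr_ok K' r' e \<Longrightarrow> expr_ok (K + K') (r + r') (juxtapose s e)"
  by (cases s; cases e) (auto simp: rv.set_map)

lemma expr_ok_monomial:
  "admissible_monomial M \<Longrightarrow> expr_ok (K_monomial M) (rho_monomial M) (tr_monomial M)"
proof (cases M)
  case (Pair Ss V)
  assume adm: "admissible_monomial M"
  then have "admissible V" "\<And>A. A \<in> set Ss \<Longrightarrow> admissible_scalar A"
    by (auto simp: admissible_monomial_def Pair)
  then have "expr_ok (sum_list (map K_scalar Ss) + K_ins V) (sum_list (map rho_scalar Ss) + rho_ins V)
      (foldr juxtapose (map tr_scalar Ss) (tr_ins V))"
  proof (induction Ss)
    case (Cons A Ss)
    then show ?case
      using expr_ok_juxtapose[OF scalar_ok_atom[of A] Cons.IH] by (simp add: add.assoc)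
  qed (simp add: expr_ok_ins)
  then show ?thesis
    by (simp add: Pair tr_monomial_def K_monomial_def rho_monomial_def)
qed

subsection \<open>Semantics of the translation\<close>

lemma dot_cong: "(\<And>i. i < d \<Longrightarrow> x i = x' i) \<Longrightarrow> (\<And>i. i < d \<Longrightarrow> y i = y' i) \<Longrightarrow> dot d x y = dot d x' y'"
  by (simp add: dot_def)

context cloud
begin

lemma bmeas_rvec: "j < d \<Longrightarrow> (\<lambda>Y. rvec Y p j) \<in> bmeas S"
  by (cases p) (auto intro!: bmeas_diff bmeas_coord[OF bmeas_coord_Q])

lemma bmeas_dot:
  "(\<And>j. j < d \<Longrightarrow> (\<lambda>Y. F Y j) \<in> bmeas M') \<Longrightarrow> (\<And>j. j < d \<Longrightarrow> (\<lambda>Y. G Y j) \<in> bmeas M') \<Longrightarrow>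
   (\<lambda>Y. dot d (F Y) (G Y)) \<in> bmeas M'"
  unfolding dot_def by (auto intro!: bmeas_sum bmeas_mult)

lemma bmeas_fval: "(\<lambda>Y. fval d x V Y f) \<in> bmeas S"
proof (cases f)
  case (FX a b)
  show ?thesis
    unfolding FX fval.simps by (rule bmeas_dot) (erule bmeas_rvec, rule bmeas_const)
next
  case (FV a b i)
  show ?thesis
    unfolding FV fval.simps by (rule bmeas_dot) (erule bmeas_rvec, rule bmeas_const)
next
  case (FG p q)
  show ?thesis
    unfolding FG fval.simps by (rule bmeas_dot) (rule bmeas_rvec, assumption)+
qed

lemma bmeas_fsval: "(\<lambda>Y. fsval d x V Y fs) \<in> bmeas S"
proof (induction fs)
  case (Cons f fs)
  show ?case
    unfolding fsval_simps by (rule bmeas_mult[OF bmeas_fval Cons.IH])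
qed (simp only: fsval_simps bmeas_const)

lemma bmeas_case_nat: "y \<in> supp d P \<Longrightarrow> F \<in> bmeas S \<Longrightarrow> (\<lambda>Y. F (case_nat y Y)) \<in> bmeas S"
  by (rule bmeas_compose[OF _ measurable_case_nat_right]) auto

abbreviation (input) post :: "real \<Rightarrow> vec \<Rightarrow> nat \<Rightarrow> ((nat \<Rightarrow> vec) \<Rightarrow> real) \<Rightarrow> real" where
  "post t x n F \<equiv> texp n (lw d t x) F"

text \<open>Two expectations merge into one when the second receives replicas of its own, numbered
  from \<open>n\<close> on; \<open>dep\<close> ensures that the first reads none of these.\<close>

lemma dot_post:
  assumes "\<And>j. j < d \<Longrightarrow> (\<lambda>Y. F Y j) \<in> bmeas S" "\<And>j. j < d \<Longrightarrow> (\<lambda>Y. G Y j) \<in> bmeas S"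
    and dep: "\<And>Y Y'. (\<And>a. a < n \<Longrightarrow> Y a = Y' a) \<Longrightarrow> F Y = F Y'"
  shows "dot d (\<lambda>j. post t x n (\<lambda>Y. F Y j)) (\<lambda>j. post t x m (\<lambda>Y. G Y j)) =
    post t x (n + m) (\<lambda>Y. dot d (F Y) (G (\<lambda>a. Y (a + n))))"
proof -
  have "dot d (\<lambda>j. post t x n (\<lambda>Y. F Y j)) (\<lambda>j. post t x m (\<lambda>Y. G Y j)) =
      (\<Sum>j<d. post t x (n + m) (\<lambda>Y. F Y j * G (\<lambda>a. Y (a + n)) j))"
    unfolding dot_def
  proof (rule sum.cong[OF refl])
    fix j assume "j \<in> {..<d}"
    then have j: "j < d"
      by simp
    have dep_j: "F Y j = F Y' j" if "\<And>a. a < n \<Longrightarrow> Y a = Y' a" for Y Y'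
      using dep[OF that] by simp
    show "post t x n (\<lambda>Y. F Y j) * post t x m (\<lambda>Y. G Y j) =
        post t x (n + m) (\<lambda>Y. F Y j * G (\<lambda>a. Y (a + n)) j)"
      by (rule texp_split[OF assms(1)[OF j] assms(2)[OF j] bmeas_lw dep_j, symmetric])
  qed
  also have "\<dots> = post t x (n + m) (\<lambda>Y. dot d (F Y) (G (\<lambda>a. Y (a + n))))"
    unfolding dot_def
  proof (rule texp_sum[symmetric, OF _ bmeas_lw])
    fix j assume "j \<in> {..<d}"
    then have j: "j < d"
      by simp
    show "(\<lambda>Y. F Y j * G (\<lambda>a. Y (a + n)) j) \<in> bmeas S"
      by (rule bmeas_mult[OF assms(1)[OF j] bmeas_reindex[OF assms(2)[OF j]]])
  qed
  finally show ?thesis .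
qed

text \<open>The outer point joins the inner replicas as a new coordinate \<open>0\<close>. Agreement
  is required on the support only, because \<open>case_nat y Y\<close> lies in the product space
  just for such \<open>y\<close>.\<close>

lemma posterior_post:
  assumes "t > 0" "f \<in> borel_measurable P" "H \<in> bmeas S"
    and "\<And>y. y \<in> supp d P \<Longrightarrow> f y = post t x n (\<lambda>Y. H (case_nat y Y))"
  shows "(LINT y|posterior d P t x. f y) = post t x (Suc n) H"
  unfolding posterior_integral[OF assms(1,2)] texp_head[OF assms(3) bmeas_lw]
  by (intro arg_cong2[where f = "(/)"] refl Bochner_Integration.integral_cong) (simp add: assms(4))

lemma ybar_post:
  assumes "t > 0" "j < d"
  shows "ybar d P t x j = post t x 1 (\<lambda>Y. Y 0 j)"
  unfolding ybar_def
  using posterior_post[OF assms(1) measurable_coord_P[OF assms(2)] bmeas_coord[OF bmeas_coord_Q[OF assms(2)], of 0], where n = 0]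
  by (simp add: texp_const[OF bmeas_lw])

lemma Zvar_post:
  assumes "t > 0" "j < d"
  shows "Zvar d P t x y j = post t x 1 (\<lambda>Y. y j - Y 0 j)"
  unfolding Zvar_def ybar_post[OF assms]
  by (subst texp_diff[OF bmeas_const bmeas_coord[OF bmeas_coord_Q[OF assms(2)]] bmeas_lw])
    (simp add: texp_const[OF bmeas_lw])

lemma dot_Zvar_post:
  assumes "t > 0" and G: "\<And>j. j < d \<Longrightarrow> (\<lambda>Y. G Y j) \<in> bmeas S"
  shows "dot d (Zvar d P t x y) (\<lambda>j. post t x m (\<lambda>Y. G Y j)) =
    post t x (Suc m) (\<lambda>Y. dot d (\<lambda>j. y j - Y 0 j) (G (\<lambda>a. Y (Suc a))))"
proof -
  have "dot d (Zvar d P t x y) (\<lambda>j. post t x m (\<lambda>Y. G Y j)) =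
      dot d (\<lambda>j. post t x 1 (\<lambda>Y. y j - Y 0 j)) (\<lambda>j. post t x m (\<lambda>Y. G Y j))"
    by (intro dot_cong) (auto simp: Zvar_post[OF \<open>t > 0\<close>])
  also have "\<dots> = post t x (1 + m) (\<lambda>Y. dot d (\<lambda>j. y j - Y 0 j) (G (\<lambda>a. Y (a + 1))))"
  proof (rule dot_post)
    show "(\<lambda>Y. y j - Y 0 j) \<in> bmeas S" if "j < d" for j
      by (rule bmeas_diff[OF bmeas_const bmeas_coord[OF bmeas_coord_Q[OF that]]])
  qed (use G in auto)
  finally show ?thesis
    by simp
qed

fun frag_val :: "real \<Rightarrow> vec \<Rightarrow> (nat \<Rightarrow> vec) \<Rightarrow> vec \<Rightarrow> fragment \<Rightarrow> real" where
  "frag_val t x V y (n, fs) = post t x n (\<lambda>Y. fsval d x V (case_nat y Y) fs)"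

text \<open>For a fixed outer point the two fragments read disjoint blocks of independent
  replicas.\<close>

lemma frag_val_mult:
  assumes "frag_ok K r g" "y \<in> supp d P"
  shows "frag_val t x V y (frag_mult g g') = frag_val t x V y g * frag_val t x V y g'"
proof -
  obtain n fs n' fs' where g: "g = (n, fs)" "g' = (n', fs')"
    by (cases g; cases g')
  have c: "(\<lambda>a. case_nat y Y (if a = 0 then 0 else a + n)) = case_nat y (\<lambda>a. Y (a + n))" for Y
    by (rule ext) (simp split: nat.split)
  have "fsval d x V (case_nat y Y) fs = fsval d x V (case_nat y Y') fs"
    if "\<And>a. a < n \<Longrightarrow> Y a = Y' a" for Y Y'
  proof (rule fsval_cong)
    fix a assume "a \<in> indices fs"
    then have "a \<le> n"
      using assms(1) by (auto simp: g)
    then show "case_nat y Y a = case_nat y Y' a"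
      using that by (cases a) auto
  qed
  note split = texp_split[OF bmeas_case_nat[OF assms(2) bmeas_fsval] bmeas_case_nat[OF assms(2) bmeas_fsval] bmeas_lw this]
  show ?thesis
    unfolding g frag_mult.simps frag_val.simps fsval_simps fsval_map c by (rule split)
qed

lemma frag_val_prod:
  assumes "y \<in> supp d P" "\<And>g. g \<in> set gs \<Longrightarrow> \<exists>K r. frag_ok K r g"
  shows "frag_val t x V y (frag_prod gs) = prod_list (map (frag_val t x V y) gs)"
  using assms(2)
proof (induction gs)
  case Nil
  then show ?case by (simp add: frag_prod_def texp_const[OF bmeas_lw])
next
  case (Cons g gs)
  then obtain K r where "frag_ok K r g"
    by (metis list.set_intros(1))
  from frag_val_mult[OF this assms(1)] Cons show ?case
    by (simp add: frag_prod_def)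
qed


fun expr_val :: "real \<Rightarrow> vec \<Rightarrow> (nat \<Rightarrow> vec) \<Rightarrow> nat \<Rightarrow> expr \<Rightarrow> real" where
  "expr_val t x V j (n, fs, p) = post t x n (\<lambda>Y. fsval d x V Y fs * rvec Y p j)"

fun closed_val :: "real \<Rightarrow> vec \<Rightarrow> (nat \<Rightarrow> vec) \<Rightarrow> nat \<times> nat factor list \<Rightarrow> real" where
  "closed_val t x V (n, fs) = post t x n (\<lambda>Y. fsval d x V Y fs)"

lemma bmeas_fsval_rvec: "j < d \<Longrightarrow> (\<lambda>Y. fsval d x V Y fs * rvec Y p j) \<in> bmeas S"
  by (rule bmeas_mult[OF bmeas_fsval bmeas_rvec])

lemma frag_val_ins:
  assumes "t > 0" and u: "\<And>j. j < d \<Longrightarrow> u j = expr_val t x V j e"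
  shows "dot d (Zvar d P t x y) u = frag_val t x V y (frag_ins e)"
proof -
  obtain n fs p where e: "e = (n, fs, p)"
    by (cases e)
  have "dot d (Zvar d P t x y) u =
      dot d (Zvar d P t x y) (\<lambda>j. post t x n (\<lambda>Y. fsval d x V Y fs * rvec Y p j))"
    by (rule dot_cong) (simp_all add: u e)
  also have "\<dots> = post t x (Suc n) (\<lambda>Y. dot d (\<lambda>j. y j - Y 0 j)
      (\<lambda>j. fsval d x V (\<lambda>a. Y (Suc a)) fs * rvec (\<lambda>a. Y (Suc a)) p j))"
    by (rule dot_Zvar_post[OF \<open>t > 0\<close> bmeas_fsval_rvec])
  also have "\<dots> = frag_val t x V y (frag_ins e)"
    by (simp add: e dot_cmult_right fsval_map rvec_map) (simp add: mult.commute)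
  finally show ?thesis .
qed

lemma frag_val_X:
  assumes "t > 0"
  shows "dot d (Zvar d P t x y) x = frag_val t x V y (1, [FX 0 1])"
proof -
  \<comment> \<open>The fixed vector \<open>x\<close> is treated as an expectation over no replicas
    at all.\<close>
  have "dot d (Zvar d P t x y) (\<lambda>j. post t x 0 (\<lambda>Y. x j)) =
      post t x (Suc 0) (\<lambda>Y. dot d (\<lambda>j. y j - Y 0 j) x)"
    by (rule dot_Zvar_post[OF \<open>t > 0\<close> bmeas_const])
  then show ?thesis
    by (simp add: texp_const[OF bmeas_lw])
qed

lemma frag_val_sq:
  assumes "t > 0"
  shows "(vnorm d (Zvar d P t x y))\<^sup>2 = frag_val t x V y (2, [FG (Dif 0 1) (Dif 0 2)])"
proof -
  have "(vnorm d (Zvar d P t x y))\<^sup>2 = dot d (Zvar d P t x y) (\<lambda>j. post t x 1 (\<lambda>Y. y j - Y 0 j))"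
    unfolding dot_self[symmetric] by (rule dot_cong) (simp_all add: Zvar_post[OF assms])
  also have "\<dots> = post t x (Suc 1) (\<lambda>Y. dot d (\<lambda>j. y j - Y 0 j) (\<lambda>j. y j - Y (Suc 0) j))"
    by (rule dot_Zvar_post[OF assms bmeas_diff[OF bmeas_const bmeas_coord[OF bmeas_coord_Q]]])
  finally show ?thesis
    by (simp add: numeral_2_eq_2)
qed

lemma frag_val_atom:
  assumes "t > 0" "even m" "y \<in> supp d P" "\<And>U. U \<in> set Us \<Longrightarrow> admissible U"
    and u: "\<And>U j. U \<in> set Us \<Longrightarrow> j < d \<Longrightarrow> insertion_val d P t x U j = expr_val t x V j (tr_ins U)"
  shows "dot d (Zvar d P t x y) x ^ k * vnorm d (Zvar d P t x y) ^ m *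
      prod_list (map (dot d (Zvar d P t x y)) (map (insertion_val d P t x) Us)) =
    frag_val t x V y (atom_frag k m (map tr_ins Us))"
proof -
  let ?z = "Zvar d P t x y"
  have X: "dot d ?z x ^ k = prod_list (map (frag_val t x V y) (replicate k (1, [FX 0 1])))"
    unfolding frag_val_X[OF \<open>t > 0\<close>, of x y V] by (simp only: map_replicate prod_list_replicate)
  have "vnorm d ?z ^ m = ((vnorm d ?z)\<^sup>2) ^ (m div 2)"
    using \<open>even m\<close> by (simp flip: power_mult)
  then have N: "vnorm d ?z ^ m =
      prod_list (map (frag_val t x V y) (replicate (m div 2) (2, [FG (Dif 0 1) (Dif 0 2)])))"
    unfolding frag_val_sq[OF \<open>t > 0\<close>, of x y V] by (simp only: map_replicate prod_list_replicate)
  have I: "map (dot d ?z) (map (insertion_val d P t x) Us) = map (frag_val t x V y) (map frag_ins (map tr_ins Us))"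
    using frag_val_ins[OF \<open>t > 0\<close> u] by simp
  have "\<exists>K r. frag_ok K r g" if g: "g \<in> set (replicate k (1, [FX 0 1]) @
      replicate (m div 2) (2, [FG (Dif 0 1) (Dif 0 2)]) @ map frag_ins (map tr_ins Us))" for g
  proof -
    consider "g = (1, [FX 0 1])" | "g = (2, [FG (Dif 0 1) (Dif 0 2)])" | U where "U \<in> set Us" "g = frag_ins (tr_ins U)"
      using g by (auto split: if_splits)
    then show ?thesis
    proof cases
      case 3
      then show ?thesis
        using frag_ok_ins[OF expr_ok_ins[OF assms(4)]] by blast
    qed auto
  qed
  from frag_val_prod[OF \<open>y \<in> supp d P\<close> this, of _ t x V] show ?thesis
    unfolding X N I atom_frag_def by (simp only: map_append prod_list.append mult.assoc)
qed

lemma measurable_Zvar_P: "j < d \<Longrightarrow> (\<lambda>y. Zvar d P t x y j) \<in> borel_measurable P"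
  unfolding Zvar_def by (intro borel_measurable_diff measurable_coord_P borel_measurable_const)

lemma measurable_dot_Zvar_P: "(\<lambda>y. dot d (Zvar d P t x y) u) \<in> borel_measurable P"
  unfolding dot_def
  by (intro borel_measurable_sum borel_measurable_times measurable_Zvar_P borel_measurable_const) auto

lemma measurable_vnorm_Zvar_P: "(\<lambda>y. vnorm d (Zvar d P t x y)) \<in> borel_measurable P"
proof -
  have [measurable]: "(\<lambda>y. \<Sum>i<d. (Zvar d P t x y i)\<^sup>2) \<in> borel_measurable P"
    by (intro borel_measurable_sum borel_measurable_power measurable_Zvar_P) auto
  have "(\<lambda>y. sqrt (\<Sum>i<d. (Zvar d P t x y i)\<^sup>2)) \<in> borel_measurable P"
    by measurable
  then show ?thesis
    by (simp add: vnorm_def L2_set_def)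
qed

lemma measurable_atom_P:
  "(\<lambda>y. dot d (Zvar d P t x y) x ^ k * vnorm d (Zvar d P t x y) ^ m *
      prod_list (map (dot d (Zvar d P t x y)) us)) \<in> borel_measurable P"
proof -
  have "(\<lambda>y. prod_list (map (dot d (Zvar d P t x y)) us)) \<in> borel_measurable P"
  proof (induction us)
    case (Cons u us)
    then show ?case
      unfolding list.map prod_list.Cons by (intro borel_measurable_times measurable_dot_Zvar_P)
  qed simp
  then show ?thesis
    by (intro borel_measurable_times borel_measurable_power measurable_dot_Zvar_P measurable_vnorm_Zvar_P)
qed

text \<open>By induction on nesting, inner insertions are already single expectations and
  \<open>frag_val_atom\<close> merges them; the leading \<open>Z\<close> brings one more replica,
  placed in front of theirs. \<open>V\<close> is arbitrary because no \<open>FV\<close> occurs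
  before a differentiation.\<close>

lemma insertion_val_eq:
  "admissible U \<Longrightarrow> t > 0 \<Longrightarrow> j < d \<Longrightarrow> insertion_val d P t x U j = expr_val t x V j (tr_ins U)"
proof (induction U arbitrary: j)
  case Ybar
  then show ?case
    by (simp add: ybar_post)
next
  case (VAtom k m Us)
  obtain n fs where nfs: "atom_frag k m (map tr_ins Us) = (n, fs)"
    by (cases "atom_frag k m (map tr_ins Us)")
  let ?g = "\<lambda>y. dot d (Zvar d P t x y) x ^ k * vnorm d (Zvar d P t x y) ^ m *
      prod_list (map (dot d (Zvar d P t x y)) (map (insertion_val d P t x) Us))"
  let ?r = "\<lambda>a. if a = 0 then 0 else a + 1 :: nat"
  let ?H = "\<lambda>Y. fsval d x V Y (map (map_factor ?r) fs) * rvec Y (Dif 0 1) j"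
  have "(LINT y|posterior d P t x. Zvar d P t x y j * ?g y) = post t x (Suc (1 + n)) ?H"
  proof (rule posterior_post[OF \<open>t > 0\<close> _ bmeas_fsval_rvec[OF \<open>j < d\<close>]])
    show "(\<lambda>y. Zvar d P t x y j * ?g y) \<in> borel_measurable P"
      by (rule borel_measurable_times[OF measurable_Zvar_P[OF \<open>j < d\<close>] measurable_atom_P])
    fix y assume y: "y \<in> supp d P"
    have "?g y = post t x n (\<lambda>Y. fsval d x V (case_nat y Y) fs)"
      using VAtom nfs frag_val_atom[OF \<open>t > 0\<close> _ y, where m = m and Us = Us and x = x and V = V and k = k] by simp
    moreover have "post t x (1 + n) (\<lambda>Y. (y j - Y 0 j) * fsval d x V (case_nat y (\<lambda>a. Y (a + 1))) fs) =
        post t x 1 (\<lambda>Y. y j - Y 0 j) * post t x n (\<lambda>Y. fsval d x V (case_nat y Y) fs)"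
      by (rule texp_split[OF bmeas_diff[OF bmeas_const bmeas_coord[OF bmeas_coord_Q[OF \<open>j < d\<close>]]]
          bmeas_case_nat[OF y bmeas_fsval] bmeas_lw]) simp
    moreover have "?H (case_nat y Y) = (y j - Y 0 j) * fsval d x V (case_nat y (\<lambda>a. Y (a + 1))) fs" for Y
    proof -
      have "(\<lambda>a. case_nat y Y (?r a)) = case_nat y (\<lambda>a. Y (a + 1))"
        by (rule ext) (simp split: nat.split)
      then show ?thesis
        by (simp only: fsval_map rvec.simps) simp
    qed
    ultimately show "Zvar d P t x y j * ?g y = post t x (1 + n) (\<lambda>Y. ?H (case_nat y Y))"
      by (simp only: Zvar_post[OF \<open>t > 0\<close> \<open>j < d\<close>])
  qed
  then show ?case
    by (simp add: nfs mult.assoc)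
qed

lemma scalar_val_eq:
  assumes "admissible_scalar A" "t > 0"
  shows "scalar_val d P t x A = closed_val t x V (tr_scalar A)"
proof (cases A)
  case (SAtom k m Us)
  obtain n fs where nfs: "atom_frag k m (map tr_ins Us) = (n, fs)"
    by (cases "atom_frag k m (map tr_ins Us)")
  have "scalar_val d P t x A = post t x (Suc n) (\<lambda>Y. fsval d x V Y fs)"
    unfolding SAtom scalar_val.simps
  proof (rule posterior_post[OF \<open>t > 0\<close> measurable_atom_P bmeas_fsval])
    fix y assume y: "y \<in> supp d P"
    have adm: "even m" "\<And>U. U \<in> set Us \<Longrightarrow> admissible U"
      using assms(1) by (auto simp: SAtom)
    show "dot d (Zvar d P t x y) x ^ k * vnorm d (Zvar d P t x y) ^ m *
        prod_list (map (dot d (Zvar d P t x y)) (map (insertion_val d P t x) Us)) =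
        post t x n (\<lambda>Y. fsval d x V (case_nat y Y) fs)"
      using frag_val_atom[OF \<open>t > 0\<close> adm(1) y adm(2) insertion_val_eq[OF adm(2) \<open>t > 0\<close>], where x = x and V = V and k = k] nfs by simp
  qed
  then show ?thesis
    by (simp add: SAtom nfs)
qed

lemma expr_val_juxtapose:
  assumes "scalar_ok K r s" "j < d"
  shows "expr_val t x V j (juxtapose s e) = closed_val t x V s * expr_val t x V j e"
proof -
  obtain n fs n' fs' p where g: "s = (n, fs)" "e = (n', fs', p)"
    by (cases s; cases e)
  have "fsval d x V Y fs = fsval d x V Y' fs" if "\<And>a. a < n \<Longrightarrow> Y a = Y' a" for Y Y'
    using assms(1) that by (intro fsval_cong) (auto simp: g)
  note split = texp_split[OF bmeas_fsval bmeas_fsval_rvec[OF assms(2)] bmeas_lw this]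
  show ?thesis
    unfolding g juxtapose.simps expr_val.simps closed_val.simps fsval_simps fsval_map rvec_map mult.assoc
    by (rule split)
qed

lemma monomial_val_eq:
  assumes "admissible_monomial M" "t > 0" "j < d"
  shows "monomial_val d P t x M j = expr_val t x V j (tr_monomial M)"
proof (cases M)
  case (Pair Ss V')
  have "admissible V'" "\<And>A. A \<in> set Ss \<Longrightarrow> admissible_scalar A"
    using assms(1) by (auto simp: admissible_monomial_def Pair)
  then have "prod_list (map (scalar_val d P t x) Ss) * insertion_val d P t x V' j =
      expr_val t x V j (foldr juxtapose (map tr_scalar Ss) (tr_ins V'))"
  proof (induction Ss)
    case (Cons A Ss)
    then show ?case
      using expr_val_juxtapose[OF scalar_ok_atom[of A] \<open>j < d\<close>, of t x V] scalar_val_eq[of A t x V] assms(2)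
      by (simp add: mult.assoc)
  qed (simp add: insertion_val_eq assms)
  then show ?thesis
    by (simp add: Pair monomial_val_def tr_monomial_def)
qed

end

section \<open>Differentiation of replica expressions\<close>

text \<open>\<open>Tm r p i e n fs w\<close> stands for \<open>r c\<^sup>(\<^sup>p\<^sup>)(t) exp (- t / 2)\<^sup>i b(t)\<^sup>e\<close> times the expectation, over \<open>n\<close>
  posterior replicas, of the factors \<open>fs\<close> times the vector \<open>w\<close>. Since \<open>b' = b - b\<^sup>2\<close>, such terms are closed
  under differentiation.\<close>

datatype tm = Tm real nat nat nat nat "nat factor list" "nat rv"

text \<open>The product rule: \<open>x\<close> enters through the \<open>FX\<close> factors only,
  linearly in each, and a derivative puts the new direction in its place.\<close>

primrec hits :: "nat \<Rightarrow> nat factor list \<Rightarrow> nat factor list list" where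
  "hits m [] = []"
| "hits m (f # fs) = (case f of FX a b \<Rightarrow> [FV a b m # fs] | _ \<Rightarrow> []) @ map ((#) f) (hits m fs)"

text \<open>The second list differentiates the tilt, whose exponent has the derivative
  \<open>exp (- t / 2) * b * <Y a, V m>\<close>. Position \<open>0\<close> is taken by the fresh
  replica of the normalisation, so all old indices move up by one.\<close>

primrec dx_tm :: "nat \<Rightarrow> tm \<Rightarrow> tm list" where
  "dx_tm m (Tm r p i e n fs w) = map (\<lambda>gs. Tm r p i e n gs w) (hits m fs) @
     map (\<lambda>a. Tm r p (Suc i) (Suc e) (Suc n) (FV (Suc a) 0 m # map (map_factor Suc) fs) (map_rv Suc w)) [0..<n]"

text \<open>The first four terms come from the prefactor, the others from the exponent as in
  \<open>lw_has_derivative_t\<close>. Each of them raises \<open>e + p\<close> and the radius by at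
  most two, which is the origin of \<open>2 * q\<close> in both exponents of the estimate.\<close>

primrec dt_tm :: "tm \<Rightarrow> tm list" where
  "dt_tm (Tm r p i e n fs w) =
     (let up = (\<lambda>r i e f. Tm r p i e (Suc n) (f # map (map_factor Suc) fs) (map_rv Suc w)) in
      [Tm r (Suc p) i e n fs w, Tm (- r * real i / 2) p i e n fs w,
       Tm (r * real e) p i e n fs w, Tm (- r * real e) p i (Suc e) n fs w] @
      map (\<lambda>a. up (r / 2) (Suc i) (Suc e) (FX (Suc a) 0)) [0..<n] @
      map (\<lambda>a. up (- r) (Suc i) (Suc (Suc e)) (FX (Suc a) 0)) [0..<n] @
      map (\<lambda>a. up (r / 2) i (Suc (Suc e)) (FG (Pt (Suc a)) (Pt (Suc a)))) [0..<n] @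
      map (\<lambda>a. up (- r / 2) i (Suc e) (FG (Pt (Suc a)) (Pt (Suc a)))) [0..<n] @
      map (\<lambda>a. up (- r / 2) i (Suc (Suc e)) (FG (Pt 0) (Pt 0))) [0..<n] @
      map (\<lambda>a. up (r / 2) i (Suc e) (FG (Pt 0) (Pt 0))) [0..<n])"

lemma hits_counts:
  assumes "gs \<in> set (hits m fs)"
  shows "mset (dirs gs) = add_mset m (mset (dirs fs))" "Suc (nX gs) = nX fs" "nG gs = nG fs"
    "indices gs = indices fs"
proof -
  have "mset (dirs gs) = add_mset m (mset (dirs fs)) \<and> Suc (nX gs) = nX fs \<and> nG gs = nG fs \<and>
      indices gs = indices fs"
    using assms
  proof (induction fs arbitrary: gs)
    case (Cons f fs)
    then show ?case
      by (cases f) auto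
  qed simp
  then show "mset (dirs gs) = add_mset m (mset (dirs fs))" "Suc (nX gs) = nX fs" "nG gs = nG fs"
    "indices gs = indices fs"
    by auto
qed

lemma fsval_cong_dirs: "(\<And>i. i \<in> set (dirs fs) \<Longrightarrow> V i = V' i) \<Longrightarrow> fsval d x V Y fs = fsval d x V' Y fs"
proof (induction fs)
  case (Cons f fs)
  then show ?case
    by (cases f) auto
qed simp

section \<open>Linearity in a direction and spatial derivatives of products\<close>

definition unit_vec :: "nat \<Rightarrow> vec" where
  "unit_vec i = (\<lambda>k. if k = i then 1 else 0)"

lemma dot_unit_vec: "i < d \<Longrightarrow> dot d w (unit_vec i) = w i"
  by (simp add: dot_def unit_vec_def if_distrib cong: if_cong)

lemma sum_dot_unit_vec: "(\<Sum>i<d. v i * dot d w (unit_vec i)) = dot d w v"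
  by (simp add: dot_unit_vec) (simp add: dot_def mult.commute)

text \<open>Partial derivatives insert unit vectors, and this sum reassembles them into
  \<open>v\<close>. Linearity holds because the direction occurs in exactly one factor; two
  occurrences would make the product quadratic in it.\<close>

lemma fsval_linear:
  assumes "count (mset (dirs gs)) m = 1"
  shows "(\<Sum>i<d. v i * fsval d x (V(m := unit_vec i)) Y gs) = fsval d x (V(m := v)) Y gs"
  using assms
proof (induction gs)
  case (Cons f gs)
  show ?case
  proof (cases "\<exists>a b. f = FV a b m")
    case True
    then obtain a b where f: "f = FV a b m"
      by blast
    then have "m \<notin> set (dirs gs)"
      using Cons.prems by (simp add: count_list_0_iff)
    then have inv: "fsval d x (V(m := u)) Y gs = fsval d x V Y gs" for u
      by (intro fsval_cong_dirs) auto
    show ?thesis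
      unfolding f fsval_simps fval.simps fun_upd_same inv mult.assoc[symmetric]
        sum_distrib_right[symmetric] sum_dot_unit_vec ..
  next
    case False
    then have inv: "fval d x (V(m := u)) Y f = fval d x V Y f" for u
      by (cases f) auto
    have "count (mset (dirs gs)) m = 1"
      using Cons.prems False by (cases f) auto
    from Cons.IH[OF this] show ?thesis
      unfolding fsval_simps inv mult.left_commute[of "v _"] sum_distrib_left[symmetric] by (rule arg_cong)
  qed
qed simp

text \<open>Freshness of \<open>m\<close> means that overwriting \<open>V m\<close> leaves all old
  factors unchanged, so one assignment serves both the old and the differentiated factors.\<close>

lemma fsval_has_derivative:
  assumes "i < d" and "m \<notin> set (dirs fs)"
  shows "((\<lambda>s. fsval d (x(i := s)) V Y fs) has_real_derivative
    (\<Sum>gs\<leftarrow>hits m fs. fsval d (x(i := s)) (V(m := unit_vec i)) Y gs)) (at s)"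
  using assms(2)
proof (induction fs)
  case (Cons f fs)
  let ?V = "V(m := unit_vec i)"
  have V: "fval d x' ?V Y f = fval d x' V Y f" for x'
    using Cons.prems by (cases f) auto
  have Vs: "fsval d x' ?V Y fs = fsval d x' V Y fs" for x'
    using Cons.prems by (intro fsval_cong_dirs) (cases f; auto)
  define f' where "f' = (case f of FX a b \<Rightarrow> rvec Y (Dif a b) i | _ \<Rightarrow> 0)"
  have df: "((\<lambda>s. fval d (x(i := s)) V Y f) has_real_derivative f') (at s)"
  proof (cases f)
    case (FX a b)
    have "dot d w (x(i := s)) = w i * s + (\<Sum>k\<in>{..<d} - {i}. w k * x k)" for w s
      unfolding dot_def using \<open>i < d\<close> by (subst sum.remove[of _ i]) auto
    then show ?thesis
      unfolding FX f'_def by (auto intro!: derivative_eq_intros)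
  qed (auto simp: f'_def)
  have "((\<lambda>s. fsval d (x(i := s)) V Y fs) has_real_derivative
      (\<Sum>gs\<leftarrow>hits m fs. fsval d (x(i := s)) ?V Y gs)) (at s)"
    using Cons.prems by (intro Cons.IH) (cases f; auto)
  from DERIV_mult[OF df this]
  have "((\<lambda>s. fsval d (x(i := s)) V Y (f # fs)) has_real_derivative
      f' * fsval d (x(i := s)) V Y fs +
      fval d (x(i := s)) V Y f * (\<Sum>gs\<leftarrow>hits m fs. fsval d (x(i := s)) ?V Y gs)) (at s)"
    by (simp add: mult.commute add.commute)
  moreover have "(\<Sum>gs\<leftarrow>hits m (f # fs). fsval d (x(i := s)) ?V Y gs) =
      f' * fsval d (x(i := s)) V Y fs +
      fval d (x(i := s)) V Y f * (\<Sum>gs\<leftarrow>hits m fs. fsval d (x(i := s)) ?V Y gs)"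
    using dot_unit_vec[OF \<open>i < d\<close>] V Vs
    by (cases f) (auto simp: f'_def o_def sum_list_const_mult)
  ultimately show ?case
    by (simp only:)
qed simp

lemma vnorm_upd_le:
  assumes "\<bar>s - x i\<bar> < 1"
  shows "vnorm d (x(i := s)) \<le> (\<Sum>k<d. \<bar>x k\<bar> + 1)"
  unfolding vnorm_def
  by (rule order_trans[OF L2_set_le_sum_abs], rule sum_mono) (use assms in auto)

section \<open>Time derivatives of the prefactor and of the exponent\<close>

lemma bcoef_has_derivative: "t > 0 \<Longrightarrow> (bcoef has_real_derivative bcoef t - (bcoef t)\<^sup>2) (at t)"
proof -
  assume "t > 0"
  have "(bcoef has_real_derivative - (exp (- t) * (bcoef t)\<^sup>2)) (at t)"
    unfolding bcoef_def[abs_def] using \<open>t > 0\<close>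
    by (auto intro!: derivative_eq_intros simp: power2_eq_square)
  moreover have "exp (- t) = (exp (- t / 2))\<^sup>2"
    by (simp add: power2_eq_square flip: exp_add)
  then have "exp (- t) * (bcoef t)\<^sup>2 = (bcoef t * (exp (- t / 2))\<^sup>2) * bcoef t"
    by (simp only: power2_eq_square mult_ac)
  then have "- (exp (- t) * (bcoef t)\<^sup>2) = bcoef t - (bcoef t)\<^sup>2"
    unfolding bcoef_mult_exp[OF \<open>t > 0\<close>] by (simp add: left_diff_distrib power2_eq_square)
  ultimately show ?thesis
    by (simp only:)
qed

lemma exp_half_has_derivative:
  "((\<lambda>s. exp (- s / 2)) has_real_derivative - exp (- t / 2) / 2) (at t)"
  by (auto intro!: derivative_eq_intros)

lemma bcoef_antimono: "0 < s \<Longrightarrow> s \<le> t \<Longrightarrow> bcoef t \<le> bcoef s"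
  by (simp add: bcoef_def)

lemma lw_has_derivative_t:
  assumes "t > 0"
  defines "e \<equiv> exp (- t / 2)" and "b \<equiv> bcoef t"
  shows "((\<lambda>s. lw d s x y) has_real_derivative
    (e * b / 2 - e * b\<^sup>2) * dot d x y + (b\<^sup>2 - b) / 2 * dot d y y) (at t)"
proof -
  have d1: "((\<lambda>s. exp (- s / 2) * bcoef s) has_real_derivative - e / 2 * b + (b - b\<^sup>2) * e) (at t)"
    unfolding e_def b_def
    using DERIV_mult[OF exp_half_has_derivative bcoef_has_derivative[OF \<open>t > 0\<close>]] by simp
  have d2: "((\<lambda>s. (bcoef s - 1) / 2) has_real_derivative (b - b\<^sup>2) / 2) (at t)"
    unfolding b_def using bcoef_has_derivative[OF \<open>t > 0\<close>] by (auto intro!: derivative_eq_intros)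
  have "((\<lambda>s. lw d s x y) has_real_derivative
      (- e / 2 * b + (b - b\<^sup>2) * e) * dot d x y - (b - b\<^sup>2) / 2 * dot d y y) (at t)"
    unfolding lw_def by (intro DERIV_diff DERIV_cmult_right d1 d2)
  moreover have "(- e / 2 * b + (b - b\<^sup>2) * e) * dot d x y - (b - b\<^sup>2) / 2 * dot d y y =
      (e * b / 2 - e * b\<^sup>2) * dot d x y + (b\<^sup>2 - b) / 2 * dot d y y"
    by (simp add: field_simps)
  ultimately show ?thesis
    by simp
qed

context cloud
begin

lemma vnorm_rvec_le:
  assumes "Y \<in> space S"
  shows "vnorm d (rvec Y p) \<le> 2 * R"
proof (cases p)
  case (Pt a)
  then show ?thesis
    using assms vnorm_supp[of "Y a"] R_nonneg by (auto simp: space_S_iff)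
next
  case (Dif a b)
  then show ?thesis
    using assms vnorm_supp[of "Y a"] vnorm_supp[of "Y b"] vnorm_diff_le[of d "Y a" "Y b"]
    by (auto simp: space_S_iff)
qed

text \<open>A crude local bound whose sole purpose is to justify differentiation under the
  expectation; it does not enter the final constant.\<close>

lemma fsval_bounded:
  "\<exists>C\<ge>0. \<forall>x' Y. vnorm d x' \<le> A \<longrightarrow> Y \<in> space S \<longrightarrow> \<bar>fsval d x' V Y fs\<bar> \<le> C"
proof (induction fs)
  case (Cons f fs)
  have dle: "\<bar>dot d (rvec Y p) u\<bar> \<le> 2 * R * B" if "Y \<in> space S" "vnorm d u \<le> B" for Y u B and p :: "nat rv"
    by (rule order_trans[OF abs_dot_le]) (intro mult_mono vnorm_rvec_le that; use R_nonneg in simp)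
  have "\<exists>C\<ge>0. \<forall>x' Y. vnorm d x' \<le> A \<longrightarrow> Y \<in> space S \<longrightarrow> \<bar>fval d x' V Y f\<bar> \<le> C"
  proof (cases f)
    case (FX a b)
    show ?thesis
      using dle[of _ _ "max A 0" "Dif a b"] R_nonneg
      by (intro exI[of _ "2 * R * max A 0"]) (auto simp: FX le_max_iff_disj)
  next
    case (FV a b i)
    show ?thesis
      using dle[of _ "V i" "vnorm d (V i)" "Dif a b"] R_nonneg
      by (intro exI[of _ "2 * R * vnorm d (V i)"]) (auto simp: FV)
  next
    case (FG p q)
    show ?thesis
      using dle[OF _ vnorm_rvec_le] R_nonneg by (intro exI[of _ "2 * R * (2 * R)"]) (auto simp: FG)
  qed
  then obtain C C' where "C \<ge> 0" "C' \<ge> 0"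
    "\<And>x' Y. vnorm d x' \<le> A \<Longrightarrow> Y \<in> space S \<Longrightarrow> \<bar>fval d x' V Y f\<bar> \<le> C"
    "\<And>x' Y. vnorm d x' \<le> A \<Longrightarrow> Y \<in> space S \<Longrightarrow> \<bar>fsval d x' V Y fs\<bar> \<le> C'"
    using Cons.IH by blast
  then show ?case
    by (intro exI[of _ "C * C'"]) (auto simp: abs_mult intro!: mult_mono)
qed (intro exI[of _ 1]; simp)

lemma fsvals_bounded:
  "\<exists>C\<ge>0. \<forall>x' Y. vnorm d x' \<le> A \<longrightarrow> Y \<in> space S \<longrightarrow> \<bar>\<Sum>gs\<leftarrow>G. fsval d x' V Y gs\<bar> \<le> C"
proof (induction G)
  case (Cons gs G)
  then obtain C C' where "C \<ge> 0" "C' \<ge> 0"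
    "\<And>x' Y. vnorm d x' \<le> A \<Longrightarrow> Y \<in> space S \<Longrightarrow> \<bar>fsval d x' V Y gs\<bar> \<le> C"
    "\<And>x' Y. vnorm d x' \<le> A \<Longrightarrow> Y \<in> space S \<Longrightarrow> \<bar>\<Sum>gs\<leftarrow>G. fsval d x' V Y gs\<bar> \<le> C'"
    using fsval_bounded[of A V gs] by blast
  then show ?case
    by (intro exI[of _ "C + C'"]) (auto intro!: order_trans[OF abs_triangle_ineq] add_mono)
qed (intro exI[of _ 0]; simp)

lemma abs_coord_S: "Y \<in> space S \<Longrightarrow> j < d \<Longrightarrow> \<bar>rvec Y p j\<bar> \<le> 2 * R"
  using abs_coord_le_vnorm[of j d "rvec Y p"] vnorm_rvec_le[of Y p] by linarith

lemma bmeas_fsvals: "(\<lambda>Y. \<Sum>gs\<leftarrow>G. fsval d x V Y gs) \<in> bmeas S"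
  by (rule bmeas_sum_list[OF bmeas_fsval])

lemma abs_lw_le:
  assumes "y \<in> supp d P" "vnorm d x \<le> A" "\<bar>exp (- t / 2) * bcoef t\<bar> \<le> B" "\<bar>bcoef t - 1\<bar> \<le> B'"
  shows "\<bar>lw d t x y\<bar> \<le> B * (A * R) + B' / 2 * R\<^sup>2"
proof -
  have "\<bar>dot d x y\<bar> \<le> A * R"
    using order_trans[OF vnorm_nonneg assms(2)]
    by (intro order_trans[OF abs_dot_le] mult_mono assms vnorm_supp) auto
  then have "\<bar>exp (- t / 2) * bcoef t * dot d x y\<bar> \<le> B * (A * R)"
    unfolding abs_mult[of _ "dot d x y"] using assms(3) by (intro mult_mono) auto
  moreover have "\<bar>dot d y y\<bar> \<le> R\<^sup>2"
    using vnorm_supp[OF assms(1)] by (simp add: dot_self power_mono)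
  then have "\<bar>(bcoef t - 1) / 2 * dot d y y\<bar> \<le> B' / 2 * R\<^sup>2"
    unfolding abs_mult[of _ "dot d y y"] using assms(4) by (intro mult_mono) auto
  ultimately show ?thesis
    unfolding lw_def by linarith
qed

lemma expr_val_has_derivative_x:
  assumes "i < d" "j < d" and m: "m \<notin> set (dirs fs)"
  shows "((\<lambda>s. expr_val t (x(i := s)) V j (n, fs, p)) has_real_derivative
    (\<Sum>gs\<leftarrow>hits m fs. expr_val t x (V(m := unit_vec i)) j (n, gs, p)) +
    exp (- t / 2) * bcoef t * (\<Sum>a<n. expr_val t x (V(m := unit_vec i)) j
      (Suc n, FV (Suc a) 0 m # map (map_factor Suc) fs, map_rv Suc p))) (at (x i))"
proof -
  let ?V = "V(m := unit_vec i)"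
  let ?A = "\<Sum>k<d. \<bar>x k\<bar> + 1"
  let ?k = "exp (- t / 2) * bcoef t"
  have le: "vnorm d (x(i := s)) \<le> ?A" if "\<bar>s - x i\<bar> < 1" for s
    by (rule vnorm_upd_le[of s x i d]) (use that in simp)
  obtain C1 C2 where C1: "C1 \<ge> 0" "\<And>x' Y. vnorm d x' \<le> ?A \<Longrightarrow> Y \<in> space S \<Longrightarrow> \<bar>fsval d x' V Y fs\<bar> \<le> C1"
    and C2: "C2 \<ge> 0"
    "\<And>x' Y. vnorm d x' \<le> ?A \<Longrightarrow> Y \<in> space S \<Longrightarrow> \<bar>\<Sum>gs\<leftarrow>hits m fs. fsval d x' ?V Y gs\<bar> \<le> C2"
    using fsval_bounded[of ?A V fs] fsvals_bounded[of ?A ?V "hits m fs"] by blast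
  define C3 where "C3 = \<bar>?k\<bar> * (?A * R) + \<bar>bcoef t - 1\<bar> / 2 * R\<^sup>2"
  define C where "C = max (max (C1 * (2 * R)) (C2 * (2 * R))) (max C3 (\<bar>?k\<bar> * R))"
  let ?F = "\<lambda>s Y. fsval d (x(i := s)) V Y fs * rvec Y p j"
  let ?F' = "\<lambda>s Y. (\<Sum>gs\<leftarrow>hits m fs. fsval d (x(i := s)) ?V Y gs) * rvec Y p j"
  have "((\<lambda>s. texp n (lw d t (x(i := s))) (?F s)) has_real_derivative
    texp n (lw d t (x(i := x i))) (?F' (x i)) +
    (\<Sum>a<n. texp (Suc n) (lw d t (x(i := x i)))
      (\<lambda>Y. ?F (x i) (\<lambda>a. Y (Suc a)) * (?k * (Y (Suc a) i) - ?k * Y 0 i)))) (at (x i))"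
  proof (rule texp_has_real_derivative[where \<delta> = 1 and C = C and L' = "\<lambda>s y. ?k * y i"])
    show "?F s \<in> bmeas S" for s
      by (rule bmeas_fsval_rvec[OF \<open>j < d\<close>])
    show "?F' (x i) \<in> bmeas S"
      by (rule bmeas_mult[OF bmeas_fsvals bmeas_rvec[OF \<open>j < d\<close>]])
    show "\<bar>?F s Y\<bar> \<le> C" if "\<bar>s - x i\<bar> < 1" "Y \<in> space S" for s Y
    proof -
      have "\<bar>?F s Y\<bar> \<le> C1 * (2 * R)"
        unfolding abs_mult using C1(1)
        by (intro mult_mono C1(2)[OF le] abs_coord_S[OF _ \<open>j < d\<close>] that) auto
      then show ?thesis
        by (simp add: C_def)
    qed
    show "\<bar>?F' s Y\<bar> \<le> C" if "\<bar>s - x i\<bar> < 1" "Y \<in> space S" for s Y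
    proof -
      have "\<bar>?F' s Y\<bar> \<le> C2 * (2 * R)"
        unfolding abs_mult using C2(1)
        by (intro mult_mono C2(2)[OF le] abs_coord_S[OF _ \<open>j < d\<close>] that) auto
      then show ?thesis
        by (simp add: C_def)
    qed
    show "((\<lambda>s. ?F s Y) has_real_derivative ?F' s Y) (at s)" for s Y
      by (rule DERIV_cmult_right[OF fsval_has_derivative[OF \<open>i < d\<close> m]])
    show "lw d t (x(i := s)) \<in> bmeas Q" for s
      by (rule bmeas_lw)
    show "(\<lambda>y. ?k * y i) \<in> bmeas Q"
      by (rule bmeas_mult[OF bmeas_const bmeas_coord_Q[OF \<open>i < d\<close>]])
    show "\<bar>lw d t (x(i := s)) y\<bar> \<le> C" if "\<bar>s - x i\<bar> < 1" "y \<in> space Q" for s y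
    proof -
      have "\<bar>lw d t (x(i := s)) y\<bar> \<le> C3"
        unfolding C3_def using that by (intro abs_lw_le le) auto
      then show ?thesis
        by (simp add: C_def)
    qed
    show "\<bar>?k * y i\<bar> \<le> C" if "y \<in> space Q" for y
    proof -
      have "\<bar>?k * y i\<bar> \<le> \<bar>?k\<bar> * R"
        unfolding abs_mult[of _ "y i"] using that
        by (intro mult_left_mono order_trans[OF abs_coord_le_vnorm[OF \<open>i < d\<close>] vnorm_supp]) auto
      then show ?thesis
        by (simp add: C_def)
    qed
    show "((\<lambda>s. lw d t (x(i := s)) y) has_real_derivative ?k * y i) (at s)" for s y
    proof -
      have "dot d (x(i := s)) y = y i * s + (\<Sum>k\<in>{..<d} - {i}. x k * y k)" for s
        unfolding dot_def using \<open>i < d\<close> by (subst sum.remove[of _ i]) auto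
      then show ?thesis
        unfolding lw_def by (auto intro!: derivative_eq_intros)
    qed
  qed simp
  moreover have "texp n (lw d t x) (?F' (x i)) = (\<Sum>gs\<leftarrow>hits m fs. expr_val t x ?V j (n, gs, p))"
    unfolding expr_val.simps fun_upd_triv
    by (subst texp_sum_list[OF bmeas_fsval_rvec[OF \<open>j < d\<close>] bmeas_lw, symmetric])
      (simp add: sum_list_mult_const)
  moreover have "texp (Suc n) (lw d t x)
      (\<lambda>Y. ?F (x i) (\<lambda>a. Y (Suc a)) * (?k * (Y (Suc a) i) - ?k * Y 0 i)) =
      ?k * expr_val t x ?V j (Suc n, FV (Suc a) 0 m # map (map_factor Suc) fs, map_rv Suc p)" for a
  proof -
    have V: "fsval d x ?V Y fs = fsval d x V Y fs" for Y
      using m by (intro fsval_cong_dirs) auto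
    show ?thesis
      unfolding expr_val.simps texp_cmult[symmetric]
      by (rule texp_cong) (simp add: fsval_map rvec_map V dot_unit_vec[OF \<open>i < d\<close>] algebra_simps)
  qed
  ultimately show ?thesis
    by (simp add: sum_distrib_left)
qed


lemma expr_val_has_derivative_t:
  fixes p :: "nat rv" and fs :: "nat factor list" and n :: nat and V :: "nat \<Rightarrow> vec" and x :: vec
  assumes "t > 0" "j < d"
  defines "e \<equiv> exp (- t / 2)" and "b \<equiv> bcoef t"
    and "up \<equiv> (\<lambda>f. expr_val t x V j (Suc n, f # map (map_factor Suc) fs, map_rv Suc p))"
  shows "((\<lambda>s. expr_val s x V j (n, fs, p)) has_real_derivative
    (e * b / 2 - e * b\<^sup>2) * (\<Sum>a<n. up (FX (Suc a) 0)) +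
    (b\<^sup>2 - b) / 2 * ((\<Sum>a<n. up (FG (Pt (Suc a)) (Pt (Suc a)))) - (\<Sum>a<n. up (FG (Pt 0) (Pt 0))))) (at t)"
proof -
  let ?F = "\<lambda>Y. fsval d x V Y fs * rvec Y p j"
  define l where "l s y = (exp (- s / 2) * bcoef s / 2 - exp (- s / 2) * (bcoef s)\<^sup>2) * dot d x y +
      ((bcoef s)\<^sup>2 - bcoef s) / 2 * dot d y y" for s y
  \<comment> \<open>Within distance \<open>t / 2\<close> of \<open>t\<close> the time stays above
    \<open>t / 2\<close>, and \<open>bcoef\<close> is decreasing.\<close>
  define B where "B = bcoef (t / 2)"
  define X where "X = vnorm d x * R"
  define C3 where "C3 = (B + B\<^sup>2) * X + B\<^sup>2 * R\<^sup>2"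
  obtain C1 where C1: "C1 \<ge> 0" "\<And>Y. Y \<in> space S \<Longrightarrow> \<bar>?F Y\<bar> \<le> C1"
    using bmeas_bound[OF bmeas_fsval_rvec[OF \<open>j < d\<close>]] by metis
  define C where "C = max C1 C3"
  have near: "s > 0" "0 \<le> exp (- s / 2)" "exp (- s / 2) \<le> 1" "1 \<le> bcoef s" "bcoef s \<le> B"
    if "\<bar>s - t\<bar> < t / 2" for s
  proof -
    show "s > 0"
      using that \<open>t > 0\<close> by (simp add: abs_if split: if_splits)
    then show "0 \<le> exp (- s / 2)" "exp (- s / 2) \<le> 1" "1 \<le> bcoef s"
      by (auto intro: bcoef_ge_1)
    show "bcoef s \<le> B"
      unfolding B_def using that \<open>t > 0\<close> by (intro bcoef_antimono) (auto simp: abs_if split: if_splits)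
  qed
  have yb: "\<bar>dot d x y\<bar> \<le> X" "\<bar>dot d y y\<bar> \<le> R\<^sup>2" if "y \<in> supp d P" for y
  proof -
    show "\<bar>dot d x y\<bar> \<le> X"
      unfolding X_def using that by (intro order_trans[OF abs_dot_le] mult_left_mono vnorm_supp) auto
    show "\<bar>dot d y y\<bar> \<le> R\<^sup>2"
      using vnorm_supp[OF that] by (simp add: dot_self power_mono)
  qed
  have X0: "X \<ge> 0"
    unfolding X_def using R_nonneg by simp
  have half_diff: "(u - v) / 2 \<le> w" if "u \<le> w" "1 \<le> v" "0 \<le> w" for u v w :: real
    using that by simp
  have bsq: "bcoef s \<le> (bcoef s)\<^sup>2" "(bcoef s)\<^sup>2 \<le> B\<^sup>2" if "\<bar>s - t\<bar> < t / 2" for s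
    using near[OF that] by (auto simp: power2_eq_square intro: mult_mono)
  have eb: "exp (- s / 2) * bcoef s \<le> B" "exp (- s / 2) * (bcoef s)\<^sup>2 \<le> B\<^sup>2"
    "0 \<le> exp (- s / 2) * bcoef s" "0 \<le> exp (- s / 2) * (bcoef s)\<^sup>2" if "\<bar>s - t\<bar> < t / 2" for s
    using near[OF that] bsq[OF that] mult_mono[of "exp (- s / 2)" 1 "bcoef s" B]
      mult_mono[of "exp (- s / 2)" 1 "(bcoef s)\<^sup>2" "B\<^sup>2"] by auto
  have "((\<lambda>s. texp n (lw d s x) ?F) has_real_derivative
    texp n (lw d t x) (\<lambda>Y. 0) +
    (\<Sum>a<n. texp (Suc n) (lw d t x) (\<lambda>Y. ?F (\<lambda>a. Y (Suc a)) * (l t (Y (Suc a)) - l t (Y 0))))) (at t)"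
  proof (rule texp_has_real_derivative[where \<delta> = "t / 2" and C = C and L' = l and F = "\<lambda>s. ?F" and F' = "\<lambda>s Y. 0"])
    show "?F \<in> bmeas S"
      by (rule bmeas_fsval_rvec[OF \<open>j < d\<close>])
    show "\<bar>?F Y\<bar> \<le> C" if "Y \<in> space S" for Y
      using C1(2)[OF that] by (simp add: C_def)
    show "lw d s x \<in> bmeas Q" for s
      by (rule bmeas_lw)
    show "l t \<in> bmeas Q"
      unfolding l_def[abs_def] by (rule bmeas_add[OF bmeas_mult[OF bmeas_const bmeas_dot_Q(1)] bmeas_mult[OF bmeas_const bmeas_dot_Q(2)]])
    show "\<bar>lw d s x y\<bar> \<le> C" if s: "\<bar>s - t\<bar> < t / 2" and "y \<in> space Q" for s y
    proof -
      have "\<bar>lw d s x y\<bar> \<le> B * X + B\<^sup>2 / 2 * R\<^sup>2"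
        unfolding X_def
      proof (rule abs_lw_le)
        show "\<bar>exp (- s / 2) * bcoef s\<bar> \<le> B" "\<bar>bcoef s - 1\<bar> \<le> B\<^sup>2"
          using near[OF s] bsq[OF s] eb[OF s] by linarith+
      qed (use that in auto)
      also have "\<dots> \<le> C3"
        using X0 by (simp add: C3_def algebra_simps)
      finally show ?thesis
        by (simp add: C_def)
    qed
    show "\<bar>l s y\<bar> \<le> C" if s: "\<bar>s - t\<bar> < t / 2" and "y \<in> space Q" for s y
    proof -
      have y: "y \<in> supp d P"
        using that by simp
      have "\<bar>l s y\<bar> \<le> \<bar>exp (- s / 2) * bcoef s / 2 - exp (- s / 2) * (bcoef s)\<^sup>2\<bar> * \<bar>dot d x y\<bar> +
          \<bar>((bcoef s)\<^sup>2 - bcoef s) / 2\<bar> * \<bar>dot d y y\<bar>"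
        unfolding l_def abs_mult[symmetric] by (rule abs_triangle_ineq)
      also have "\<dots> \<le> (B + B\<^sup>2) * X + B\<^sup>2 * R\<^sup>2"
      proof (intro add_mono mult_mono yb y)
        show "\<bar>exp (- s / 2) * bcoef s / 2 - exp (- s / 2) * (bcoef s)\<^sup>2\<bar> \<le> B + B\<^sup>2"
          using eb[OF s] by linarith
        have nn: "0 \<le> ((bcoef s)\<^sup>2 - bcoef s) / 2"
          using bsq[OF s] by simp
        show "\<bar>((bcoef s)\<^sup>2 - bcoef s) / 2\<bar> \<le> B\<^sup>2"
          unfolding abs_of_nonneg[OF nn] using half_diff[OF bsq(2)[OF s] near(4)[OF s] zero_le_power2] .
      qed (use near[OF s] in auto)
      finally show ?thesis
        by (simp add: C_def C3_def)
    qed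
    show "((\<lambda>s. lw d s x y) has_real_derivative l s y) (at s)" if "\<bar>s - t\<bar> < t / 2" for s y
      unfolding l_def by (rule lw_has_derivative_t[OF near(1)[OF that]])
  qed (use \<open>t > 0\<close> C1 in \<open>auto simp: C_def\<close>)
  moreover have "texp (Suc n) (lw d t x) (\<lambda>Y. ?F (\<lambda>a. Y (Suc a)) * (l t (Y (Suc a)) - l t (Y 0))) =
      (e * b / 2 - e * b\<^sup>2) * up (FX (Suc a) 0) +
      (b\<^sup>2 - b) / 2 * (up (FG (Pt (Suc a)) (Pt (Suc a))) - up (FG (Pt 0) (Pt 0)))" for a
  proof -
    let ?f = "\<lambda>f Y. fsval d x V Y (f # map (map_factor Suc) fs) * rvec Y (map_rv Suc p) j"
    note i = bmeas_fsval_rvec[OF \<open>j < d\<close>]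
    have "texp (Suc n) (lw d t x) (\<lambda>Y. ?F (\<lambda>a. Y (Suc a)) * (l t (Y (Suc a)) - l t (Y 0))) =
      texp (Suc n) (lw d t x) (\<lambda>Y. (e * b / 2 - e * b\<^sup>2) * ?f (FX (Suc a) 0) Y +
        (b\<^sup>2 - b) / 2 * (?f (FG (Pt (Suc a)) (Pt (Suc a))) Y - ?f (FG (Pt 0) (Pt 0)) Y))"
    proof (rule texp_cong)
      fix Y
      have "l t y - l t y' = (e * b / 2 - e * b\<^sup>2) * dot d (\<lambda>i. y i - y' i) x +
          (b\<^sup>2 - b) / 2 * (dot d y y - dot d y' y')" for y y'
        unfolding l_def e_def b_def dot_diff_left dot_commute[of d y x] dot_commute[of d y' x]
        by (simp only: right_diff_distrib)
      then show "?F (\<lambda>a. Y (Suc a)) * (l t (Y (Suc a)) - l t (Y 0)) =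
          (e * b / 2 - e * b\<^sup>2) * ?f (FX (Suc a) 0) Y +
          (b\<^sup>2 - b) / 2 * (?f (FG (Pt (Suc a)) (Pt (Suc a))) Y - ?f (FG (Pt 0) (Pt 0)) Y)"
        unfolding fsval_simps fsval_map rvec_map fval.simps rvec.simps
        by (simp only: right_diff_distrib distrib_left mult_ac)
    qed
    also have "\<dots> = (e * b / 2 - e * b\<^sup>2) * up (FX (Suc a) 0) +
        (b\<^sup>2 - b) / 2 * (up (FG (Pt (Suc a)) (Pt (Suc a))) - up (FG (Pt 0) (Pt 0)))"
      unfolding up_def expr_val.simps
      by (subst texp_add[OF bmeas_mult[OF bmeas_const i] bmeas_mult[OF bmeas_const bmeas_diff[OF i i]] bmeas_lw],
          subst texp_cmult, subst texp_cmult, subst texp_diff[OF i i bmeas_lw]) (rule refl)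
    finally show ?thesis .
  qed
  ultimately show ?thesis
    by (simp only: expr_val.simps sum.distrib sum_subtractf sum_distrib_left[symmetric] texp_const[OF bmeas_lw] add_0_left)
qed

lemma expr_val_linear:
  assumes "j < d" "count (mset (dirs gs)) m = 1"
  shows "(\<Sum>i<d. v i * expr_val t x (V(m := unit_vec i)) j (n, gs, p)) = expr_val t x (V(m := v)) j (n, gs, p)"
proof -
  have b: "(\<lambda>Y. v i * (fsval d x (V(m := unit_vec i)) Y gs * rvec Y p j)) \<in> bmeas S" for i
    by (rule bmeas_mult[OF bmeas_const bmeas_fsval_rvec[OF assms(1)]])
  have "(\<Sum>i<d. v i * expr_val t x (V(m := unit_vec i)) j (n, gs, p)) =
      (\<Sum>i<d. post t x n (\<lambda>Y. v i * (fsval d x (V(m := unit_vec i)) Y gs * rvec Y p j)))"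
    by (simp only: expr_val.simps texp_cmult)
  also have "\<dots> = post t x n (\<lambda>Y. \<Sum>i<d. v i * (fsval d x (V(m := unit_vec i)) Y gs * rvec Y p j))"
    by (rule texp_sum[OF b bmeas_lw, symmetric])
  also have "\<dots> = expr_val t x (V(m := v)) j (n, gs, p)"
    by (simp only: mult.assoc[symmetric] sum_distrib_right[symmetric] fsval_linear[OF assms(2)] expr_val.simps)
  finally show ?thesis .
qed

end

section \<open>The differentiated normal form\<close>

text \<open>The balance behind the estimate. The coefficient supplies \<open>K\<close> powers of
  \<open>exp (- t / 2)\<close>, so \<open>i + K = nX fs + m\<close> provides one for every
  \<open>FX\<close> and one for every space derivative. The bound on \<open>e + p\<close> counts
  powers of \<open>b\<close>: at most one per space derivative and two per time derivative. In the
  radius, the \<open>+ 1\<close> is the vector \<open>w\<close>. Each direction below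
  \<open>m\<close> occurs exactly once, as linearity requires.\<close>

fun tm_ok :: "nat \<Rightarrow> nat \<Rightarrow> nat \<Rightarrow> nat \<Rightarrow> tm \<Rightarrow> bool" where
  "tm_ok K \<rho> q m (Tm r p i e n fs w) \<longleftrightarrow> indices fs \<subseteq> {..<n} \<and> set_rv w \<subseteq> {..<n} \<and>
     mset (dirs fs) = mset [0..<m] \<and> i + K = nX fs + m \<and> e + p \<le> 2 * q + m \<and>
     2 * nX fs + 2 * nG fs + 1 \<le> \<rho> + 2 * q"

lemma tm_ok_dx: "tm_ok K \<rho> q m \<tau> \<Longrightarrow> \<sigma> \<in> set (dx_tm m \<tau>) \<Longrightarrow> tm_ok K \<rho> q (Suc m) \<sigma>"
proof (cases \<tau>)
  case (Tm r p i e n fs w)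
  assume ok: "tm_ok K \<rho> q m \<tau>" and \<sigma>: "\<sigma> \<in> set (dx_tm m \<tau>)"
  consider gs where "gs \<in> set (hits m fs)" "\<sigma> = Tm r p i e n gs w"
    | a where "a < n"
      "\<sigma> = Tm r p (Suc i) (Suc e) (Suc n) (FV (Suc a) 0 m # map (map_factor Suc) fs) (map_rv Suc w)"
    using \<sigma> by (auto simp: Tm)
  then show ?thesis
  proof cases
    case 1
    then show ?thesis
      using ok hits_counts[OF 1(1)] by (auto simp: Tm)
  next
    case 2
    then show ?thesis
      using ok by (auto simp: Tm rv.set_map)
  qed
qed

lemma tm_ok_dt: "tm_ok K \<rho> q m \<tau> \<Longrightarrow> \<sigma> \<in> set (dt_tm \<tau>) \<Longrightarrow> tm_ok K \<rho> (Suc q) m \<sigma>"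
  by (cases \<tau>) (auto simp: Let_def rv.set_map)

primrec dxs :: "nat \<Rightarrow> tm list \<Rightarrow> tm list" where
  "dxs 0 T = T"
| "dxs (Suc m) T = concat (map (dx_tm m) (dxs m T))"

primrec dts :: "nat \<Rightarrow> tm list \<Rightarrow> tm list" where
  "dts 0 T = T"
| "dts (Suc q) T = concat (map dt_tm (dts q T))"

lemma tm_ok_dxs: "(\<And>\<tau>. \<tau> \<in> set T \<Longrightarrow> tm_ok K \<rho> q 0 \<tau>) \<Longrightarrow> \<sigma> \<in> set (dxs m T) \<Longrightarrow> tm_ok K \<rho> q m \<sigma>"
  by (induction m arbitrary: \<sigma>) (auto intro: tm_ok_dx)

lemma tm_ok_dts: "(\<And>\<tau>. \<tau> \<in> set T \<Longrightarrow> tm_ok K \<rho> 0 m \<tau>) \<Longrightarrow> \<sigma> \<in> set (dts q T) \<Longrightarrow> tm_ok K \<rho> q m \<sigma>"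
  by (induction q arbitrary: \<sigma>) (auto intro: tm_ok_dt)

definition monomial_tm :: "monomial \<Rightarrow> tm" where
  "monomial_tm M = (case tr_monomial M of (n, fs, w) \<Rightarrow> Tm 1 0 0 0 n fs w)"

lemma tm_ok_monomial: "admissible_monomial M \<Longrightarrow> tm_ok (K_monomial M) (rho_monomial M) 0 0 (monomial_tm M)"
  using expr_ok_monomial[of M] by (cases "tr_monomial M") (auto simp: monomial_tm_def)

lemma sum_list_upt: "(\<Sum>a\<leftarrow>[0..<n]. f a) = (\<Sum>a<n. f a :: real)"
  by (simp add: interv_sum_list_conv_sum_set_nat atLeast0LessThan)

lemma DERIV_sum_list:
  "(\<And>f. f \<in> set fs \<Longrightarrow> (g f has_real_derivative g' f) F) \<Longrightarrow>
   ((\<lambda>s. \<Sum>f\<leftarrow>fs. g f s) has_real_derivative (\<Sum>f\<leftarrow>fs. g' f)) F"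
  by (induction fs) (auto intro!: derivative_eq_intros)

lemma exp_half_power_has_derivative:
  "((\<lambda>s. exp (- s / 2) ^ i) has_real_derivative - (real i / 2) * exp (- t / 2) ^ i) (at t)"
proof -
  have "((\<lambda>s. exp (- s / 2) ^ i) has_real_derivative real i * (- exp (- t / 2) / 2 * exp (- t / 2) ^ (i - 1))) (at t)"
    using DERIV_power[of "\<lambda>s. exp (- s / 2)" "- exp (- t / 2) / 2" t UNIV i] by (auto intro!: derivative_eq_intros)
  moreover have "real i * (- E / 2 * E ^ (i - 1)) = - (real i / 2) * E ^ i" for E :: real
    by (cases i) auto
  ultimately show ?thesis
    by (simp only:)
qed

lemma bcoef_power_has_derivative:
  assumes "t > 0"
  shows "((\<lambda>s. bcoef s ^ e) has_real_derivative real e * bcoef t ^ e - real e * bcoef t ^ Suc e) (at t)"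
proof -
  have "((\<lambda>s. bcoef s ^ e) has_real_derivative real e * ((bcoef t - (bcoef t)\<^sup>2) * bcoef t ^ (e - 1))) (at t)"
    using DERIV_power[OF bcoef_has_derivative[OF assms], of e] by simp
  moreover have "real e * ((b - b\<^sup>2) * b ^ (e - 1)) = real e * b ^ e - real e * b ^ Suc e" for b :: real
    by (cases e) (auto simp: algebra_simps power2_eq_square)
  ultimately show ?thesis
    by (simp only:)
qed

text \<open>The powers of the exponential and of \<open>b\<close> are abstracted to
  \<open>ki\<close> and \<open>be\<close>, so that only polynomial arithmetic is left.\<close>

lemma product_rule_identity:
  fixes r :: real
  shows "r * c1 * ki * be * E + (- r * i / 2) * c0 * ki * be * E +
      ((r * e) * c0 * ki * be * E + (- r * e) * c0 * ki * (b * be) * E) +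
      ((r / 2) * c0 * (k * ki) * (b * be) * S1 + ((- r) * c0 * (k * ki) * (b * (b * be)) * S1 +
      ((r / 2) * c0 * ki * (b * (b * be)) * S2 + ((- r / 2) * c0 * ki * (b * be) * S2 +
      ((- r / 2) * c0 * ki * (b * (b * be)) * S3 + (r / 2) * c0 * ki * (b * be) * S3))))) =
    ((r * c1 * ki + (- (i / 2) * ki) * (r * c0)) * be + (e * be - e * (b * be)) * (r * c0 * ki)) * E +
      ((k * b / 2 - k * (b * b)) * S1 + ((b * b) - b) / 2 * (S2 - S3)) * (r * c0 * ki * be)"
  by (simp add: algebra_simps add_divide_distrib diff_divide_distrib)

text \<open>\<open>Dx\<close> differentiates along the last list entry first. After reversal the
  direction with index \<open>m\<close> belongs to the derivative taken after \<open>m\<close>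
  others, and consing a vector moves no earlier index. For \<open>replicate k x @ ws\<close> the
  indices below \<open>length ws\<close> are the vectors of \<open>ws\<close> and the remaining ones
  are \<open>x\<close>.\<close>

definition dir_fun :: "vec list \<Rightarrow> nat \<Rightarrow> vec" where
  "dir_fun vs k = rev vs ! k"

context cloud
begin

primrec tval :: "(real \<Rightarrow> real) \<Rightarrow> real \<Rightarrow> vec \<Rightarrow> (nat \<Rightarrow> vec) \<Rightarrow> nat \<Rightarrow> tm \<Rightarrow> real" where
  "tval c t x V j (Tm r p i e n fs w) =
     r * (deriv ^^ p) c t * exp (- t / 2) ^ i * bcoef t ^ e * expr_val t x V j (n, fs, w)"

definition tvals :: "(real \<Rightarrow> real) \<Rightarrow> real \<Rightarrow> vec \<Rightarrow> (nat \<Rightarrow> vec) \<Rightarrow> nat \<Rightarrow> tm list \<Rightarrow> real" where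
  "tvals c t x V j T = (\<Sum>\<tau>\<leftarrow>T. tval c t x V j \<tau>)"

lemma tval_cong_dirs:
  assumes "tm_ok K \<rho> q m \<tau>" "\<And>k. k < m \<Longrightarrow> V k = V' k"
  shows "tval c t x V j \<tau> = tval c t x V' j \<tau>"
proof (cases \<tau>)
  case (Tm r p i e n fs w)
  then have "set (dirs fs) = {0..<m}"
    using assms(1) by (metis mset_eq_setD set_upt tm_ok.simps)
  then have "fsval d x V Y fs = fsval d x V' Y fs" for Y
    using assms(2) by (intro fsval_cong_dirs) auto
  then show ?thesis
    by (simp add: Tm)
qed

lemma tval_has_derivative_x:
  assumes "i' < d" "j < d" "tm_ok K \<rho> q m \<tau>"
  shows "((\<lambda>s. tval c t (x(i' := s)) V j \<tau>) has_real_derivative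
    tvals c t x (V(m := unit_vec i')) j (dx_tm m \<tau>)) (at (x i'))"
proof (cases \<tau>)
  case (Tm r p i e n fs w)
  then have "set (dirs fs) = {0..<m}"
    using assms(3) by (metis mset_eq_setD set_upt tm_ok.simps)
  then have m: "m \<notin> set (dirs fs)"
    by simp
  let ?k = "r * (deriv ^^ p) c t * exp (- t / 2) ^ i * bcoef t ^ e"
  let ?V = "V(m := unit_vec i')"
  let ?g = "\<lambda>a. expr_val t x ?V j (Suc n, FV (Suc a) 0 m # map (map_factor Suc) fs, map_rv Suc w)"
  have 1: "tvals c t x ?V j (map (\<lambda>gs. Tm r p i e n gs w) (hits m fs)) =
      ?k * (\<Sum>gs\<leftarrow>hits m fs. expr_val t x ?V j (n, gs, w))"
    by (simp only: tvals_def map_map o_def tval.simps sum_list_const_mult)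
  have 2: "tvals c t x ?V j (map (\<lambda>a. Tm r p (Suc i) (Suc e) (Suc n) (FV (Suc a) 0 m # map (map_factor Suc) fs)
      (map_rv Suc w)) [0..<n]) = r * (deriv ^^ p) c t * exp (- t / 2) ^ Suc i * bcoef t ^ Suc e * (\<Sum>a<n. ?g a)"
    by (simp only: tvals_def map_map o_def tval.simps sum_list_const_mult sum_list_upt)
  have "tvals c t x ?V j (dx_tm m \<tau>) = ?k * ((\<Sum>gs\<leftarrow>hits m fs. expr_val t x ?V j (n, gs, w)) +
      exp (- t / 2) * bcoef t * (\<Sum>a<n. ?g a))"
    unfolding Tm dx_tm.simps
    by (subst tvals_def, simp only: map_append sum_list_append flip: tvals_def)
      (simp only: 1 2 distrib_left power_Suc mult_ac)
  then show ?thesis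
    unfolding Tm tval.simps
    using DERIV_cmult[OF expr_val_has_derivative_x[OF assms(1,2) m, of t x V n w], of ?k] by (simp only:)
qed

lemma tval_linear:
  assumes "j < d" "tm_ok K \<rho> q (Suc m) \<sigma>"
  shows "(\<Sum>i<d. v i * tval c t x (V(m := unit_vec i)) j \<sigma>) = tval c t x (V(m := v)) j \<sigma>"
proof (cases \<sigma>)
  case (Tm r p i e n fs w)
  have "mset (dirs fs) = mset [0..<Suc m]"
    using assms(2) by (simp add: Tm)
  then have "count (mset (dirs fs)) m = 1"
    by (simp add: not_in_iff[symmetric])
  note lin = expr_val_linear[OF assms(1) this, where v = v and t = t and x = x and V = V and n = n and p = w]
  let ?k = "r * (deriv ^^ p) c t * exp (- t / 2) ^ i * bcoef t ^ e"
  show ?thesis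
    unfolding Tm tval.simps lin[symmetric] mult.left_commute[of "v _" ?k] sum_distrib_left[symmetric] ..
qed

lemma tvals_linear:
  assumes "j < d" "\<And>\<sigma>. \<sigma> \<in> set T \<Longrightarrow> tm_ok K \<rho> q (Suc m) \<sigma>"
  shows "(\<Sum>i<d. v i * tvals c t x (V(m := unit_vec i)) j T) = tvals c t x (V(m := v)) j T"
  using assms(2)
proof (induction T)
  case (Cons \<sigma> T)
  have "(\<Sum>i<d. v i * tvals c t x (V(m := unit_vec i)) j (\<sigma> # T)) =
      (\<Sum>i<d. v i * tval c t x (V(m := unit_vec i)) j \<sigma>) + (\<Sum>i<d. v i * tvals c t x (V(m := unit_vec i)) j T)"
    by (simp only: tvals_def list.map sum_list.Cons distrib_left sum.distrib)
  also have "\<dots> = tval c t x (V(m := v)) j \<sigma> + tvals c t x (V(m := v)) j T"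
    by (simp only: tval_linear[OF assms(1) Cons.prems[OF list.set_intros(1)]]
        Cons.IH[OF Cons.prems[OF list.set_intros(2)]])
  finally show ?case
    by (simp only: tvals_def list.map sum_list.Cons)
qed (simp add: tvals_def)

lemma tvals_append: "tvals c t x V j (T @ T') = tvals c t x V j T + tvals c t x V j T'"
  by (simp add: tvals_def)

lemma tvals_concat: "tvals c t x V j (concat Ts) = (\<Sum>T\<leftarrow>Ts. tvals c t x V j T)"
  by (induction Ts) (simp_all add: tvals_append, simp add: tvals_def)

lemma tvals_has_derivative_x:
  assumes "i < d" "j < d" "\<And>\<tau>. \<tau> \<in> set T \<Longrightarrow> tm_ok K \<rho> q m \<tau>"
  shows "((\<lambda>s. tvals c t (x(i := s)) V j T) has_real_derivative
    tvals c t x (V(m := unit_vec i)) j (concat (map (dx_tm m) T))) (at (x i))"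
  unfolding tvals_concat map_map o_def
  unfolding tvals_def[of _ _ "x(i := _)"]
  by (rule DERIV_sum_list, rule tval_has_derivative_x[OF assms(1,2) assms(3)])

lemma tval_has_derivative_t:
  assumes "t > 0" "j < d" "smooth_pos c"
  shows "((\<lambda>s. tval c s x V j \<tau>) has_real_derivative tvals c t x V j (dt_tm \<tau>)) (at t)"
proof (cases \<tau>)
  case (Tm r p i e n fs w)
  let ?up = "\<lambda>f. expr_val t x V j (Suc n, f # map (map_factor Suc) fs, map_rv Suc w)"
  define k where "k = exp (- t / 2)"
  define b where "b = bcoef t"
  define c0 where "c0 = (deriv ^^ p) c t"
  define c1 where "c1 = (deriv ^^ Suc p) c t"
  define E where "E = expr_val t x V j (n, fs, w)"
  define S1 where "S1 = (\<Sum>a<n. ?up (FX (Suc a) 0))"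
  define S2 where "S2 = (\<Sum>a<n. ?up (FG (Pt (Suc a)) (Pt (Suc a))))"
  define S3 where "S3 = (\<Sum>a<n. ?up (FG (Pt 0) (Pt 0)))"
  have dc: "((deriv ^^ p) c has_real_derivative c1) (at t)"
    using assms(1,3) by (simp add: c1_def smooth_pos_def DERIV_deriv_iff_real_differentiable)
  have dE: "((\<lambda>s. expr_val s x V j (n, fs, w)) has_real_derivative
      (k * b / 2 - k * b\<^sup>2) * S1 + (b\<^sup>2 - b) / 2 * (S2 - S3)) (at t)"
    using expr_val_has_derivative_t[OF assms(1,2), of x V n fs w] unfolding k_def b_def S1_def S2_def S3_def .
  have dk: "((\<lambda>s. exp (- s / 2) ^ i) has_real_derivative - (real i / 2) * k ^ i) (at t)"
    unfolding k_def by (rule exp_half_power_has_derivative)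
  have db: "((\<lambda>s. bcoef s ^ e) has_real_derivative real e * b ^ e - real e * b ^ Suc e) (at t)"
    unfolding b_def by (rule bcoef_power_has_derivative[OF assms(1)])
  have D: "((\<lambda>s. tval c s x V j \<tau>) has_real_derivative
      (((r * c1 * k ^ i + (- (real i / 2) * k ^ i) * (r * c0)) * b ^ e +
       (real e * b ^ e - real e * b ^ Suc e) * (r * c0 * k ^ i)) * E +
       ((k * b / 2 - k * b\<^sup>2) * S1 + (b\<^sup>2 - b) / 2 * (S2 - S3)) * (r * c0 * k ^ i * b ^ e))) (at t)"
    unfolding Tm tval.simps
    using DERIV_mult[OF DERIV_mult[OF DERIV_mult[OF DERIV_cmult[OF dc, of r] dk] db] dE]
    by (simp only: k_def[symmetric] b_def[symmetric] c0_def[symmetric] E_def[symmetric])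
  have T: "tvals c t x V j (map (\<lambda>a. Tm r' p i' e' (Suc n) (f a # map (map_factor Suc) fs) (map_rv Suc w)) [0..<n]) =
      r' * c0 * k ^ i' * b ^ e' * (\<Sum>a<n. ?up (f a))" for r' i' e' f
    by (simp only: tvals_def map_map o_def tval.simps sum_list_const_mult sum_list_upt k_def b_def c0_def)
  have "tvals c t x V j (dt_tm \<tau>) =
      r * c1 * k ^ i * b ^ e * E + (- r * real i / 2) * c0 * k ^ i * b ^ e * E +
      ((r * real e) * c0 * k ^ i * b ^ e * E + (- r * real e) * c0 * k ^ i * b ^ Suc e * E) +
      ((r / 2) * c0 * k ^ Suc i * b ^ Suc e * S1 + ((- r) * c0 * k ^ Suc i * b ^ Suc (Suc e) * S1 +
      ((r / 2) * c0 * k ^ i * b ^ Suc (Suc e) * S2 + ((- r / 2) * c0 * k ^ i * b ^ Suc e * S2 +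
      ((- r / 2) * c0 * k ^ i * b ^ Suc (Suc e) * S3 + (r / 2) * c0 * k ^ i * b ^ Suc e * S3)))))"
    unfolding Tm dt_tm.simps Let_def tvals_append T S1_def[symmetric] S2_def[symmetric] S3_def[symmetric]
    by (simp add: tvals_def k_def b_def c0_def c1_def E_def)
  also have "\<dots> = (((r * c1 * k ^ i + (- (real i / 2) * k ^ i) * (r * c0)) * b ^ e +
       (real e * b ^ e - real e * b ^ Suc e) * (r * c0 * k ^ i)) * E +
       ((k * b / 2 - k * b\<^sup>2) * S1 + (b\<^sup>2 - b) / 2 * (S2 - S3)) * (r * c0 * k ^ i * b ^ e))"
  proof -
    define ki where "ki = k ^ i"
    define be where "be = b ^ e"
    show ?thesis
      unfolding power_Suc ki_def[symmetric] be_def[symmetric] power2_eq_square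
      by (rule product_rule_identity)
  qed
  finally show ?thesis
    using D by (simp only:)
qed

lemma tvals_has_derivative_t:
  assumes "t > 0" "j < d" "smooth_pos c"
  shows "((\<lambda>s. tvals c s x V j T) has_real_derivative tvals c t x V j (concat (map dt_tm T))) (at t)"
  unfolding tvals_concat map_map o_def
  unfolding tvals_def[of _ _ _ _ _ T]
  by (rule DERIV_sum_list, rule tval_has_derivative_t[OF assms])

text \<open>The induction carries the formula at all points \<open>x\<close>, so that it can be
  differentiated again; linearity then replaces the unit vectors by \<open>v\<close>. The zero
  directions at the start are an arbitrary default, since undifferentiated terms mention
  none.\<close>

lemma Dx_eq_tvals:
  assumes "j < d"
    and ok: "\<And>J \<tau>. J < n \<Longrightarrow> \<tau> \<in> set (T J) \<Longrightarrow> tm_ok (K J) (\<rho> J) 0 0 \<tau>"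
    and f: "\<And>z. f z = (\<Sum>J<n. tvals (c J) t z (\<lambda>_ _. 0) j (T J))"
  shows "Dx d f vs x = (\<Sum>J<n. tvals (c J) t x (dir_fun vs) j (dxs (length vs) (T J)))"
    and "i < d \<Longrightarrow> (\<lambda>s. Dx d f vs (x(i := s))) differentiable at (x i)"
proof -
  have der: "((\<lambda>s. \<Sum>J<n. tvals (c J) t (x(i := s)) V j (dxs m (T J))) has_real_derivative
      (\<Sum>J<n. tvals (c J) t x (V(m := unit_vec i)) j (dxs (Suc m) (T J)))) (at (x i))"
    if "i < d" for i x V m
    unfolding dxs.simps(2)
    by (rule DERIV_sum, rule tvals_has_derivative_x[OF that \<open>j < d\<close>], rule tm_ok_dxs[OF ok]) simp_all
  have eq: "Dx d f vs x = (\<Sum>J<n. tvals (c J) t x (dir_fun vs) j (dxs (length vs) (T J)))" for x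
  proof (induction vs arbitrary: x)
    case Nil
    have "tvals (c J) t x (\<lambda>_ _. 0) j (T J) = tvals (c J) t x (dir_fun []) j (T J)" if "J < n" for J
      unfolding tvals_def
      by (intro arg_cong[where f = sum_list] map_cong refl tval_cong_dirs[OF ok[OF that]]) auto
    then show ?case
      by (simp add: f)
  next
    case (Cons v vs)
    let ?m = "length vs" and ?V = "dir_fun vs"
    have "partial i (Dx d f vs) x = (\<Sum>J<n. tvals (c J) t x (?V(?m := unit_vec i)) j (dxs (Suc ?m) (T J)))"
      if "i < d" for i
      unfolding partial_def Cons.IH by (rule DERIV_imp_deriv[OF der[OF that]])
    then have "Dx d f (v # vs) x =
        (\<Sum>i<d. v i * (\<Sum>J<n. tvals (c J) t x (?V(?m := unit_vec i)) j (dxs (Suc ?m) (T J))))"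
      by simp
    also have "\<dots> = (\<Sum>J<n. \<Sum>i<d. v i * tvals (c J) t x (?V(?m := unit_vec i)) j (dxs (Suc ?m) (T J)))"
      unfolding sum_distrib_left by (rule sum.swap)
    also have "\<dots> = (\<Sum>J<n. tvals (c J) t x (?V(?m := v)) j (dxs (Suc ?m) (T J)))"
      by (intro sum.cong refl tvals_linear[OF \<open>j < d\<close>], rule tm_ok_dxs[OF ok]) simp_all
    also have "\<dots> = (\<Sum>J<n. tvals (c J) t x (dir_fun (v # vs)) j (dxs (length (v # vs)) (T J)))"
    proof (rule sum.cong[OF refl])
      fix J assume "J \<in> {..<n}"
      then have "J < n"
        by simp
      have ok': "tm_ok (K J) (\<rho> J) 0 (Suc ?m) \<sigma>" if "\<sigma> \<in> set (dxs (Suc ?m) (T J))" for \<sigma>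
        by (rule tm_ok_dxs[OF ok[OF \<open>J < n\<close>] that])
      have "(?V(?m := v)) k = dir_fun (v # vs) k" if "k < Suc ?m" for k
        using that by (auto simp: dir_fun_def nth_append)
      then show "tvals (c J) t x (?V(?m := v)) j (dxs (Suc ?m) (T J)) =
          tvals (c J) t x (dir_fun (v # vs)) j (dxs (length (v # vs)) (T J))"
        unfolding tvals_def list.size add_Suc_right add_0_right
        by (intro arg_cong[where f = sum_list] map_cong refl tval_cong_dirs[OF ok'])
    qed
    finally show ?case .
  qed
  show "Dx d f vs x = (\<Sum>J<n. tvals (c J) t x (dir_fun vs) j (dxs (length vs) (T J)))"
    by (rule eq)
  show "(\<lambda>s. Dx d f vs (x(i := s))) differentiable at (x i)" if "i < d"
    unfolding eq real_differentiable_def using der[OF that] by (rule exI)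
qed

text \<open>The function \<open>g\<close> agrees with the sum of terms for positive times only.
  Since these form an open set, the agreement passes to every derivative.\<close>

lemma deriv_t_eq_tvals:
  assumes "j < d" and c: "\<And>J. J < n \<Longrightarrow> smooth_pos (c J)"
    and g: "\<And>s. s > 0 \<Longrightarrow> g s = (\<Sum>J<n. tvals (c J) s x V j (T J))"
    and "t > 0"
  shows "(deriv ^^ q) g t = (\<Sum>J<n. tvals (c J) t x V j (dts q (T J)))"
    and "(deriv ^^ q) g differentiable at t"
proof -
  have der: "((\<lambda>s. \<Sum>J<n. tvals (c J) s x V j (dts q (T J))) has_real_derivative
      (\<Sum>J<n. tvals (c J) t x V j (dts (Suc q) (T J)))) (at t)" if "t > 0" for q t
    unfolding dts.simps(2)
    by (rule DERIV_sum, rule tvals_has_derivative_t[OF that \<open>j < d\<close>]) (auto intro: c)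
  have D: "((deriv ^^ q) g has_real_derivative (\<Sum>J<n. tvals (c J) t x V j (dts (Suc q) (T J)))) (at t)"
    if "t > 0" "\<And>s. s > 0 \<Longrightarrow> (deriv ^^ q) g s = (\<Sum>J<n. tvals (c J) s x V j (dts q (T J)))" for q t
    using that by (intro has_field_derivative_transform_within_open[OF der[OF that(1)], of "{0<..}"]) auto
  have eq: "(deriv ^^ q) g t = (\<Sum>J<n. tvals (c J) t x V j (dts q (T J)))" if "t > 0" for q t
    using that
  proof (induction q arbitrary: t)
    case (Suc q)
    then show ?case
      using DERIV_imp_deriv[OF D[OF Suc.prems Suc.IH]] by simp
  qed (simp add: g)
  show "(deriv ^^ q) g t = (\<Sum>J<n. tvals (c J) t x V j (dts q (T J)))"
    by (rule eq[OF \<open>t > 0\<close>])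
  show "(deriv ^^ q) g differentiable at t"
    unfolding real_differentiable_def using D[OF \<open>t > 0\<close> eq] by (rule exI)
qed

end

section \<open>The weighted estimate\<close>

text \<open>Each factor costs a \<open>4\<close> and one power of the product of
  \<open>1 + W / (1 + R)\<^sup>2\<close> over the replicas; by independence the resulting moment is
  an \<open>n\<close>-th power. The \<open>2\<close> belongs to the vector \<open>w\<close>. Neither
  \<open>d\<close>, \<open>x\<close>, \<open>t\<close> nor \<open>R\<close> enters.\<close>

primrec tm_const :: "real \<Rightarrow> (nat \<Rightarrow> real) \<Rightarrow> tm \<Rightarrow> real" where
  "tm_const D A (Tm r p i e n fs w) = 2 * \<bar>r\<bar> * \<bar>A p\<bar> * 4 ^ length fs *
     (2 ^ length fs * (1 + 4 ^ length fs * ((ln D + 1) ^ length fs + real (length fs) ^ length fs))) ^ n"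

text \<open>Directions with index at least \<open>l\<close> will be \<open>x\<close>, so their
  \<open>FV\<close> behaves like an \<open>FX\<close>: it consumes one \<open>exp (- t / 2)\<close>,
  and \<open>radius_exp\<close> counts it twice.\<close>

definition decay_exp :: "nat \<Rightarrow> 'i factor list \<Rightarrow> nat" where
  "decay_exp l fs = nX fs + length (filter (\<lambda>i. l \<le> i) (dirs fs))"

definition radius_exp :: "nat \<Rightarrow> 'i factor list \<Rightarrow> nat" where
  "radius_exp l fs = 2 * nX fs + 2 * nG fs + length (dirs fs) + length (filter (\<lambda>i. l \<le> i) (dirs fs))"

lemma length_filter_dirs:
  assumes "mset (dirs fs) = mset [0..<k + l]"
  shows "length (filter (\<lambda>i. l \<le> i) (dirs fs)) = k" and "length (dirs fs) = k + l"
proof -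
  have "mset (filter (\<lambda>i. l \<le> i) (dirs fs)) = mset (filter (\<lambda>i. l \<le> i) [0..<k + l])"
    using assms by simp
  then have "length (filter (\<lambda>i. l \<le> i) (dirs fs)) = length (filter (\<lambda>i. l \<le> i) [0..<k + l])"
    by (rule mset_eq_length)
  moreover have "[0..<k + l] = [0..<l] @ [l..<k + l]"
    using upt_add_eq_append[of 0 l k] by (simp add: add.commute)
  then have "filter (\<lambda>i. l \<le> i) [0..<k + l] = [l..<k + l]"
    by (simp add: filter_empty_conv)
  ultimately show "length (filter (\<lambda>i. l \<le> i) (dirs fs)) = k"
    by simp
  show "length (dirs fs) = k + l"
    using mset_eq_length[OF assms] by simp
qed

section \<open>Pointwise domination by widths and the final count of powers\<close>

context cloud
begin

lemma width_le_prod: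
  assumes "Y \<in> space S" "a < n"
  shows "width t x (Y a) \<le> (1 + R)\<^sup>2 * (\<Prod>a<n. 1 + width t x (Y a) / (1 + R)\<^sup>2)"
proof -
  have nn: "0 \<le> width t x (Y a) / (1 + R)\<^sup>2" for a
    using assms(1) by (intro divide_nonneg_nonneg width_nonneg) (auto simp: space_S_iff)
  have "1 * (1 + width t x (Y a) / (1 + R)\<^sup>2) \<le>
      (\<Prod>a\<in>{..<n} - {a}. 1 + width t x (Y a) / (1 + R)\<^sup>2) * (1 + width t x (Y a) / (1 + R)\<^sup>2)"
    using nn by (intro mult_right_mono prod_ge_1) (auto simp: add_nonneg_nonneg)
  also have "\<dots> = (\<Prod>a<n. 1 + width t x (Y a) / (1 + R)\<^sup>2)"
    using assms(2) by (subst prod.remove[of "{..<n}" a]) auto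
  finally have "width t x (Y a) / (1 + R)\<^sup>2 \<le> (\<Prod>a<n. 1 + width t x (Y a) / (1 + R)\<^sup>2)"
    by simp
  then show ?thesis
    using R_nonneg by (simp add: pos_divide_le_eq mult.commute)
qed

text \<open>The estimate is made factor by factor. The powers of \<open>exp (- t / 2)\<close> are
  spent on exactly those factors that grow with \<open>x\<close>; all others are bounded by the
  radius of the support.\<close>

lemma abs_fsval_le:
  fixes t :: real
  assumes Y: "Y \<in> space S" and idx: "indices fs \<subseteq> {..<n}"
    and V: "\<And>i. i \<in> set (dirs fs) \<Longrightarrow> i < l \<Longrightarrow> vnorm d (V i) \<le> 1"
      "\<And>i. i \<in> set (dirs fs) \<Longrightarrow> l \<le> i \<Longrightarrow> V i = x"
  defines "\<omega> \<equiv> (\<Prod>a<n. 1 + width t x (Y a) / (1 + R)\<^sup>2)"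
  shows "exp (- t / 2) ^ decay_exp l fs * \<bar>fsval d x V Y fs\<bar> \<le>
    4 ^ length fs * (1 + R) ^ radius_exp l fs * \<omega> ^ length fs"
  using idx V
proof (induction fs)
  case Nil
  then show ?case
    by (simp add: decay_exp_def radius_exp_def)
next
  case (Cons f fs)
  let ?e = "exp (- t / 2)" and ?R = "1 + R"
  have \<omega>: "1 \<le> \<omega>"
    unfolding \<omega>_def using Y
    by (intro prod_ge_1) (auto simp: space_S_iff intro!: divide_nonneg_nonneg width_nonneg)
  have step: "\<exists>a b. decay_exp l (f # fs) = a + decay_exp l fs \<and> radius_exp l (f # fs) = b + radius_exp l fs \<and>
      ?e ^ a * \<bar>fval d x V Y f\<bar> \<le> 4 * ?R ^ b * \<omega>"
  proof -
    have X: "?e ^ 1 * \<bar>dot d (rvec Y (Dif a b)) x\<bar> \<le> 4 * ?R ^ 2 * \<omega>" if "a < n" "b < n" for a b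
    proof -
      have w: "0 \<le> width t x (Y a)" "0 \<le> width t x (Y b)" for a b
        using Y by (auto simp: space_S_iff intro!: width_nonneg)
      have "?e * dot d (rvec Y (Dif a b)) x = width t x (Y b) - width t x (Y a)"
        unfolding exp_dot_diff[symmetric] by (simp add: dot_diff_left dot_commute)
      then have "?e ^ 1 * \<bar>dot d (rvec Y (Dif a b)) x\<bar> = \<bar>width t x (Y b) - width t x (Y a)\<bar>"
        by (metis abs_exp_cancel abs_mult power_one_right)
      \<comment> \<open>Both widths lie between \<open>0\<close> and this bound, hence so does the
        absolute value of their difference.\<close>
      also have "\<dots> \<le> ?R\<^sup>2 * \<omega>"
        using width_le_prod[OF Y that(1), of t x] width_le_prod[OF Y that(2), of t x] w
        unfolding \<omega>_def by (simp add: abs_le_iff) (smt (verit))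
      also have "\<dots> \<le> 4 * (?R\<^sup>2 * \<omega>)"
        using \<omega> by simp
      finally show ?thesis
        by simp
    qed
    have D: "\<bar>dot d (rvec Y p) u\<bar> \<le> 2 * R * B" if "vnorm d u \<le> B" for p :: "nat rv" and u B
      by (rule order_trans[OF abs_dot_le]) (intro mult_mono vnorm_rvec_le that Y; use R_nonneg in simp)
    show ?thesis
    proof (cases f)
      case (FX a b)
      then show ?thesis
        using X[of a b] Cons.prems(1)
        by (intro exI[of _ 1] exI[of _ 2]) (auto simp: decay_exp_def radius_exp_def)
    next
      case (FV a b i)
      show ?thesis
      proof (cases "i < l")
        case True
        then have "\<bar>fval d x V Y f\<bar> \<le> 2 * R * 1"
          using D[of "V i" 1 "Dif a b"] Cons.prems(2)[of i] FV by simp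
        also have "\<dots> \<le> 4 * ?R ^ 1 * 1"
          using R_nonneg by simp
        also have "\<dots> \<le> 4 * ?R ^ 1 * \<omega>"
          using R_nonneg \<omega> by (intro mult_left_mono) auto
        finally show ?thesis
          using True by (intro exI[of _ 0] exI[of _ 1]) (auto simp: FV decay_exp_def radius_exp_def)
      next
        case False
        then have "V i = x"
          using Cons.prems(3)[of i] FV by simp
        then show ?thesis
          using X[of a b] Cons.prems(1) False
          by (intro exI[of _ 1] exI[of _ 2]) (auto simp: FV decay_exp_def radius_exp_def)
      qed
    next
      case (FG p q)
      have "\<bar>fval d x V Y f\<bar> \<le> 2 * R * (2 * R)"
        unfolding FG fval.simps by (rule D[OF vnorm_rvec_le[OF Y]])
      also have "\<dots> = 4 * R ^ 2 * 1"
        by (simp add: power2_eq_square)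
      also have "\<dots> \<le> 4 * ?R ^ 2 * \<omega>"
        using R_nonneg \<omega> by (intro mult_mono power_mono) auto
      finally show ?thesis
        by (intro exI[of _ 0] exI[of _ 2]) (auto simp: FG decay_exp_def radius_exp_def)
    qed
  qed
  then obtain a b where ab: "decay_exp l (f # fs) = a + decay_exp l fs"
      "radius_exp l (f # fs) = b + radius_exp l fs" "?e ^ a * \<bar>fval d x V Y f\<bar> \<le> 4 * ?R ^ b * \<omega>"
    by blast
  have sub: "set (dirs fs) \<subseteq> set (dirs (f # fs))"
    by (cases f) auto
  have IH: "?e ^ decay_exp l fs * \<bar>fsval d x V Y fs\<bar> \<le> 4 ^ length fs * ?R ^ radius_exp l fs * \<omega> ^ length fs"
    using Cons.prems(1) sub by (intro Cons.IH Cons.prems(2,3)) auto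
  have "?e ^ decay_exp l (f # fs) * \<bar>fsval d x V Y (f # fs)\<bar> =
      (?e ^ a * \<bar>fval d x V Y f\<bar>) * (?e ^ decay_exp l fs * \<bar>fsval d x V Y fs\<bar>)"
    by (simp only: ab power_add fsval_simps abs_mult mult_ac)
  also have "\<dots> \<le> (4 * ?R ^ b * \<omega>) * (4 ^ length fs * ?R ^ radius_exp l fs * \<omega> ^ length fs)"
    using R_nonneg \<omega> by (intro mult_mono ab(3) IH) auto
  also have "\<dots> = 4 ^ length (f # fs) * ?R ^ radius_exp l (f # fs) * \<omega> ^ length (f # fs)"
    by (simp only: ab power_add list.size power_Suc mult_ac add_0_right add_Suc_right)
  finally show ?case .
qed

text \<open>The power moves inside the product, and the replicas are independent with equal laws, so
  one single-point moment is raised to the power \<open>n\<close>.\<close>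

lemma texp_width_prod_le:
  assumes "UD d P D" "t > 0"
  shows "post t x n (\<lambda>Y. (\<Prod>a<n. 1 + width t x (Y a) / (1 + R)\<^sup>2) ^ h) \<le>
    (2 ^ h * (1 + 4 ^ h * ((ln D + 1) ^ h + real h ^ h))) ^ n"
proof -
  let ?g = "\<lambda>y. (1 + width t x y / (1 + R)\<^sup>2) ^ h"
  have g: "?g \<in> bmeas Q"
    by (rule bmeas_power[OF bmeas_add[OF bmeas_const bmeas_divide[OF bmeas_width]]])
  have "post t x n (\<lambda>Y. (\<Prod>a<n. 1 + width t x (Y a) / (1 + R)\<^sup>2) ^ h) =
      ((\<integral>y. ?g y * exp (lw d t x y) \<partial>Q) / (\<integral>y. exp (lw d t x y) \<partial>Q)) ^ n"
    unfolding prod_power_distrib by (rule texp_prod[OF g bmeas_lw])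
  also have "\<dots> \<le> (2 ^ h * (1 + 4 ^ h * ((ln D + 1) ^ h + real h ^ h))) ^ n"
  proof (rule power_mono[OF tilted_one_plus_width_moment[OF assms]])
    have "0 \<le> (\<integral>y. ?g y * exp (lw d t x y) \<partial>Q)"
      by (intro integral_nonneg_AE AE_I2 mult_nonneg_nonneg zero_le_power)
        (auto intro!: add_nonneg_nonneg divide_nonneg_nonneg width_nonneg)
    then show "0 \<le> (\<integral>y. ?g y * exp (lw d t x y) \<partial>Q) / (\<integral>y. exp (lw d t x y) \<partial>Q)"
      using Z_pos[OF bmeas_lw, of t x] by simp
  qed
  finally show ?thesis .
qed

text \<open>Testing against a fixed \<open>u\<close> keeps the vector inside one expectation, where
  Cauchy-Schwarz bounds its component along \<open>u\<close> by \<open>2 * R\<close> in every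
  dimension.\<close>

lemma abs_dot_expr_val_le:
  assumes UD: "UD d P D" and "t > 0" and u: "vnorm d u \<le> 1"
    and idx: "indices fs \<subseteq> {..<n}"
    and V: "\<And>i. i \<in> set (dirs fs) \<Longrightarrow> i < l \<Longrightarrow> vnorm d (V i) \<le> 1"
      "\<And>i. i \<in> set (dirs fs) \<Longrightarrow> l \<le> i \<Longrightarrow> V i = x"
  defines "h \<equiv> length fs"
  shows "exp (- t / 2) ^ decay_exp l fs * \<bar>\<Sum>j<d. u j * expr_val t x V j (n, fs, w)\<bar> \<le>
    2 * 4 ^ h * (2 ^ h * (1 + 4 ^ h * ((ln D + 1) ^ h + real h ^ h))) ^ n * (1 + R) ^ Suc (radius_exp l fs)"
proof -
  let ?e = "exp (- t / 2) ^ decay_exp l fs"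
  let ?\<omega> = "\<lambda>Y. \<Prod>a<n. 1 + width t x (Y a) / (1 + R)\<^sup>2"
  let ?k = "4 ^ h * (1 + R) ^ radius_exp l fs * (2 * (1 + R))"
  let ?F = "\<lambda>j Y. ?e * (u j * (fsval d x V Y fs * rvec Y w j))"
  have b: "?F j \<in> bmeas S" if "j \<in> {..<d}" for j
    using that by (intro bmeas_mult[OF bmeas_const bmeas_mult[OF bmeas_const bmeas_fsval_rvec]]) simp
  have \<omega>b: "(\<lambda>Y. ?k * ?\<omega> Y ^ h) \<in> bmeas S"
    by (rule bmeas_mult[OF bmeas_const bmeas_power[OF bmeas_prod[OF
        bmeas_add[OF bmeas_const bmeas_divide[OF bmeas_coord[OF bmeas_width]]]]]])
  have "?e * (\<Sum>j<d. u j * expr_val t x V j (n, fs, w)) = (\<Sum>j<d. post t x n (?F j))"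
    unfolding sum_distrib_left expr_val.simps texp_cmult ..
  also have "\<dots> = post t x n (\<lambda>Y. \<Sum>j<d. ?F j Y)"
    by (rule texp_sum[OF b bmeas_lw, symmetric])
  finally have eq: "?e * (\<Sum>j<d. u j * expr_val t x V j (n, fs, w)) = post t x n (\<lambda>Y. \<Sum>j<d. ?F j Y)" .
  have pw: "\<bar>\<Sum>j<d. ?F j Y\<bar> \<le> ?k * ?\<omega> Y ^ h" if Y: "Y \<in> space S" for Y
  proof -
    have "(\<Sum>j<d. ?F j Y) = (?e * fsval d x V Y fs) * dot d u (rvec Y w)"
      unfolding dot_def sum_distrib_left by (intro sum.cong refl) simp
    then have "\<bar>\<Sum>j<d. ?F j Y\<bar> = (?e * \<bar>fsval d x V Y fs\<bar>) * \<bar>dot d u (rvec Y w)\<bar>"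
      by (simp add: abs_mult)
    also have "\<dots> \<le> (4 ^ h * (1 + R) ^ radius_exp l fs * ?\<omega> Y ^ h) * (2 * (1 + R))"
    proof (rule mult_mono[OF _ _ _ abs_ge_zero])
      show "?e * \<bar>fsval d x V Y fs\<bar> \<le> 4 ^ h * (1 + R) ^ radius_exp l fs * ?\<omega> Y ^ h"
        unfolding h_def by (rule abs_fsval_le[OF Y idx V])
      show "0 \<le> 4 ^ h * (1 + R) ^ radius_exp l fs * ?\<omega> Y ^ h"
        using R_nonneg Y
        by (intro mult_nonneg_nonneg zero_le_power prod_nonneg)
          (auto simp: space_S_iff intro!: add_nonneg_nonneg divide_nonneg_nonneg width_nonneg)
      have "\<bar>dot d u (rvec Y w)\<bar> \<le> 1 * (2 * R)"
        by (rule order_trans[OF abs_dot_le]) (intro mult_mono u vnorm_rvec_le Y; simp)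
      then show "\<bar>dot d u (rvec Y w)\<bar> \<le> 2 * (1 + R)"
        by simp
    qed
    also have "\<dots> = ?k * ?\<omega> Y ^ h"
      by (simp only: mult_ac)
    finally show ?thesis .
  qed
  have "\<bar>post t x n (\<lambda>Y. \<Sum>j<d. ?F j Y)\<bar> \<le> post t x n (\<lambda>Y. ?k * ?\<omega> Y ^ h)"
    by (rule texp_abs_le[OF bmeas_sum[OF b] \<omega>b bmeas_lw pw])
  also have "\<dots> \<le> ?k * (2 ^ h * (1 + 4 ^ h * ((ln D + 1) ^ h + real h ^ h))) ^ n"
    unfolding texp_cmult using R_nonneg by (intro mult_left_mono texp_width_prod_le[OF UD \<open>t > 0\<close>]) simp
  finally have "?e * \<bar>\<Sum>j<d. u j * expr_val t x V j (n, fs, w)\<bar> \<le>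
      ?k * (2 ^ h * (1 + 4 ^ h * ((ln D + 1) ^ h + real h ^ h))) ^ n"
    unfolding eq[symmetric] by (simp add: abs_mult)
  then show ?thesis
    by (simp only: power_Suc mult_ac)
qed

lemma abs_dot_tval_le:
  assumes UD: "UD d P D" and "t > 0" and u: "vnorm d u \<le> 1"
    and ok: "tm_ok K \<rho>0 q (k + l) \<tau>" and "real \<rho>0 \<le> \<rho>"
    and V: "\<And>i. i < l \<Longrightarrow> vnorm d (V i) \<le> 1" "\<And>i. l \<le> i \<Longrightarrow> i < k + l \<Longrightarrow> V i = x"
    and c: "\<And>p. \<bar>(deriv ^^ p) c t\<bar> \<le> A p * exp (- (real K + \<sigma>) * t / 2) * bcoef t powr (\<eta> + real p)"
  shows "\<bar>\<Sum>j<d. u j * tval c t x V j \<tau>\<bar> \<le> tm_const D A \<tau> * (exp (- (\<sigma> + real l) * t / 2) *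
    bcoef t powr (\<eta> + 2 * real q + real k + real l) * (1 + R) powr (\<rho> + 2 * real q + 2 * real k + real l))"
proof (cases \<tau>)
  case (Tm r p i e n fs w)
  let ?E = "exp (- t / 2)"
  define h where "h = length fs"
  define M where "M = 2 * 4 ^ h * (2 ^ h * (1 + 4 ^ h * ((ln D + 1) ^ h + real h ^ h))) ^ n"
  define s where "s = \<bar>\<Sum>j<d. u j * expr_val t x V j (n, fs, w)\<bar>"
  have dirs: "mset (dirs fs) = mset [0..<k + l]"
    using ok by (simp add: Tm)
  have set_dirs: "set (dirs fs) = {0..<k + l}"
    using mset_eq_setD[OF dirs] by simp
  have b1: "bcoef t \<ge> 1"
    by (rule bcoef_ge_1[OF \<open>t > 0\<close>])
  have D1: "D \<ge> 1"
    using UD by (simp add: UD_def)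
  have M0: "0 \<le> M"
    unfolding M_def using D1 by (intro mult_nonneg_nonneg zero_le_power add_nonneg_nonneg) auto
  have dec: "decay_exp l fs = nX fs + k"
    by (simp add: decay_exp_def length_filter_dirs[OF dirs])
  have rad: "radius_exp l fs = 2 * nX fs + 2 * nG fs + l + 2 * k"
    by (simp add: radius_exp_def length_filter_dirs[OF dirs])
  have "?E ^ decay_exp l fs * s \<le> M * (1 + R) ^ Suc (radius_exp l fs)"
    unfolding s_def M_def h_def
    using ok set_dirs V by (intro abs_dot_expr_val_le[OF UD \<open>t > 0\<close> u]) (auto simp: Tm)
  \<comment> \<open>The \<open>+ 1\<close> in the radius invariant pays for this \<open>Suc\<close>,
    which is the factor \<open>1 + R\<close> of the vector \<open>w\<close>.\<close>
  also have "\<dots> \<le> M * (1 + R) ^ (\<rho>0 + 2 * q + 2 * k + l)"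
    using ok R_nonneg M0 unfolding rad by (intro mult_left_mono power_increasing) (auto simp: Tm)
  also have "\<dots> \<le> M * (1 + R) powr (\<rho> + 2 * real q + 2 * real k + real l)"
    using R_nonneg M0 \<open>real \<rho>0 \<le> \<rho>\<close>
    by (intro mult_left_mono) (auto simp: powr_mono simp flip: powr_realpow)
  finally have 1: "?E ^ (nX fs + k) * s \<le> M * (1 + R) powr (\<rho> + 2 * real q + 2 * real k + real l)"
    unfolding dec .
  have Ap: "\<bar>(deriv ^^ p) c t\<bar> \<le> \<bar>A p\<bar> * (exp (- \<sigma> * t / 2) * ?E ^ K * bcoef t powr (\<eta> + real p))"
  proof -
    have "- (real K + \<sigma>) * t / 2 = - \<sigma> * t / 2 + real K * (- t / 2)"
      by (simp add: field_simps)
    then have "exp (- (real K + \<sigma>) * t / 2) = exp (- \<sigma> * t / 2) * ?E ^ K"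
      by (simp only: exp_add exp_of_nat_mult)
    then have "\<bar>(deriv ^^ p) c t\<bar> \<le> A p * (exp (- \<sigma> * t / 2) * ?E ^ K * bcoef t powr (\<eta> + real p))"
      using c[of p] by (simp add: mult.assoc)
    also have "\<dots> \<le> \<bar>A p\<bar> * (exp (- \<sigma> * t / 2) * ?E ^ K * bcoef t powr (\<eta> + real p))"
      by (intro mult_right_mono) auto
    finally show ?thesis .
  qed
  \<comment> \<open>Of the \<open>K + i\<close> available powers of \<open>exp (- t / 2)\<close>,
    \<open>nX fs + k\<close> are spent on the factors that grow with \<open>x\<close>; the remaining
    \<open>l\<close> are the decay in the claim.\<close>
  have ik: "K + i = (nX fs + k) + l" and ep: "e + p \<le> 2 * q + (k + l)"
    using ok by (auto simp: Tm)
  have be: "bcoef t powr (\<eta> + real p) * bcoef t ^ e \<le> bcoef t powr (\<eta> + 2 * real q + real k + real l)"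
  proof -
    have "bcoef t powr (\<eta> + real p) * bcoef t ^ e = bcoef t powr (\<eta> + real p + real e)"
      using b1 by (simp add: powr_add powr_realpow)
    also have "\<dots> \<le> bcoef t powr (\<eta> + 2 * real q + real k + real l)"
      using b1 ep by (intro powr_mono) auto
    finally show ?thesis .
  qed
  have "- (\<sigma> + real l) * t / 2 = - \<sigma> * t / 2 + real l * (- t / 2)"
    by (simp add: field_simps)
  then have El: "exp (- \<sigma> * t / 2) * ?E ^ l = exp (- (\<sigma> + real l) * t / 2)"
    by (simp only: exp_add exp_of_nat_mult)
  have "(\<Sum>j<d. u j * tval c t x V j \<tau>) =
      (r * (deriv ^^ p) c t * ?E ^ i * bcoef t ^ e) * (\<Sum>j<d. u j * expr_val t x V j (n, fs, w))"
    unfolding Tm tval.simps sum_distrib_left by (intro sum.cong refl) (simp only: mult_ac)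
  then have "\<bar>\<Sum>j<d. u j * tval c t x V j \<tau>\<bar> =
      \<bar>r\<bar> * \<bar>(deriv ^^ p) c t\<bar> * ?E ^ i * bcoef t ^ e * s"
    using b1 by (simp add: abs_mult s_def)
  also have "\<dots> \<le> \<bar>r\<bar> * (\<bar>A p\<bar> * (exp (- \<sigma> * t / 2) * ?E ^ K * bcoef t powr (\<eta> + real p))) *
      ?E ^ i * bcoef t ^ e * s"
    using b1 by (intro mult_right_mono mult_left_mono Ap) (auto simp: s_def)
  also have "\<dots> = (\<bar>r\<bar> * \<bar>A p\<bar>) * (exp (- \<sigma> * t / 2) * (?E ^ K * ?E ^ i)) *
      (bcoef t powr (\<eta> + real p) * bcoef t ^ e) * s"
    by (simp only: mult_ac)
  also have "?E ^ K * ?E ^ i = ?E ^ (nX fs + k) * ?E ^ l"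
    unfolding power_add[symmetric] ik ..
  also have "(\<bar>r\<bar> * \<bar>A p\<bar>) * (exp (- \<sigma> * t / 2) * (?E ^ (nX fs + k) * ?E ^ l)) *
      (bcoef t powr (\<eta> + real p) * bcoef t ^ e) * s =
      (\<bar>r\<bar> * \<bar>A p\<bar>) * (exp (- \<sigma> * t / 2) * ?E ^ l) * (bcoef t powr (\<eta> + real p) * bcoef t ^ e) *
      (?E ^ (nX fs + k) * s)"
    by (simp only: mult_ac)
  also have "\<dots> \<le> (\<bar>r\<bar> * \<bar>A p\<bar>) * exp (- (\<sigma> + real l) * t / 2) *
      bcoef t powr (\<eta> + 2 * real q + real k + real l) *
      (M * (1 + R) powr (\<rho> + 2 * real q + 2 * real k + real l))"
    unfolding El using b1
    by (intro mult_mono[OF mult_mono[OF order_refl be] 1]) (auto simp: s_def)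
  also have "\<dots> = (\<bar>r\<bar> * \<bar>A p\<bar> * M) * (exp (- (\<sigma> + real l) * t / 2) *
    bcoef t powr (\<eta> + 2 * real q + real k + real l) * (1 + R) powr (\<rho> + 2 * real q + 2 * real k + real l))"
    by (simp only: mult_ac)
  also have "\<bar>r\<bar> * \<bar>A p\<bar> * M = tm_const D A \<tau>"
    by (simp only: Tm tm_const.simps M_def h_def mult_ac)
  finally show ?thesis .
qed

lemma weighted_repr_estimate:
  assumes UD: "UD d P D" and repr: "weighted_repr d P \<sigma> \<eta> \<rho> N c A B"
  shows "derivs_exist d B"
    and "t > 0 \<Longrightarrow> length ws = l \<Longrightarrow> \<forall>w\<in>set ws. vnorm d w \<le> 1 \<Longrightarrow>
      vnorm d (DtDx d B q t x (replicate k x @ ws)) \<le>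
      (\<Sum>J<length N. \<Sum>\<tau>\<leftarrow>dts q (dxs (k + l) [monomial_tm (N ! J)]). tm_const D (A J) \<tau>) *
      (exp (- (\<sigma> + real l) * t / 2) * bcoef t powr (\<eta> + 2 * real q + real k + real l) *
       (1 + R) powr (\<rho> + 2 * real q + 2 * real k + real l))"
proof -
  let ?T = "\<lambda>J. [monomial_tm (N ! J)]"
  let ?K = "\<lambda>J. K_monomial (N ! J)" and ?\<rho> = "\<lambda>J. rho_monomial (N ! J)"
  have N: "admissible_monomial (N ! J)" "real (?\<rho> J) \<le> \<rho>" "smooth_pos (c J)"
    "\<And>q t. t > 0 \<Longrightarrow> \<bar>(deriv ^^ q) (c J) t\<bar> \<le>
      A J q * exp (- (real (?K J) + \<sigma>) * t / 2) * bcoef t powr (\<eta> + real q)" if "J < length N" for J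
    using repr that by (auto simp: weighted_repr_def)
  have ok: "tm_ok (?K J) (?\<rho> J) 0 0 \<tau>" if "J < length N" "\<tau> \<in> set (?T J)" for J \<tau>
    using tm_ok_monomial[OF N(1)[OF that(1)]] that(2) by simp
  have B: "B t z j = (\<Sum>J<length N. tvals (c J) t z (\<lambda>_ _. 0) j (?T J))" if "t > 0" "j < d" for t z j
  proof -
    have "B t z j = (\<Sum>J<length N. c J t * monomial_val d P t z (N ! J) j)"
      using repr that by (simp add: weighted_repr_def)
    also have "\<dots> = (\<Sum>J<length N. tvals (c J) t z (\<lambda>_ _. 0) j (?T J))"
    proof (rule sum.cong[OF refl])
      fix J assume "J \<in> {..<length N}"
      then have "monomial_val d P t z (N ! J) j = expr_val t z (\<lambda>_ _. 0) j (tr_monomial (N ! J))"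
        using monomial_val_eq[OF N(1) that] by simp
      then show "c J t * monomial_val d P t z (N ! J) j = tvals (c J) t z (\<lambda>_ _. 0) j (?T J)"
        by (cases "tr_monomial (N ! J)") (simp add: tvals_def monomial_tm_def)
    qed
    finally show ?thesis .
  qed
  have Dx: "Dx d (\<lambda>z. B t z j) vs x = (\<Sum>J<length N. tvals (c J) t x (dir_fun vs) j (dxs (length vs) (?T J)))"
    if "t > 0" "j < d" for t j vs x
    by (rule Dx_eq_tvals(1)[OF that(2), where K = ?K and \<rho> = ?\<rho>, OF ok B[OF that]])
  have Dt: "DtDx d B q t x vs j =
      (\<Sum>J<length N. tvals (c J) t x (dir_fun vs) j (dts q (dxs (length vs) (?T J))))"
    and Dt': "(\<lambda>s. DtDx d B q s x vs j) differentiable at t"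
    if "t > 0" "j < d" for q t x vs j
    unfolding DtDx_def
    using deriv_t_eq_tvals[OF that(2) N(3) Dx[OF _ that(2)] that(1), of q] by auto
  show "derivs_exist d B"
    unfolding derivs_exist_def
  proof (intro allI impI conjI)
    fix t x vs j i assume "0 < (t::real)" "j < d" "i < d"
    then show "(\<lambda>s. Dx d (\<lambda>z. B t z j) vs (x(i := s))) differentiable at (x i)"
      by (intro Dx_eq_tvals(2)[where K = ?K and \<rho> = ?\<rho>, OF _ ok B]) auto
  qed (rule Dt')
  assume "t > 0" and ws: "length ws = l" "\<forall>w\<in>set ws. vnorm d w \<le> 1"
  let ?vs = "replicate k x @ ws"
  let ?X = "exp (- (\<sigma> + real l) * t / 2) * bcoef t powr (\<eta> + 2 * real q + real k + real l) *
       (1 + R) powr (\<rho> + 2 * real q + 2 * real k + real l)"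
  define v where "v = DtDx d B q t x ?vs"
  \<comment> \<open>The direction in which the norm of \<open>v\<close> is attained. If
    \<open>v\<close> has norm \<open>0\<close>, division by zero gives \<open>u = 0\<close> and
    \<open>dot d u v\<close> still equals the norm.\<close>
  define u where "u j = v j / vnorm d v" for j
  have u1: "vnorm d u \<le> 1"
    unfolding u_def using vnorm_cmult[of d "inverse (vnorm d v)" v]
    by (cases "vnorm d v = 0") (simp_all add: divide_inverse mult.commute)
  have "vnorm d v = dot d u v"
  proof (cases "vnorm d v = 0")
    case True
    then show ?thesis
      by (simp add: u_def dot_def)
  next
    case False
    then show ?thesis
      using dot_self[of d v]
      by (simp add: u_def[abs_def] dot_def power2_eq_square sum_divide_distrib[symmetric])
  qed
  also have "dot d u v = (\<Sum>j<d. u j * (\<Sum>J<length N. \<Sum>\<tau>\<leftarrow>dts q (dxs (k + l) (?T J)). tval (c J) t x (dir_fun ?vs) j \<tau>))"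
    unfolding dot_def v_def using Dt[OF \<open>t > 0\<close>] ws(1) by (simp add: tvals_def)
  also have "\<dots> = (\<Sum>J<length N. \<Sum>j<d. u j * (\<Sum>\<tau>\<leftarrow>dts q (dxs (k + l) (?T J)). tval (c J) t x (dir_fun ?vs) j \<tau>))"
    unfolding sum_distrib_left by (rule sum.swap)
  also have "\<dots> \<le> (\<Sum>J<length N. (\<Sum>\<tau>\<leftarrow>dts q (dxs (k + l) (?T J)). tm_const D (A J) \<tau>) * ?X)"
  proof (rule sum_mono)
    fix J assume "J \<in> {..<length N}"
    then have J: "J < length N"
      by simp
    have V1: "vnorm d (dir_fun ?vs i) \<le> 1" if "i < l" for i
      using ws that by (simp add: dir_fun_def nth_append) (metis length_rev nth_mem set_rev)
    have V2: "dir_fun ?vs i = x" if "l \<le> i" "i < k + l" for i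
      using ws that by (auto simp: dir_fun_def nth_append)
    have "\<bar>\<Sum>j<d. u j * tval (c J) t x (dir_fun ?vs) j \<tau>\<bar> \<le> tm_const D (A J) \<tau> * ?X"
      if "\<tau> \<in> set (dts q (dxs (k + l) (?T J)))" for \<tau>
      by (rule abs_dot_tval_le[OF UD \<open>t > 0\<close> u1 tm_ok_dts[OF tm_ok_dxs[OF ok[OF J]] that] N(2)[OF J] V1 V2 N(4)[OF J \<open>t > 0\<close>]])
    moreover have "(\<Sum>j<d. u j * (\<Sum>\<tau>\<leftarrow>L. f j \<tau>)) \<le> (\<Sum>\<tau>\<leftarrow>L. g \<tau>) * X"
      if "\<And>\<tau>. \<tau> \<in> set L \<Longrightarrow> \<bar>\<Sum>j<d. u j * f j \<tau>\<bar> \<le> g \<tau> * X" for L :: "tm list" and f g X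
      using that
    proof (induction L)
      case (Cons \<tau> L)
      then have "(\<Sum>j<d. u j * f j \<tau>) \<le> g \<tau> * X" "(\<Sum>j<d. u j * (\<Sum>\<tau>\<leftarrow>L. f j \<tau>)) \<le> (\<Sum>\<tau>\<leftarrow>L. g \<tau>) * X"
        by (auto simp: abs_le_iff)
      then show ?case
        by (simp add: distrib_left distrib_right sum.distrib)
    qed simp
    ultimately show "(\<Sum>j<d. u j * (\<Sum>\<tau>\<leftarrow>dts q (dxs (k + l) (?T J)). tval (c J) t x (dir_fun ?vs) j \<tau>)) \<le>
        (\<Sum>\<tau>\<leftarrow>dts q (dxs (k + l) (?T J)). tm_const D (A J) \<tau>) * ?X"
      by blast
  qed
  also have "\<dots> = (\<Sum>J<length N. \<Sum>\<tau>\<leftarrow>dts q (dxs (k + l) (?T J)). tm_const D (A J) \<tau>) * ?X"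
    by (rule sum_distrib_right[symmetric])
  finally show "vnorm d (DtDx d B q t x ?vs) \<le> (\<Sum>J<length N. \<Sum>\<tau>\<leftarrow>dts q (dxs (k + l) (?T J)). tm_const D (A J) \<tau>) * ?X"
    unfolding v_def .
qed

end

theorem lemma3p11:
  fixes \<sigma> \<eta> \<rho> D_UD :: real
    and N :: "monomial list"
    and A :: "nat \<Rightarrow> nat \<Rightarrow> real"
  assumes "\<sigma> \<ge> 0" and "\<eta> \<ge> 0" and "\<rho> \<ge> 0"
  shows "\<exists>C :: nat \<Rightarrow> nat \<Rightarrow> nat \<Rightarrow> real.
    \<forall>(d::nat) (P\<^sub>0 :: vec measure) (R::real) (c :: nat \<Rightarrow> real \<Rightarrow> real) (B :: real \<Rightarrow> vec \<Rightarrow> vec).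
      d \<ge> 1 \<longrightarrow>
      borel_prob d P\<^sub>0 \<longrightarrow>
      supp d P\<^sub>0 \<subseteq> {y. vnorm d y \<le> R} \<longrightarrow>
      UD d P\<^sub>0 D_UD \<longrightarrow>
      weighted_repr d P\<^sub>0 \<sigma> \<eta> \<rho> N c A B \<longrightarrow>
      derivs_exist d B \<and>
      (\<forall>q k l t x ws. t > 0 \<longrightarrow> length ws = l \<longrightarrow> (\<forall>w\<in>set ws. vnorm d w \<le> 1) \<longrightarrow>
         vnorm d (DtDx d B q t x (replicate k x @ ws)) \<le>
           C q k l * exp (- (\<sigma> + real l) * t / 2)
             * bcoef t powr (\<eta> + 2 * real q + real k + real l)
             * (1 + R) powr (\<rho> + 2 * real q + 2 * real k + real l)) \<and>
      (\<forall>q l t x. t > 0 \<longrightarrow>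
         op_norm d l (DtDx d B q t x) \<le>
           C q 0 l * exp (- (\<sigma> + real l) * t / 2)
             * bcoef t powr (\<eta> + 2 * real q + real l)
             * (1 + R) powr (\<rho> + 2 * real q + real l))"
proof -
  \<comment> \<open>The lists of terms are computed from \<open>N\<close> and the orders alone, so
    \<open>C\<close> is fixed before the dimension, the measure, the radius and the coefficients
    are.\<close>
  define C where "C q k l = (\<Sum>J<length N.
      \<Sum>\<tau>\<leftarrow>dts q (dxs (k + l) [monomial_tm (N ! J)]). tm_const D_UD (A J) \<tau>)" for q k l
  show ?thesis
  proof (intro exI[of _ C] allI impI)
    fix d and P :: "vec measure" and R and c :: "nat \<Rightarrow> real \<Rightarrow> real" and B :: "real \<Rightarrow> vec \<Rightarrow> vec"
    assume "borel_prob d P" "supp d P \<subseteq> {y. vnorm d y \<le> R}"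
      and UD: "UD d P D_UD" and repr: "weighted_repr d P \<sigma> \<eta> \<rho> N c A B"
    then interpret cloud d P R
      by unfold_locales
    have bound: "vnorm d (DtDx d B q t x (replicate k x @ ws)) \<le>
        C q k l * exp (- (\<sigma> + real l) * t / 2) * bcoef t powr (\<eta> + 2 * real q + real k + real l)
        * (1 + R) powr (\<rho> + 2 * real q + 2 * real k + real l)"
      if "t > 0" "length ws = l" "\<forall>w\<in>set ws. vnorm d w \<le> 1" for q k l t x ws
      using weighted_repr_estimate(2)[OF UD repr that, where q = q and k = k and x = x]
      by (simp only: C_def mult.assoc)
    have op: "op_norm d l (DtDx d B q t x) \<le>
        C q 0 l * exp (- (\<sigma> + real l) * t / 2) * bcoef t powr (\<eta> + 2 * real q + real l)
        * (1 + R) powr (\<rho> + 2 * real q + real l)" if "t > 0" for q l t x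
      unfolding op_norm_def
    proof (rule cSUP_least)
      \<comment> \<open>The bound on the supremum needs a nonempty index set; zero vectors are
        admissible for every \<open>l\<close>.\<close>
      have "replicate l (\<lambda>_. 0) \<in> {ws. length ws = l \<and> (\<forall>w\<in>set ws. vnorm d w \<le> 1)}"
        by (simp add: vnorm_def L2_set_def)
      then show "{ws. length ws = l \<and> (\<forall>w\<in>set ws. vnorm d w \<le> 1)} \<noteq> {}"
        by blast
      show "vnorm d (DtDx d B q t x ws) \<le>
          C q 0 l * exp (- (\<sigma> + real l) * t / 2) * bcoef t powr (\<eta> + 2 * real q + real l)
          * (1 + R) powr (\<rho> + 2 * real q + real l)"
        if "ws \<in> {ws. length ws = l \<and> (\<forall>w\<in>set ws. vnorm d w \<le> 1)}" for ws
      proof -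
        have ws: "length ws = l" "\<forall>w\<in>set ws. vnorm d w \<le> 1"
          using that by auto
        show ?thesis
          using bound[OF \<open>t > 0\<close> ws, of q x 0] by simp
      qed
    qed
    show "derivs_exist d B \<and>
      (\<forall>q k l t x ws. t > 0 \<longrightarrow> length ws = l \<longrightarrow> (\<forall>w\<in>set ws. vnorm d w \<le> 1) \<longrightarrow>
         vnorm d (DtDx d B q t x (replicate k x @ ws)) \<le>
           C q k l * exp (- (\<sigma> + real l) * t / 2)
             * bcoef t powr (\<eta> + 2 * real q + real k + real l)
             * (1 + R) powr (\<rho> + 2 * real q + 2 * real k + real l)) \<and>
      (\<forall>q l t x. t > 0 \<longrightarrow>
         op_norm d l (DtDx d B q t x) \<le>
           C q 0 l * exp (- (\<sigma> + real l) * t / 2)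
             * bcoef t powr (\<eta> + 2 * real q + real l)
             * (1 + R) powr (\<rho> + 2 * real q + real l))"
      using weighted_repr_estimate(1)[OF UD repr] bound op by blast
  qed
qed

end
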